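(* Let $1<p<\infty$, $p^{-1}+q^{-1}=1$. Let $\Omega\subset\mathbb{R}^2$ be an open bounded polygonal domain with Lipschitz boundary and let $\mathcal{T}_n$ be a simplicial mesh (triangulation) of $\Omega$ with set of interior faces $\mathcal{F}_n$. Assume $\mu\equiv0$, $\operatorname{div}\boldsymbol\beta\equiv0$, that $\boldsymbol\beta\in L^\infty(\Omega)$ is $\Omega$-filling, and that the in- and outflow boundaries are well separated. Assume additionally that $\boldsymbol\beta|_T\in\mathbb{P}^0(T)\times\mathbb{P}^0(T)$ (i.e. constant) for all $T\in\mathcal{T}_n$, that $[\![\boldsymbol\beta\cdot\boldsymbol n_F]\!]_F=0$ for all $F\in\mathcal{F}_n$, and that the mesh is flow-aligned in the sense that each triangle $T\in\mathcal{T}_n$ has exactly one tangential-flow face $F\subset\partial T$, i.e. exactly one face on which $\boldsymbol\beta|_T\cdot\boldsymbol n_T=0$. Let $\mathbb{V}=W^q_{0,+}(\boldsymbol\beta;\Omega)$ and $$\mathbb{S}_n=\{\phi_n\in\mathbb{V}:-\operatorname{div}(\boldsymbol\beta\phi_n)=\chi_n\ \text{for some }\chi_n\in\mathbb{P}^0(\mathcal{T}_n)\}.$$ Then $$\mathbb{S}_n=\mathbb{P}^1_{\mathrm{conf}}(\mathcal{T}_n):=\{\phi_n\in\mathbb{V}:\phi_n|_T\in\mathbb{P}^1(T)\ \forall T\in\mathcal{T}_n\}.$$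
   Context: $\boldsymbol n$ and $\boldsymbol n_T$ are the unit outward normals on $\partial\Omega$ and $\partial T$; $\boldsymbol n_F$ is a unit normal on $F$. Interior faces are the sets $F=\partial T_1\cap\partial T_2$ of positive length with $T_1\ne T_2$ in $\mathcal{T}_n$; $[\![\cdot]\!]_F=(\cdot)_+-(\cdot)_-$ is the jump across $F$. $\mathbb{P}^k(T)$ denotes polynomials of degree at most $k$ on $T$, and $\mathbb{P}^0(\mathcal{T}_n)=\{w\in L^\infty(\Omega):w|_T\in\mathbb{P}^0(T)\ \forall T\in\mathcal{T}_n\}$. In-/outflow boundary: $\partial\Omega_\mp=\{x\in\partial\Omega:\pm\boldsymbol\beta(x)\cdot\boldsymbol n(x)<0\}$ (well defined up to finitely many points since $\boldsymbol\beta$ is constant on each triangle). Well-separated in- and outflow: $\overline{\partial\Omega_-}\cap\overline{\partial\Omega_+}=\emptyset$. Graph spaces: for $1\le\rho\le\infty$, $W^\rho(\boldsymbol\beta;\Omega)=\{w\in L^\rho(\Omega):\boldsymbol\beta\cdot\nabla w\in L^\rho(\Omega)\}$ (here $\operatorname{div}(\boldsymbol\beta w)=\boldsymbol\beta\cdot\nabla w$ as $\operatorname{div}\boldsymbol\beta\equiv0$). Under well-separated in- and outflow, traces are well defined in $L^\rho(|\boldsymbol\beta\cdot\boldsymbol n|;\partial\Omega)$, and $W^\rho_{0,\pm}(\boldsymbol\beta;\Omega)=\{w\in W^\rho(\boldsymbol\beta;\Omega):w|_{\partial\Omega_\pm}=0\}$. $\Omega$-filling: for $1<\rho<\infty$ there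 exist $z_+,z_-\in W^\infty(\boldsymbol\beta;\Omega)$ with $\|z_+\|_\infty,\|z_-\|_\infty>0$ such that $-\boldsymbol\beta\cdot\nabla z_\pm=\rho$ in $\Omega$ and $z_\pm=0$ on $\partial\Omega_\pm$. (By scaling, this does not depend on $\rho$.) *)

theory Defs
  imports "HOL-Analysis.Analysis"
begin

(* Functions defined almost everywhere are represented by functions on the whole plane. All the
   function spaces below are closed under modification on a null set, and under arbitrary
   modification outside the domain, so equality of such sets is equality of the corresponding
   sets of equivalence classes. *)

section \<open>Lebesgue spaces\<close>

(* Meant for 1 <= rho <= \<infinity>. *)
definition Lp :: "ereal \<Rightarrow> 'a measure \<Rightarrow> ('a \<Rightarrow> 'b::real_normed_vector) set" where
  "Lp \<rho> M = {f \<in> borel_measurable M.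
     if \<rho> = \<infinity> then \<exists>C. AE x in M. norm (f x) \<le> C
     else integrable M (\<lambda>x. norm (f x) powr real_of_ereal \<rho>)}"

section \<open>Distributional divergence\<close>

primrec Ck :: "nat \<Rightarrow> ('a::real_normed_vector \<Rightarrow> real) \<Rightarrow> bool" where
  "Ck 0 f \<longleftrightarrow> continuous_on UNIV f"
| "Ck (Suc k) f \<longleftrightarrow> (\<forall>x. f differentiable (at x)) \<and>
     (\<forall>v. Ck k (\<lambda>x. frechet_derivative f (at x) v))"

definition smooth :: "('a::real_normed_vector \<Rightarrow> real) \<Rightarrow> bool" where
  "smooth f \<longleftrightarrow> (\<forall>k. Ck k f)"

definition test_function :: "'a::real_normed_vector set \<Rightarrow> ('a \<Rightarrow> real) \<Rightarrow> bool" where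
  "test_function \<Omega> \<psi> \<longleftrightarrow> smooth \<psi> \<and>
     compact (closure {x. \<psi> x \<noteq> 0}) \<and> closure {x. \<psi> x \<noteq> 0} \<subseteq> \<Omega>"

definition locally_integrable ::
    "'a::euclidean_space set \<Rightarrow> ('a \<Rightarrow> 'b::{banach, second_countable_topology}) \<Rightarrow> bool" where
  "locally_integrable \<Omega> f \<longleftrightarrow> (\<forall>K. compact K \<and> K \<subseteq> \<Omega> \<longrightarrow> integrable (lebesgue_on K) f)"

(* div u = d in the sense of distributions on \<Omega>;
   frechet_derivative \<psi> (at x) (u x) is u(x) . grad \<psi>(x). *)
definition has_weak_div ::
    "'a::euclidean_space set \<Rightarrow> ('a \<Rightarrow> 'a) \<Rightarrow> ('a \<Rightarrow> real) \<Rightarrow> bool" where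
  "has_weak_div \<Omega> u d \<longleftrightarrow> locally_integrable \<Omega> u \<and> locally_integrable \<Omega> d \<and>
     (\<forall>\<psi>. test_function \<Omega> \<psi> \<longrightarrow>
        (LINT x|lebesgue_on \<Omega>. frechet_derivative \<psi> (at x) (u x)) =
        - (LINT x|lebesgue_on \<Omega>. d x * \<psi> x))"

section \<open>Polygonal Lipschitz domains\<close>

definition lipschitz_boundary :: "(real^2) set \<Rightarrow> bool" where
  "lipschitz_boundary \<Omega> \<longleftrightarrow> (\<forall>x \<in> frontier \<Omega>. \<exists>r > 0. \<exists>(R :: real^2 \<Rightarrow> real^2) (g :: real \<Rightarrow> real) L.
     orthogonal_transformation R \<and> L-lipschitz_on UNIV g \<and>
     \<Omega> \<inter> ball x r = {y \<in> ball x r. R y $ 2 > g (R y $ 1)})"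

(* A segment is given by the pair of its end points. *)
definition segment_partition :: "(real^2) set \<Rightarrow> ((real^2) \<times> (real^2)) set \<Rightarrow> bool" where
  "segment_partition \<Gamma> E \<longleftrightarrow> finite E \<and> (\<forall>(a, b) \<in> E. a \<noteq> b) \<and>
     \<Gamma> = (\<Union>(a, b) \<in> E. closed_segment a b) \<and>
     pairwise (\<lambda>(a, b) (c, d). open_segment a b \<inter> open_segment c d = {}) E"

definition polygonal_lipschitz_domain :: "(real^2) set \<Rightarrow> bool" where
  "polygonal_lipschitz_domain \<Omega> \<longleftrightarrow> \<Omega> \<noteq> {} \<and> open \<Omega> \<and> connected \<Omega> \<and> bounded \<Omega> \<and>
     (\<exists>E. segment_partition (frontier \<Omega>) E) \<and> lipschitz_boundary \<Omega>"

(* Arc length on a finite union of segments \<Gamma>: on each segment of a partition, the image of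
   Lebesgue measure on [0,1] under the affine parametrization, scaled by the length of the segment.
   The result does not depend on the partition. *)
definition arclength :: "(real^2) set \<Rightarrow> (real^2) measure" where
  "arclength \<Gamma> = (let E = SOME E. segment_partition \<Gamma> E in
     distr
       (density (count_space E \<Otimes>\<^sub>M restrict_space lborel {0..1::real})
         (\<lambda>(e, t). ennreal (dist (fst e) (snd e))))
       borel
       (\<lambda>(e, t). (1 - t) *\<^sub>R fst e + t *\<^sub>R snd e))"

section \<open>Normal components on the boundary\<close>

(* \<nu> is the unit outward normal of the open set \<Omega> at a point x where the boundary is flat. *)
definition outward_normal :: "(real^2) set \<Rightarrow> real^2 \<Rightarrow> real^2 \<Rightarrow> bool" where
  "outward_normal \<Omega> x \<nu> \<longleftrightarrow> norm \<nu> = 1 \<and>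
     (\<exists>r > 0. \<Omega> \<inter> ball x r = {y \<in> ball x r. (y - x) \<bullet> \<nu> < 0})"

(* The value at x \<in> frontier \<Omega> of a field that is constant in \<Omega> near x. *)
definition boundary_value :: "(real^2) set \<Rightarrow> (real^2 \<Rightarrow> real^2) \<Rightarrow> real^2 \<Rightarrow> real^2 \<Rightarrow> bool" where
  "boundary_value \<Omega> \<beta> x b \<longleftrightarrow> (\<exists>r > 0. AE y in lebesgue_on (\<Omega> \<inter> ball x r). \<beta> y = b)"

(* \<beta> . n on the boundary of a polygon, for piecewise constant \<beta>. It is set to 0 at the finitely
   many boundary points where it is undefined, which thus belong to neither the inflow
   nor the outflow boundary. *)
definition normal_flux :: "(real^2) set \<Rightarrow> (real^2 \<Rightarrow> real^2) \<Rightarrow> real^2 \<Rightarrow> real" where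
  "normal_flux \<Omega> \<beta> x =
     (if \<exists>b \<nu>. boundary_value \<Omega> \<beta> x b \<and> outward_normal \<Omega> x \<nu>
      then THE c. \<exists>b \<nu>. boundary_value \<Omega> \<beta> x b \<and> outward_normal \<Omega> x \<nu> \<and> c = b \<bullet> \<nu>
      else 0)"

definition inflow_boundary :: "(real^2) set \<Rightarrow> (real^2 \<Rightarrow> real^2) \<Rightarrow> (real^2) set" where
  "inflow_boundary \<Omega> \<beta> = {x \<in> frontier \<Omega>. normal_flux \<Omega> \<beta> x < 0}"

definition outflow_boundary :: "(real^2) set \<Rightarrow> (real^2 \<Rightarrow> real^2) \<Rightarrow> (real^2) set" where
  "outflow_boundary \<Omega> \<beta> = {x \<in> frontier \<Omega>. normal_flux \<Omega> \<beta> x > 0}"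

definition well_separated :: "(real^2) set \<Rightarrow> (real^2 \<Rightarrow> real^2) \<Rightarrow> bool" where
  "well_separated \<Omega> \<beta> \<longleftrightarrow>
     closure (inflow_boundary \<Omega> \<beta>) \<inter> closure (outflow_boundary \<Omega> \<beta>) = {}"

section \<open>Graph spaces and traces\<close>

(* For divergence-free \<beta>: \<beta> . grad w is the distribution div (w \<beta>). *)
definition graph_space :: "ereal \<Rightarrow> (real^2 \<Rightarrow> real^2) \<Rightarrow> (real^2) set \<Rightarrow> (real^2 \<Rightarrow> real) set" where
  "graph_space \<rho> \<beta> \<Omega> = {w \<in> Lp \<rho> (lebesgue_on \<Omega>).
     \<exists>d \<in> Lp \<rho> (lebesgue_on \<Omega>). has_weak_div \<Omega> (\<lambda>x. w x *\<^sub>R \<beta> x) d}"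

definition flux_measure :: "(real^2) set \<Rightarrow> (real^2 \<Rightarrow> real^2) \<Rightarrow> (real^2) measure" where
  "flux_measure \<Omega> \<beta> = density (arclength (frontier \<Omega>)) (\<lambda>x. ennreal \<bar>normal_flux \<Omega> \<beta> x\<bar>)"

(* \<gamma> in L^rho(|\<beta> . n|; frontier \<Omega>) is the trace of w: the integration-by-parts formula
   int_\<Omega> w \<beta> . grad v + (\<beta> . grad w) v = int_(frontier \<Omega>) \<gamma> v \<beta> . n
   determines \<gamma> up to null sets of |\<beta> . n| ds. *)
definition has_trace ::
    "ereal \<Rightarrow> (real^2 \<Rightarrow> real^2) \<Rightarrow> (real^2) set \<Rightarrow> (real^2 \<Rightarrow> real) \<Rightarrow> (real^2 \<Rightarrow> real) \<Rightarrow> bool" where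
  "has_trace \<rho> \<beta> \<Omega> w \<gamma> \<longleftrightarrow> \<gamma> \<in> Lp \<rho> (flux_measure \<Omega> \<beta>) \<and>
     (\<exists>d \<in> Lp \<rho> (lebesgue_on \<Omega>). has_weak_div \<Omega> (\<lambda>x. w x *\<^sub>R \<beta> x) d \<and>
       (\<forall>v. smooth v \<longrightarrow>
          (LINT x|lebesgue_on \<Omega>. w x * frechet_derivative v (at x) (\<beta> x) + d x * v x) =
          (LINT x|arclength (frontier \<Omega>). \<gamma> x * v x * normal_flux \<Omega> \<beta> x)))"

definition graph_space_0out ::
    "ereal \<Rightarrow> (real^2 \<Rightarrow> real^2) \<Rightarrow> (real^2) set \<Rightarrow> (real^2 \<Rightarrow> real) set" where
  "graph_space_0out \<rho> \<beta> \<Omega> = {w \<in> graph_space \<rho> \<beta> \<Omega>. \<exists>\<gamma>. has_trace \<rho> \<beta> \<Omega> w \<gamma> \<and>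
     (AE x in flux_measure \<Omega> \<beta>. x \<in> outflow_boundary \<Omega> \<beta> \<longrightarrow> \<gamma> x = 0)}"

definition graph_space_0in ::
    "ereal \<Rightarrow> (real^2 \<Rightarrow> real^2) \<Rightarrow> (real^2) set \<Rightarrow> (real^2 \<Rightarrow> real) set" where
  "graph_space_0in \<rho> \<beta> \<Omega> = {w \<in> graph_space \<rho> \<beta> \<Omega>. \<exists>\<gamma>. has_trace \<rho> \<beta> \<Omega> w \<gamma> \<and>
     (AE x in flux_measure \<Omega> \<beta>. x \<in> inflow_boundary \<Omega> \<beta> \<longrightarrow> \<gamma> x = 0)}"

(* The clause "not AE z = 0" is the condition that the L^infinity norm of z is positive. *)
definition filling :: "(real^2) set \<Rightarrow> (real^2 \<Rightarrow> real^2) \<Rightarrow> bool" where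
  "filling \<Omega> \<beta> \<longleftrightarrow> (\<forall>\<rho>::real. 1 < \<rho> \<longrightarrow>
     (\<exists>zp \<in> graph_space_0out \<infinity> \<beta> \<Omega>. \<exists>zm \<in> graph_space_0in \<infinity> \<beta> \<Omega>.
        \<not> (AE x in lebesgue_on \<Omega>. zp x = 0) \<and> \<not> (AE x in lebesgue_on \<Omega>. zm x = 0) \<and>
        has_weak_div \<Omega> (\<lambda>x. zp x *\<^sub>R \<beta> x) (\<lambda>_. - \<rho>) \<and>
        has_weak_div \<Omega> (\<lambda>x. zm x *\<^sub>R \<beta> x) (\<lambda>_. - \<rho>)))"

section \<open>Meshes\<close>

(* Conforming triangulation by closed triangles: two triangles meet in a common vertex,
   a common edge, or not at all. *)
definition simplicial_mesh :: "(real^2) set \<Rightarrow> (real^2) set set \<Rightarrow> bool" where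
  "simplicial_mesh \<Omega> \<T> \<longleftrightarrow> finite \<T> \<and> (\<forall>T \<in> \<T>. 2 simplex T) \<and> \<Union>\<T> = closure \<Omega> \<and>
     (\<forall>T\<^sub>1 \<in> \<T>. \<forall>T\<^sub>2 \<in> \<T>. (T\<^sub>1 \<inter> T\<^sub>2) face_of T\<^sub>1 \<and> (T\<^sub>1 \<inter> T\<^sub>2) face_of T\<^sub>2)"

(* F is the interior face between T1 and T2; it has positive length iff it contains a segment. *)
definition interior_face ::
    "(real^2) set set \<Rightarrow> (real^2) set \<Rightarrow> (real^2) set \<Rightarrow> (real^2) set \<Rightarrow> bool" where
  "interior_face \<T> T\<^sub>1 T\<^sub>2 F \<longleftrightarrow> T\<^sub>1 \<in> \<T> \<and> T\<^sub>2 \<in> \<T> \<and> T\<^sub>1 \<noteq> T\<^sub>2 \<and> F = frontier T\<^sub>1 \<inter> frontier T\<^sub>2 \<and>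
     (\<exists>a b. a \<noteq> b \<and> closed_segment a b \<subseteq> F)"

definition unit_normal :: "(real^2) set \<Rightarrow> real^2 \<Rightarrow> bool" where
  "unit_normal F n \<longleftrightarrow> norm n = 1 \<and> (\<forall>x \<in> F. \<forall>y \<in> F. (x - y) \<bullet> n = 0)"

definition const_on :: "(real^2) set \<Rightarrow> (real^2 \<Rightarrow> 'b) \<Rightarrow> 'b \<Rightarrow> bool" where
  "const_on T f c \<longleftrightarrow> (AE x in lebesgue_on T. f x = c)"

definition cell_value :: "(real^2 \<Rightarrow> real^2) \<Rightarrow> (real^2) set \<Rightarrow> real^2" where
  "cell_value \<beta> T = (THE b. const_on T \<beta> b)"

definition normal_jump_free :: "(real^2) set set \<Rightarrow> (real^2 \<Rightarrow> real^2) \<Rightarrow> bool" where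
  "normal_jump_free \<T> \<beta> \<longleftrightarrow> (\<forall>T\<^sub>1 T\<^sub>2 F n. interior_face \<T> T\<^sub>1 T\<^sub>2 F \<and> unit_normal F n \<longrightarrow>
     cell_value \<beta> T\<^sub>1 \<bullet> n - cell_value \<beta> T\<^sub>2 \<bullet> n = 0)"

definition tangential_face :: "(real^2 \<Rightarrow> real^2) \<Rightarrow> (real^2) set \<Rightarrow> (real^2) set \<Rightarrow> bool" where
  "tangential_face \<beta> T F \<longleftrightarrow> F edge_of T \<and>
     (\<forall>x \<in> rel_interior F. \<forall>n. outward_normal (interior T) x n \<longrightarrow> cell_value \<beta> T \<bullet> n = 0)"

definition flow_aligned :: "(real^2) set set \<Rightarrow> (real^2 \<Rightarrow> real^2) \<Rightarrow> bool" where
  "flow_aligned \<T> \<beta> \<longleftrightarrow> (\<forall>T \<in> \<T>. \<exists>!F. tangential_face \<beta> T F)"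

section \<open>Discrete spaces\<close>

definition P0_mesh :: "(real^2) set \<Rightarrow> (real^2) set set \<Rightarrow> (real^2 \<Rightarrow> real) set" where
  "P0_mesh \<Omega> \<T> = {w \<in> Lp \<infinity> (lebesgue_on \<Omega>). \<forall>T \<in> \<T>. \<exists>c. const_on T w c}"

definition S_space ::
    "real \<Rightarrow> (real^2 \<Rightarrow> real^2) \<Rightarrow> (real^2) set \<Rightarrow> (real^2) set set \<Rightarrow> (real^2 \<Rightarrow> real) set" where
  "S_space q \<beta> \<Omega> \<T> = {\<phi> \<in> graph_space_0out (ereal q) \<beta> \<Omega>.
     \<exists>\<eta> \<in> P0_mesh \<Omega> \<T>. has_weak_div \<Omega> (\<lambda>x. \<phi> x *\<^sub>R \<beta> x) (\<lambda>x. - \<eta> x)}"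

definition P1_conf ::
    "real \<Rightarrow> (real^2 \<Rightarrow> real^2) \<Rightarrow> (real^2) set \<Rightarrow> (real^2) set set \<Rightarrow> (real^2 \<Rightarrow> real) set" where
  "P1_conf q \<beta> \<Omega> \<T> = {\<phi> \<in> graph_space_0out (ereal q) \<beta> \<Omega>.
     \<forall>T \<in> \<T>. \<exists>a c. AE x in lebesgue_on T. \<phi> x = a \<bullet> x + c}"

end

theory Submission
  imports Defs
begin

text \<open>
  On a triangle \<open>T\<close> the field is a constant vector \<open>b\<close>. Exactly one edge of \<open>T\<close> is parallel to \<open>b\<close>, so
  \<open>b \<noteq> 0\<close> and all streamlines enter \<open>T\<close> through one of the two other edges and leave it through the
  remaining one. Let \<open>P\<close> be the vertex opposite to the tangential edge, let the exit edge run from \<open>P\<close>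
  to \<open>P + u\<close>, and let \<open>P + u - \<tau> b\<close> be the third vertex. In the coordinates \<open>x = P + s u + t b\<close> the
  triangle is \<open>0 \<le> s \<le> 1\<close>, \<open>- \<tau> s \<le> t \<le> 0\<close>, streamlines are the lines of constant \<open>s\<close>, and the time
  spent in \<open>T\<close> is the linear function \<open>\<tau> s\<close>. This linearity is what flow alignment provides.

  If \<open>div (w \<beta>)\<close> is a constant \<open>D\<close> on \<open>T\<close>, then \<open>w = D t + g(s)\<close> almost everywhere on \<open>T\<close>: testing
  with functions whose derivative along \<open>b\<close> is a difference of two translates shows that \<open>w - D t\<close> is
  invariant under translation along \<open>b\<close> (\<open>cell_profile\<close>). Here \<open>g\<close> is the trace of \<open>w\<close> on the
  exit edge, and the trace on the entry edge is \<open>g(s) - D \<tau> s\<close>. Hence \<open>w\<close> is affine on \<open>T\<close> as soon as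
  \<open>g\<close> is affine, and then both traces are affine.

  Next \<open>g\<close> is compared with what lies behind the exit edge. Since the normal component of the field
  does not jump, a triangle \<open>T'\<close> behind the exit edge has this edge as its entry edge
  (\<open>successor_entry\<close>), and the weak equation across the edge says that \<open>g\<close> equals the entry trace of
  \<open>w\<close> on \<open>T'\<close> (\<open>match_interface\<close>). If there is no such triangle, the exit edge belongs to the outflow
  boundary, where the trace vanishes, so \<open>g = 0\<close> (\<open>match_outflow\<close>). Both statements rest on
  \<open>trace_match\<close>: test functions concentrated near the edge only see the difference of the traces.
  So \<open>w\<close> is affine on \<open>T\<close> if it is affine on the successor \<open>T'\<close>, and the claim follows by induction
  along the chain of successors, provided that no chain returns to its starting point.

  Cycles are excluded by the filling property. The bounded function \<open>z\<close> with \<open>- div (z \<beta>) = \<rho> > 0\<close> has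
  traces as above, and its flux through the exit edge of \<open>T\<close> exceeds its flux through the exit edge of
  the successor \<open>T'\<close> by \<open>\<rho>\<close> times the area of \<open>T'\<close> (\<open>exit_flux_successor\<close>). Therefore this flux
  decreases strictly along a chain, and the induction is on the number of triangles with smaller flux
  (\<open>profile_affine\<close>).

  Conversely, if \<open>\<phi>\<close> is affine on each triangle, its weak divergence is a function \<open>d\<close> by membership in
  the graph space, and testing inside one triangle shows that \<open>d\<close> equals the constant \<open>a \<bullet> b\<close> there, where
  \<open>a\<close> is the gradient of \<open>\<phi>\<close> (\<open>weak_div_of_affine\<close>).
\<close>

section \<open>Smooth functions and bumps\<close>

lemma Ck_SucD: "Ck (Suc k) f \<Longrightarrow> Ck k f"
proof (induction k arbitrary: f)
  case 0
  then show ?case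
    by (auto intro!: differentiable_imp_continuous_on simp: differentiable_on_def)
next
  case (Suc k)
  then show ?case by (metis Ck.simps(2))
qed

lemma Ck_const: "Ck k (\<lambda>x. c)"
proof (induction k arbitrary: c)
  case (Suc k)
  then show ?case by simp
qed simp

lemma Ck_add: "Ck k f \<Longrightarrow> Ck k g \<Longrightarrow> Ck k (\<lambda>x. f x + g x)"
proof (induction k arbitrary: f g)
  case 0
  then show ?case by (auto intro: continuous_intros)
next
  case (Suc k)
  have "frechet_derivative (\<lambda>x. f x + g x) (at x) =
      (\<lambda>v. frechet_derivative f (at x) v + frechet_derivative g (at x) v)" for x
    using Suc.prems
    by (intro frechet_derivative_at[symmetric] has_derivative_add)
       (auto simp: frechet_derivative_works[symmetric])
  then show ?case using Suc by auto
qed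

lemma Ck_mult: "Ck k f \<Longrightarrow> Ck k g \<Longrightarrow> Ck k (\<lambda>x. f x * g x)"
proof (induction k arbitrary: f g)
  case 0
  then show ?case by (auto intro: continuous_intros)
next
  case (Suc k)
  have "frechet_derivative (\<lambda>x. f x * g x) (at x) =
      (\<lambda>v. f x * frechet_derivative g (at x) v + frechet_derivative f (at x) v * g x)" for x
    using Suc.prems
    by (intro frechet_derivative_at[symmetric] has_derivative_mult)
       (auto simp: frechet_derivative_works[symmetric])
  moreover have "Ck k f" "Ck k g" using Suc.prems Ck_SucD by blast+
  ultimately show ?case using Suc by (auto intro!: Ck_add)
qed

lemma Ck_affine_comp:
  assumes "bounded_linear l"
  shows "Ck k f \<Longrightarrow> Ck k (\<lambda>x. f (l x + c))"
proof (induction k arbitrary: f)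
  case 0
  have "continuous_on UNIV (\<lambda>x. l x + c)"
    using assms by (intro continuous_intros linear_continuous_on)
  with 0 show ?case by (auto intro: continuous_on_compose2)
next
  case (Suc k)
  have "((\<lambda>x. f (l x + c)) has_derivative
      (\<lambda>v. frechet_derivative f (at (l x + c)) (l v))) (at x)" for x
  proof (rule has_derivative_compose[of "\<lambda>x. l x + c" l x UNIV f])
    show "((\<lambda>x. l x + c) has_derivative l) (at x)"
      using has_derivative_add[OF bounded_linear_imp_has_derivative[OF assms] has_derivative_const]
      by simp
    show "(f has_derivative frechet_derivative f (at (l x + c))) (at (l x + c))"
      using Suc.prems by (simp add: frechet_derivative_works[symmetric])
  qed
  then have "(\<lambda>x. f (l x + c)) differentiable (at x)"
    "frechet_derivative (\<lambda>x. f (l x + c)) (at x) =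
      (\<lambda>v. frechet_derivative f (at (l x + c)) (l v))" for x
    by (auto intro: frechet_derivative_at[symmetric] differentiableI)
  moreover have "Ck k (\<lambda>x. frechet_derivative f (at (l x + c)) (l v))" for v
    using Suc.IH[of "\<lambda>y. frechet_derivative f (at y) (l v)"] Suc.prems by simp
  ultimately show ?case by simp
qed

lemma Ck_Suc_real:
  assumes "\<And>x. (f has_real_derivative f' x) (at x)" "Ck k f'"
  shows "Ck (Suc k) f"
proof -
  have "frechet_derivative f (at x) = (\<lambda>v. f' x * v)" for x
    using assms(1)[of x] unfolding has_field_derivative_def
    by (intro frechet_derivative_at[symmetric]) simp
  moreover have "f differentiable (at x)" for x
    using assms(1)[of x] unfolding has_field_derivative_def by (auto intro: differentiableI)
  ultimately show ?thesis using assms(2) by (auto intro!: Ck_mult Ck_const)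
qed

text \<open>The functions \<open>x\<^sup>-\<^sup>m exp (- 1 / x)\<close>, extended by zero to \<open>x \<le> 0\<close>. The derivative of each of them is a
  combination of two others, so their smoothness follows by one induction for all \<open>m\<close> at once.\<close>

definition flat_pow :: "nat \<Rightarrow> real \<Rightarrow> real" where
  "flat_pow m x = (if x > 0 then (1 / x) ^ m * exp (- 1 / x) else 0)"

lemma flat_pow_tendsto_0: "(flat_pow m \<longlongrightarrow> 0) (at_right 0)"
proof -
  have "((\<lambda>y::real. y ^ m / exp y) \<longlongrightarrow> 0) at_top" by (rule tendsto_power_div_exp_0)
  then have "((\<lambda>x::real. (inverse x) ^ m / exp (inverse x)) \<longlongrightarrow> 0) (at_right 0)"
    by (rule filterlim_compose[OF _ filterlim_inverse_at_top_right])
  moreover have "\<forall>\<^sub>F x in at_right (0::real). (inverse x) ^ m / exp (inverse x) = flat_pow m x"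
    by (auto simp: eventually_at_filter flat_pow_def field_simps exp_minus)
  ultimately show ?thesis by (rule Lim_transform_eventually)
qed

lemma flat_pow_has_derivative:
  "(flat_pow m has_real_derivative flat_pow (m + 2) x + (- real m) * flat_pow (m + 1) x) (at x)"
proof -
  consider "x > 0" | "x < 0" | "x = 0" by linarith
  then show ?thesis
  proof cases
    case 1
    have "((\<lambda>x. (1 / x) ^ m * exp (- 1 / x)) has_real_derivative
        flat_pow (m + 2) x + (- real m) * flat_pow (m + 1) x) (at x)"
      using 1 by (auto intro!: derivative_eq_intros simp: flat_pow_def)
        (cases m; simp add: field_simps power2_eq_square)
    then show ?thesis
      by (rule has_field_derivative_transform_within_open[where S = "{0<..}"])
        (use 1 in \<open>auto simp: flat_pow_def\<close>)
  next
    case 2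
    have "((\<lambda>x. 0) has_real_derivative
        flat_pow (m + 2) x + (- real m) * flat_pow (m + 1) x) (at x)"
      using 2 by (auto simp: flat_pow_def)
    then show ?thesis
      by (rule has_field_derivative_transform_within_open[where S = "{..<0}"])
        (use 2 in \<open>auto simp: flat_pow_def\<close>)
  next
    case 3
    have "((\<lambda>h. (flat_pow m h - flat_pow m 0) / h) \<longlongrightarrow> 0) (at 0)"
    proof (rule filterlim_split_at)
      show "((\<lambda>h. (flat_pow m h - flat_pow m 0) / h) \<longlongrightarrow> 0) (at_left 0)"
        by (rule Lim_transform_eventually[OF tendsto_const])
          (auto simp: eventually_at_filter flat_pow_def)
      show "((\<lambda>h. (flat_pow m h - flat_pow m 0) / h) \<longlongrightarrow> 0) (at_right 0)"
        by (rule Lim_transform_eventually[OF flat_pow_tendsto_0[of "Suc m"]])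
          (auto simp: eventually_at_filter flat_pow_def)
    qed
    then show ?thesis using 3
      by (simp add: has_field_derivative_iff flat_pow_def)
  qed
qed

lemma Ck_flat_pow: "Ck k (flat_pow m)"
proof (induction k arbitrary: m)
  case 0
  show ?case
    using flat_pow_has_derivative DERIV_isCont by (fastforce intro: continuous_at_imp_continuous_on)
next
  case (Suc k)
  show ?case
    by (rule Ck_Suc_real[OF flat_pow_has_derivative]) (intro Ck_add Ck_mult Ck_const Suc)
qed

text \<open>The factor \<open>Suc n\<close> makes the bumps tend to the indicator function of \<open>(a, b)\<close> as \<open>n\<close> grows, because
  \<open>exp (- 1 / (n y))\<close> tends to 1 for \<open>y > 0\<close>. Thus integrals against bumps determine integrals over intervals.\<close>

definition bump :: "nat \<Rightarrow> real \<Rightarrow> real \<Rightarrow> real \<Rightarrow> real" where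
  "bump n a b x = flat_pow 0 (real (Suc n) * (x - a)) * flat_pow 0 (real (Suc n) * (b - x))"

lemma smooth_mult: "smooth f \<Longrightarrow> smooth g \<Longrightarrow> smooth (\<lambda>x. f x * g x)"
  by (simp add: smooth_def Ck_mult)

lemma smooth_affine_comp:
  "bounded_linear l \<Longrightarrow> smooth f \<Longrightarrow> smooth (\<lambda>x. f (l x + c))"
  by (simp add: smooth_def Ck_affine_comp)

lemma smooth_bump: "smooth (bump n a b)"
proof -
  have "smooth (\<lambda>x. flat_pow 0 (real (Suc n) * x + (- real (Suc n) * a)))"
    "smooth (\<lambda>x. flat_pow 0 ((- real (Suc n)) * x + (real (Suc n) * b)))"
    by (rule smooth_affine_comp[OF bounded_linear_mult_right], simp add: smooth_def Ck_flat_pow)+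
  from smooth_mult[OF this] show ?thesis
    by (simp add: bump_def[abs_def] algebra_simps)
qed

lemma bump_nonneg: "0 \<le> bump n a b x"
  and bump_le_1: "bump n a b x \<le> 1"
  and bump_eq_0_iff: "bump n a b x = 0 \<longleftrightarrow> x \<notin> {a<..<b}"
proof -
  have *: "0 \<le> flat_pow 0 y" "flat_pow 0 y \<le> 1" for y by (auto simp: flat_pow_def)
  then show "0 \<le> bump n a b x" "bump n a b x \<le> 1"
    by (auto simp: bump_def mult_le_one)
  show "bump n a b x = 0 \<longleftrightarrow> x \<notin> {a<..<b}"
    by (auto simp: bump_def flat_pow_def zero_less_mult_iff)
qed

lemma bump_tendsto_indicator: "(\<lambda>n. bump n a b x) \<longlonglongrightarrow> indicator {a<..<b} x"
proof (cases "x \<in> {a<..<b}")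
  case True
  have *: "(\<lambda>n. flat_pow 0 (real (Suc n) * y)) \<longlonglongrightarrow> 1" if "y > 0" for y
  proof -
    have "(\<lambda>n. exp (- (inverse (real (Suc n)) * (1 / y)))) \<longlonglongrightarrow> exp (- (0 * (1 / y)))"
      by (intro tendsto_intros LIMSEQ_inverse_real_of_nat)
    moreover have "exp (- (inverse (real (Suc n)) * (1 / y))) = flat_pow 0 (real (Suc n) * y)" for n
      using that by (simp add: flat_pow_def divide_simps)
    ultimately show ?thesis by simp
  qed
  have "(\<lambda>n. bump n a b x) \<longlonglongrightarrow> 1 * 1"
    unfolding bump_def by (intro tendsto_mult *) (use True in auto)
  then show ?thesis using True by simp
next
  case False
  then have "bump n a b x = 0" for n by (simp add: bump_eq_0_iff)
  then show ?thesis using False by simp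
qed

lemma smooth_antiderivative:
  assumes "smooth f"
  obtains F where "smooth F" "\<And>x. (F has_real_derivative f x) (at x)"
proof -
  have cont: "continuous_on A f" for A
    using assms unfolding smooth_def by (metis Ck.simps(1) continuous_on_subset subset_UNIV)
  have "\<exists>F. \<forall>x. (F has_vector_derivative f x) (at x)"
    using einterval_antiderivative[of "-\<infinity>" "\<infinity>" f] cont[of UNIV]
    by (auto simp: einterval_def continuous_on_eq_continuous_at)
  then obtain F where F: "\<And>x. (F has_real_derivative f x) (at x)"
    by (auto simp: has_real_derivative_iff_has_vector_derivative)
  have "Ck k F" for k
    using Ck_Suc_real[OF F] assms Ck_SucD unfolding smooth_def by blast
  then show thesis using that F by (auto simp: smooth_def)
qed

lemma continuous_on_smooth: "smooth f \<Longrightarrow> continuous_on A f"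
  unfolding smooth_def by (metis Ck.simps(1) continuous_on_subset subset_UNIV)

lemma smooth_differentiable: "smooth f \<Longrightarrow> f differentiable (at x)"
  unfolding smooth_def by (metis Ck.simps(2))

lemma smooth_frechet_derivative: "smooth f \<Longrightarrow> smooth (\<lambda>x. frechet_derivative f (at x) v)"
  unfolding smooth_def by (metis Ck.simps(2))

lemma bump_has_real_derivative: "(bump n a b has_real_derivative deriv (bump n a b) x) (at x)"
  using smooth_differentiable[OF smooth_bump] by (simp add: DERIV_deriv_iff_real_differentiable)

section \<open>Functions with vanishing integrals\<close>

text \<open>Boxes are stable under intersection and generate the Borel sets, so the integral vanishes over every
  Borel set.\<close>

lemma AE_zero_of_box_integrals:
  fixes f :: "'a::euclidean_space \<Rightarrow> real"
  assumes f: "integrable lborel f"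
    and box: "\<And>a b. (LINT x:box a b|lborel. f x) = 0"
  shows "AE x in lborel. f x = 0"
proof (rule sigma_finite_measure.density_zero[OF sigma_finite_lborel f])
  let ?G = "range (\<lambda>(a, b). box a b :: 'a set)"
  have si: "set_integrable lborel A f" if "A \<in> sets lborel" for A
    using f that unfolding set_integrable_def by (rule integrable_mult_indicator[rotated])
  let ?A = "\<lambda>n::nat. box (- (real n *\<^sub>R One)) (real n *\<^sub>R One) :: 'a set"
  have inc: "incseq ?A"
    unfolding incseq_def le_fun_def
  proof (intro allI impI subsetI)
    fix m n x assume mn: "m \<le> n" "x \<in> ?A m"
    have "- real n < x \<bullet> b \<and> x \<bullet> b < real n" if b: "b \<in> Basis" for b
    proof -
      have "- real m < x \<bullet> b" "x \<bullet> b < real m" "real m \<le> real n"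
        using mn b by (auto simp: box_def)
      then show ?thesis by linarith
    qed
    then show "x \<in> ?A n" by (simp add: box_def)
  qed
  have "(\<lambda>n. LINT x:?A n|lborel. f x) \<longlonglongrightarrow> (LINT x:(\<Union>n. ?A n)|lborel. f x)"
    by (rule set_integral_cont_up[OF _ inc]) (simp_all only: si UN_box_eq_UNIV sets_lborel borel_open open_box sets.top open_UNIV)
  then have "(LINT x:(\<Union>n. ?A n)|lborel. f x) = 0"
    by (simp only: box LIMSEQ_const_iff)
  then have UN: "(LINT x:UNIV|lborel. f x) = 0"
    unfolding UN_box_eq_UNIV .
  have stable: "Int_stable ?G" "?G \<subseteq> Pow UNIV" by (auto simp: Int_stable_def box_Int_box)
  fix A :: "'a set" assume "A \<in> sets lborel"
  then have "A \<in> sigma_sets UNIV ?G" by (simp add: borel_eq_box)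
  from stable this show "(LINT x:A|lborel. f x) = 0"
  proof (rule sigma_sets_induct_disjoint)
    fix A assume "A \<in> ?G" then show "(LINT x:A|lborel. f x) = 0" by (auto simp: box)
  next
    fix A assume A: "A \<in> sigma_sets UNIV ?G" "(LINT x:A|lborel. f x) = 0"
    then have "A \<in> sets lborel" by (simp add: borel_eq_box)
    then have "(LINT x:A \<union> (UNIV - A)|lborel. f x) = (LINT x:A|lborel. f x) + (LINT x:UNIV - A|lborel. f x)"
      by (intro set_integral_Un si) auto
    then show "(LINT x:UNIV - A|lborel. f x) = 0"
      using A(2) UN by simp
  next
    fix A :: "nat \<Rightarrow> 'a set"
    assume A: "disjoint_family A" "range A \<subseteq> sigma_sets UNIV ?G" "\<And>i. (LINT x:A i|lborel. f x) = 0"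
    then have "A i \<in> sets lborel" for i by (auto simp: borel_eq_box)
    then have "(LINT x:(\<Union>i. A i)|lborel. f x) = (\<Sum>i. (LINT x:A i|lborel. f x))"
      using A(1) by (intro lebesgue_integral_countable_add si) (auto simp: disjoint_family_on_def)
    then show "(LINT x:(\<Union>i. A i)|lborel. f x) = 0" using A(3) by simp
  next
    show "(LINT x:{}|lborel. f x) = 0" by (simp add: set_lebesgue_integral_def)
  qed
qed

text \<open>Integrability is required only on boxes inside \<open>U\<close>, so that the result applies to functions that may be
  singular at the boundary of \<open>U\<close>; a countable cover of \<open>U\<close> by boxes reduces it to the global version.\<close>

lemma AE_zero_on_open_of_box_integrals:
  fixes f :: "'a::euclidean_space \<Rightarrow> real"
  assumes U: "open U"
    and si: "\<And>a b. cbox a b \<subseteq> U \<Longrightarrow> set_integrable lborel (cbox a b) f"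
    and box: "\<And>a b. cbox a b \<subseteq> U \<Longrightarrow> (LINT x:box a b|lborel. f x) = 0"
  shows "AE x in lborel. x \<in> U \<longrightarrow> f x = 0"
proof -
  obtain D where D: "countable D" "D \<subseteq> Pow U" "\<And>X. X \<in> D \<Longrightarrow> \<exists>a b. X = cbox a b" "\<Union>D = U"
    using open_countable_Union_open_cbox[OF U] by blast
  have "AE x in lborel. x \<in> X \<longrightarrow> f x = 0" if XD: "X \<in> D" for X
  proof -
    obtain a b where X: "X = cbox a b" using D(3)[OF XD] by blast
    with D(2) XD have sub: "cbox a b \<subseteq> U" by blast
    have si': "set_integrable lborel (box a b) f"
      by (rule set_integrable_subset[OF si[OF sub]]) (auto simp: box_subset_cbox)
    have "AE x in lborel. indicator (box a b) x *\<^sub>R f x = 0"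
    proof (rule AE_zero_of_box_integrals)
      show "integrable lborel (\<lambda>x. indicat_real (box a b) x *\<^sub>R f x)"
        using si' by (simp add: set_integrable_def)
      fix c d :: 'a
      obtain c' d' where cd: "box c d \<inter> box a b = box c' d'" using box_Int_box[of c d a b] by blast
      have "(LINT x:box c d|lborel. indicat_real (box a b) x *\<^sub>R f x) = (LINT x:box c' d'|lborel. f x)"
        unfolding set_lebesgue_integral_def cd[symmetric] indicator_inter_arith by (simp add: mult.assoc)
      also have "\<dots> = 0"
      proof (cases "box c' d' = {}")
        case False
        then have "cbox c' d' = closure (box c' d')" by simp
        also have "\<dots> \<subseteq> closure (box a b)" using cd by (intro closure_mono) blast
        also have "\<dots> \<subseteq> cbox a b" by (intro closure_minimal box_subset_cbox closed_cbox)
        finally show ?thesis using box sub by (meson order_trans)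
      qed (simp add: set_lebesgue_integral_def)
      finally show "(LINT x:box c d|lborel. indicat_real (box a b) x *\<^sub>R f x) = 0" .
    qed
    moreover have "AE x in lborel. x \<notin> cbox a b - box a b"
      by (intro AE_not_in) (auto simp: null_sets_def emeasure_lborel_cbox_eq emeasure_Diff
          emeasure_lborel_box_eq box_subset_cbox)
    ultimately show ?thesis by eventually_elim (auto simp: X)
  qed
  then have "AE x in lborel. \<forall>X\<in>D. x \<in> X \<longrightarrow> f x = 0" unfolding AE_ball_countable[OF D(1)] by blast
  then show ?thesis by eventually_elim (use D(4) in auto)
qed

lemma AE_zero_of_bump_integrals_real:
  fixes f :: "real \<Rightarrow> real"
  assumes U: "open U"
    and si: "\<And>a b. {a..b} \<subseteq> U \<Longrightarrow> set_integrable lborel {a..b} f"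
    and bump: "\<And>a b n. a < b \<Longrightarrow> {a..b} \<subseteq> U \<Longrightarrow> (LINT x|lborel. f x * bump n a b x) = 0"
  shows "AE x in lborel. x \<in> U \<longrightarrow> f x = 0"
proof (rule AE_zero_on_open_of_box_integrals[OF U])
  fix a b :: real assume *: "cbox a b \<subseteq> U"
  show "set_integrable lborel (cbox a b) f" using si * by simp
  show "(LINT x:box a b|lborel. f x) = 0"
  proof (cases "a < b")
    case True
    have si': "integrable lborel (\<lambda>x. indicator {a..b} x *\<^sub>R f x)"
      using si * by (simp add: set_integrable_def)
    have eq: "f x * bump n a b x = (indicator {a..b} x *\<^sub>R f x) * bump n a b x" for n x
      by (auto simp: indicator_def bump_eq_0_iff)
    have "(\<lambda>n. LINT x|lborel. f x * bump n a b x) \<longlonglongrightarrow> (LINT x:box a b|lborel. f x)"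
      unfolding set_lebesgue_integral_def eq
    proof (rule integral_dominated_convergence[OF _ _ integrable_norm[OF si']])
      have [measurable]: "bump n a b \<in> borel_measurable borel" for n
        by (intro borel_measurable_continuous_onI continuous_on_smooth smooth_bump)
      have [measurable]: "(\<lambda>x. indicator {a..b} x *\<^sub>R f x) \<in> borel_measurable lborel"
        using si' by (rule borel_measurable_integrable)
      show "(\<lambda>x. indicator {a..b} x *\<^sub>R f x * bump n a b x) \<in> borel_measurable lborel" for n
        by measurable
      show "(\<lambda>x. indicat_real (box a b) x *\<^sub>R f x) \<in> borel_measurable lborel"
      proof -
        have "set_integrable lborel (box a b) f"
        proof (rule set_integrable_subset[OF si[of a b]])
          show "{a..b} \<subseteq> U" using * by simp
          show "box a b \<subseteq> {a..b}" using box_subset_cbox[of a b] by simp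
        qed simp
        then show ?thesis unfolding set_integrable_def by (rule borel_measurable_integrable)
      qed
      show "AE x in lborel. (\<lambda>n. indicator {a..b} x *\<^sub>R f x * bump n a b x)
          \<longlonglongrightarrow> indicat_real (box a b) x *\<^sub>R f x"
      proof (intro AE_I2)
        fix x
        have "(\<lambda>n. indicator {a..b} x *\<^sub>R f x * bump n a b x)
          \<longlonglongrightarrow> (indicator {a..b} x *\<^sub>R f x) * indicator {a<..<b} x"
          by (intro tendsto_intros bump_tendsto_indicator)
        moreover have "(indicator {a..b} x *\<^sub>R f x) * indicator {a<..<b} x = indicat_real (box a b) x *\<^sub>R f x"
          by (auto simp: indicator_def)
        ultimately show "(\<lambda>n. indicator {a..b} x *\<^sub>R f x * bump n a b x)
          \<longlonglongrightarrow> indicat_real (box a b) x *\<^sub>R f x"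
          by (simp only:)
      qed
      show "AE x in lborel. norm (indicator {a..b} x *\<^sub>R f x * bump n a b x) \<le> norm (indicator {a..b} x *\<^sub>R f x)" for n
        using bump_nonneg[of n a b] bump_le_1[of n a b]
        by (intro AE_I2) (auto simp: indicator_def abs_mult intro!: mult_left_le)
    qed
    moreover have "(LINT x|lborel. f x * bump n a b x) = 0" for n
      using bump True * by simp
    ultimately show ?thesis by (simp add: LIMSEQ_const_iff)
  qed (simp add: set_lebesgue_integral_def)
qed

text \<open>Products of bumps suffice as test functions, and they keep their product form in any affine coordinates.\<close>

lemma AE_zero_of_bump_integrals_prod:
  fixes f :: "real \<times> real \<Rightarrow> real"
  assumes U: "open U"
    and si: "\<And>a b c d. {a..b} \<times> {c..d} \<subseteq> U \<Longrightarrow> set_integrable lborel ({a..b} \<times> {c..d}) f"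
    and bump: "\<And>a b c d n. a < b \<Longrightarrow> c < d \<Longrightarrow> {a..b} \<times> {c..d} \<subseteq> U \<Longrightarrow>
      (LINT (s, t)|lborel. f (s, t) * (bump n a b s * bump n c d t)) = 0"
  shows "AE x in lborel. x \<in> U \<longrightarrow> f x = 0"
proof (rule AE_zero_on_open_of_box_integrals[OF U])
  fix l u :: "real \<times> real" assume *: "cbox l u \<subseteq> U"
  obtain a c b d where lu: "l = (a, c)" "u = (b, d)" by (metis surj_pair)
  have cb: "cbox l u = {a..b} \<times> {c..d}" and bx: "box l u = {a<..<b} \<times> {c<..<d}"
    unfolding lu cbox_Pair_eq by (auto simp: box_def Basis_prod_def)
  show "set_integrable lborel (cbox l u) f" using si * unfolding cb by simp
  show "(LINT x:box l u|lborel. f x) = 0"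
  proof (cases "a < b \<and> c < d")
    case True
    let ?B = "\<lambda>n (x::real \<times> real). bump n a b (fst x) * bump n c d (snd x)"
    let ?f = "\<lambda>x. indicator (cbox l u) x *\<^sub>R f x"
    have si': "integrable lborel ?f"
      using si * unfolding cb by (simp add: set_integrable_def)
    have eq: "f x * ?B n x = ?f x * ?B n x" for n x
      unfolding cb by (cases x) (auto simp: indicator_def bump_eq_0_iff)
    have "(\<lambda>n. LINT x|lborel. f x * ?B n x) \<longlonglongrightarrow> (LINT x:box l u|lborel. f x)"
      unfolding set_lebesgue_integral_def eq
    proof (rule integral_dominated_convergence[OF _ _ integrable_norm[OF si']])
      have [measurable]: "bump n p q \<in> borel_measurable borel" for n p q
        by (intro borel_measurable_continuous_onI continuous_on_smooth smooth_bump)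
      have [measurable]: "?f \<in> borel_measurable lborel"
        using si' by (rule borel_measurable_integrable)
      have "?B n \<in> borel_measurable borel" for n
        unfolding borel_prod[symmetric] by measurable
      then have [measurable]: "?B n \<in> borel_measurable lborel" for n by simp
      show "(\<lambda>x. ?f x * ?B n x) \<in> borel_measurable lborel" for n
        by measurable
      have "set_integrable lborel (box l u) f"
      proof (rule set_integrable_subset[OF si[of a b c d]])
        show "{a..b} \<times> {c..d} \<subseteq> U" using * cb by simp
        show "box l u \<subseteq> {a..b} \<times> {c..d}" using box_subset_cbox[of l u] cb by simp
      qed simp
      then show "(\<lambda>x. indicat_real (box l u) x *\<^sub>R f x) \<in> borel_measurable lborel"
        by (auto simp: set_integrable_def intro!: borel_measurable_integrable)
      show "AE x in lborel. (\<lambda>n. ?f x * ?B n x) \<longlonglongrightarrow> indicat_real (box l u) x *\<^sub>R f x"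
      proof (intro AE_I2)
        fix x
        have "(\<lambda>n. ?f x * ?B n x) \<longlonglongrightarrow>
            ?f x * (indicator {a<..<b} (fst x) * indicator {c<..<d} (snd x))"
          by (intro tendsto_intros bump_tendsto_indicator)
        then show "(\<lambda>n. ?f x * ?B n x) \<longlonglongrightarrow> indicat_real (box l u) x *\<^sub>R f x"
          unfolding cb bx by (cases x) (auto simp: indicator_def split: if_splits)
      qed
      show "AE x in lborel. norm (?f x * ?B n x) \<le> norm (?f x)" for n
        using bump_nonneg[of n] bump_le_1[of n]
        by (intro AE_I2) (auto simp: abs_mult intro!: mult_left_le mult_le_one)
    qed
    moreover have "(LINT x|lborel. f x * ?B n x) = 0" for n
      using bump[of a b c d n] True * unfolding cb by (simp add: case_prod_beta')
    ultimately show ?thesis by (simp add: LIMSEQ_const_iff)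
  next
    case False
    then have "box l u = {}" unfolding bx by auto
    then show ?thesis by (simp add: set_lebesgue_integral_def)
  qed
qed

section \<open>Coordinates along the flow\<close>

text \<open>The determinant of the matrix with rows \<open>x\<close> and \<open>y\<close>, that is, twice the signed area of the triangle with vertices
  \<open>0\<close>, \<open>x\<close>, \<open>y\<close>.\<close>

definition cross2 :: "real^2 \<Rightarrow> real^2 \<Rightarrow> real" where
  "cross2 x y = x $ 1 * y $ 2 - x $ 2 * y $ 1"

text \<open>Coordinates of \<open>x = P + s u + t b\<close> by Cramer's rule: \<open>scoord\<close> is \<open>s\<close> and \<open>tcoord\<close> is \<open>t\<close>. With \<open>b\<close> the flow
  direction, \<open>s\<close> numbers the streamlines and \<open>t\<close> is the time along them.\<close>

definition scoord :: "real^2 \<Rightarrow> real^2 \<Rightarrow> real^2 \<Rightarrow> real^2 \<Rightarrow> real" where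
  "scoord P u b x = cross2 (x - P) b / cross2 u b"

definition tcoord :: "real^2 \<Rightarrow> real^2 \<Rightarrow> real^2 \<Rightarrow> real^2 \<Rightarrow> real" where
  "tcoord P u b x = cross2 u (x - P) / cross2 u b"

definition frame_pt :: "real^2 \<Rightarrow> real^2 \<Rightarrow> real^2 \<Rightarrow> real \<times> real \<Rightarrow> real^2" where
  "frame_pt P u b = (\<lambda>(s, t). P + s *\<^sub>R u + t *\<^sub>R b)"

lemma vec2_eq_iff: "(x::real^2) = y \<longleftrightarrow> x $ 1 = y $ 1 \<and> x $ 2 = y $ 2"
  by (simp add: vec_eq_iff forall_2)

lemma cross2_simps [simp]:
  "cross2 0 y = 0" "cross2 x 0 = 0" "cross2 x x = 0"
  "cross2 (- x) y = - cross2 x y" "cross2 x (- y) = - cross2 x y"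
  "cross2 (c *\<^sub>R x) y = c * cross2 x y" "cross2 x (c *\<^sub>R y) = c * cross2 x y"
  by (auto simp: cross2_def algebra_simps)

lemma cross2_add: "cross2 (x + y) z = cross2 x z + cross2 y z" "cross2 z (x + y) = cross2 z x + cross2 z y"
  and cross2_diff: "cross2 (x - y) z = cross2 x z - cross2 y z" "cross2 z (x - y) = cross2 z x - cross2 z y"
  by (auto simp: cross2_def algebra_simps)

lemma cross2_commute: "cross2 x y = - cross2 y x"
  by (simp add: cross2_def)

lemma bounded_linear_cross2: "bounded_linear (\<lambda>x. cross2 x y)" "bounded_linear (\<lambda>x. cross2 y x)"
  unfolding linear_conv_bounded_linear[symmetric]
  by (auto intro!: linearI simp: cross2_def algebra_simps)

lemma frame_coords:
  assumes "cross2 u b \<noteq> 0"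
  shows "frame_pt P u b (scoord P u b x, tcoord P u b x) = x"
proof -
  have "cross2 u b *\<^sub>R (x - P) = cross2 (x - P) b *\<^sub>R u + cross2 u (x - P) *\<^sub>R b"
    by (auto simp: vec2_eq_iff cross2_def algebra_simps)
  then have "(1 / cross2 u b) *\<^sub>R (cross2 u b *\<^sub>R (x - P)) =
      scoord P u b x *\<^sub>R u + tcoord P u b x *\<^sub>R b"
    by (simp add: scoord_def tcoord_def scaleR_add_right)
  then show ?thesis using assms by (simp add: frame_pt_def algebra_simps)
qed

lemma scoord_frame_pt [simp]: "cross2 u b \<noteq> 0 \<Longrightarrow> scoord P u b (frame_pt P u b (s, t)) = s"
  and tcoord_frame_pt [simp]: "cross2 u b \<noteq> 0 \<Longrightarrow> tcoord P u b (frame_pt P u b (s, t)) = t"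
  by (simp_all add: scoord_def tcoord_def frame_pt_def add.assoc cross2_add)

lemma scoord_affine: "scoord P u b x = cross2 x b / cross2 u b + - (cross2 P b / cross2 u b)"
  and tcoord_affine: "tcoord P u b x = cross2 u x / cross2 u b + - (cross2 u P / cross2 u b)"
  by (simp_all add: scoord_def tcoord_def cross2_diff diff_divide_distrib)

lemma bounded_linear_scoord: "bounded_linear (\<lambda>x. cross2 x b / cross2 u b)"
  and bounded_linear_tcoord: "bounded_linear (\<lambda>x. cross2 u x / cross2 u b)"
  by (rule bounded_linear_compose[OF bounded_linear_divide bounded_linear_cross2(1)]
      bounded_linear_compose[OF bounded_linear_divide bounded_linear_cross2(2)])+

lemma continuous_on_coords [continuous_intros]:
  "continuous_on A (scoord P u b)" "continuous_on A (tcoord P u b)"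
  unfolding scoord_affine[abs_def] tcoord_affine[abs_def]
  by (intro continuous_intros linear_continuous_on bounded_linear_scoord bounded_linear_tcoord)+

lemma continuous_on_frame_pt [continuous_intros]: "continuous_on A (frame_pt P u b)"
  unfolding frame_pt_def case_prod_beta by (intro continuous_intros)

lemma borel_measurable_coords [measurable]:
  "scoord P u b \<in> borel_measurable borel" "tcoord P u b \<in> borel_measurable borel"
  by (intro borel_measurable_continuous_onI continuous_intros)+

lemma borel_measurable_frame_pt [measurable]: "frame_pt P u b \<in> borel_measurable borel"
  by (intro borel_measurable_continuous_onI continuous_intros)

lemma lborel_real2: "(lborel :: (real^2) measure) = distr lborel borel (\<lambda>(s::real, t::real). vector [s, t])"
proof (rule lborel_eqI)
  let ?X = "\<lambda>z::real \<times> real. vector [fst z, snd z] :: real^2"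
  have [measurable]: "?X \<in> borel_measurable borel"
  proof (intro borel_measurable_continuous_onI)
    have "?X = (\<lambda>z. fst z *\<^sub>R axis 1 1 + snd z *\<^sub>R axis 2 1)"
      by (auto simp: fun_eq_iff vec2_eq_iff axis_def)
    then show "continuous_on UNIV ?X" by (simp only:) (intro continuous_intros)
  qed
  fix l u :: "real^2" assume le: "\<And>b. b \<in> Basis \<Longrightarrow> l \<bullet> b \<le> u \<bullet> b"
  have "l $ i \<le> u $ i" for i using le[of "axis i 1"] by (simp add: inner_axis axis_in_Basis_iff)
  then have le': "(l $ 1, l $ 2) \<bullet> b \<le> (u $ 1, u $ 2) \<bullet> b" if "b \<in> Basis" for b
    using that by (auto simp: Basis_prod_def)
  have "?X -` box l u = box (l $ 1, l $ 2) (u $ 1, u $ 2)"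
    by (auto simp: box_def Basis_prod_def Basis_vec_def inner_axis forall_2)
  then have "emeasure (distr lborel borel ?X) (box l u) = emeasure lborel (box (l $ 1, l $ 2) (u $ 1, u $ 2))"
    by (simp add: emeasure_distr)
  also have "\<dots> = (u $ 1 - l $ 1) * (u $ 2 - l $ 2)"
    using emeasure_lborel_box[OF le'] by (simp add: Basis_prod_def mult.commute)
  also have "\<dots> = (\<Prod>b\<in>Basis. (u - l) \<bullet> b)"
  proof -
    have "Basis = {axis 1 1, axis 2 1 :: real^2}"
      by (auto simp: Basis_vec_def UNIV_2)
    then have "(\<Prod>b\<in>Basis. (u - l) \<bullet> b) = (\<Prod>b\<in>{axis 1 1, axis 2 1}. (u - l) \<bullet> b)"
      by (simp only:)
    also have "\<dots> = (u $ 1 - l $ 1) * (u $ 2 - l $ 2)"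
      by (simp add: axis_eq_axis inner_axis)
    finally show ?thesis by (simp only:)
  qed
  finally show "emeasure (distr lborel borel (\<lambda>(s::real, t::real). vector [s, t])) (box l u) = (\<Prod>b\<in>Basis. (u - l) \<bullet> b)"
    by (simp add: case_prod_beta')
qed simp

text \<open>The linear part of the coordinate map scales areas by its determinant; it remains to compare both measures
  on boxes.\<close>

lemma lborel_frame:
  assumes J: "cross2 u b \<noteq> 0"
  shows "(lborel :: (real^2) measure) = density (distr lborel borel (frame_pt P u b)) (\<lambda>_. ennreal \<bar>cross2 u b\<bar>)"
proof (rule lborel_eqI)
  let ?V = "\<lambda>(s::real, t::real). vector [s, t] :: real^2"
  define L where "L = (\<lambda>y::real^2. y $ 1 *\<^sub>R u + y $ 2 *\<^sub>R b)"
  have lin: "linear L" unfolding L_def by (auto intro!: linearI simp: algebra_simps)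
  have det: "det (matrix L) = cross2 u b"
    by (simp add: det_2 matrix_def L_def cross2_def axis_def)
  have Vmeas [measurable]: "?V \<in> borel_measurable borel"
  proof (intro borel_measurable_continuous_onI)
    have "?V = (\<lambda>z. fst z *\<^sub>R axis 1 1 + snd z *\<^sub>R axis 2 1)"
      by (auto simp: fun_eq_iff vec2_eq_iff axis_def)
    then show "continuous_on UNIV ?V" by (simp only:) (intro continuous_intros)
  qed
  have contL: "continuous_on UNIV L" unfolding L_def by (intro continuous_intros)
  fix l r :: "real^2" assume le: "\<And>b. b \<in> Basis \<Longrightarrow> l \<bullet> b \<le> r \<bullet> b"
  define B where "B = (\<lambda>y. P + L y) -` box l r"
  have oB: "open B" unfolding B_def 
    by (intro continuous_open_vimage continuous_intros continuous_on_subset[OF contL] open_box) (auto simp: continuous_on_eq_continuous_at[symmetric])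
  have eq: "frame_pt P u b = (\<lambda>z. P + L (?V z))"
    by (auto simp: frame_pt_def L_def)
  have surj: "surj L"
    using frame_coords[OF J, of 0]
    by (intro surjI[where f="\<lambda>x. ?V (scoord 0 u b x, tcoord 0 u b x)"]) (simp add: L_def frame_pt_def)
  have img: "(+) P ` (L ` B) = box l r"
  proof (intro equalityI subsetI)
    fix x assume x: "x \<in> box l r"
    obtain y where "L y = x - P" using surj by (metis surjD)
    then have "x = P + L y" "y \<in> B" using x by (simp_all add: B_def)
    then show "x \<in> (+) P ` (L ` B)" by blast
  qed (auto simp: B_def)
  have "emeasure (density (distr lborel borel (frame_pt P u b)) (\<lambda>_. ennreal \<bar>cross2 u b\<bar>)) (box l r) =
      ennreal \<bar>cross2 u b\<bar> * emeasure lborel (frame_pt P u b -` box l r)"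
    by (simp add: emeasure_density nn_integral_cmult emeasure_distr)
  also have "frame_pt P u b -` box l r = ?V -` B"
    unfolding eq B_def by auto
  also have "emeasure lborel (?V -` B) = emeasure lborel B"
    using oB by (subst lborel_real2) (simp add: emeasure_distr)
  also have "ennreal \<bar>cross2 u b\<bar> * emeasure lborel B = emeasure lborel (box l r)"
  proof -
    have "bounded B"
    proof -
      obtain g where g: "linear g" "g \<circ> L = id"
        using linear_injective_left_inverse[OF lin] linear_surjective_imp_injective[OF lin surj]
        by blast
      have "B \<subseteq> g ` ((\<lambda>x. x - P) ` box l r)"
      proof
        fix y assume "y \<in> B"
        then have "P + L y \<in> box l r" by (simp add: B_def)
        moreover have "y = g ((P + L y) - P)" using g(2) by (simp add: fun_eq_iff)
        ultimately show "y \<in> g ` ((\<lambda>x. x - P) ` box l r)" by blast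
      qed
      moreover have "bounded (g ` ((\<lambda>x. x - P) ` box l r))"
        using g(1) by (intro bounded_linear_image bounded_translation_minus bounded_box)
          (simp add: linear_conv_bounded_linear)
      ultimately show ?thesis by (rule bounded_subset[rotated])
    qed
    then have Bm: "B \<in> lmeasurable" using oB by (simp add: lmeasurable_open)
    have "measure lebesgue (box l r) = measure lebesgue (L ` B)"
      unfolding img[symmetric] by (rule measure_translation)
    also have "\<dots> = \<bar>cross2 u b\<bar> * measure lebesgue B"
      using measure_linear_image[OF lin Bm] det by simp
    finally have m1: "ennreal (measure lebesgue (box l r)) = ennreal \<bar>cross2 u b\<bar> * ennreal (measure lebesgue B)"
      by (simp add: ennreal_mult)
    have m2: "ennreal (measure lebesgue X) = emeasure lborel X" if "X \<in> lmeasurable" "open X" for X :: "(real^2) set"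
      using that emeasure_eq_measure2[of X lebesgue] by (simp add: emeasure_completion)
    show ?thesis using m1 unfolding m2[OF Bm oB] m2[OF lmeasurable_box open_box] by simp
  qed
  also have "\<dots> = (\<Prod>b\<in>Basis. (r - l) \<bullet> b)" using le by (rule emeasure_lborel_box)
  finally show "emeasure (density (distr lborel borel (frame_pt P u b)) (\<lambda>_. ennreal \<bar>cross2 u b\<bar>)) (box l r) =
      (\<Prod>b\<in>Basis. (r - l) \<bullet> b)" .
qed simp

lemma lborel_integral_frame:
  fixes f :: "real^2 \<Rightarrow> real"
  assumes J: "cross2 u b \<noteq> 0" and [measurable]: "f \<in> borel_measurable borel"
  shows "(LINT x|lborel. f x) = \<bar>cross2 u b\<bar> * (LINT z|lborel. f (frame_pt P u b z))"
  by (subst lborel_frame[OF J, of P]) (simp add: integral_density integral_distr)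

lemma lborel_integrable_frame:
  fixes f :: "real^2 \<Rightarrow> real"
  assumes J: "cross2 u b \<noteq> 0" and [measurable]: "f \<in> borel_measurable borel"
  shows "integrable lborel f \<longleftrightarrow> integrable lborel (\<lambda>z. f (frame_pt P u b z))"
  using J by (subst lborel_frame[OF J, of P]) (simp add: integrable_density integrable_distr_eq)

lemma AE_lborel_frame:
  assumes J: "cross2 u b \<noteq> 0" and [measurable]: "Measurable.pred borel R"
  shows "(AE x in lborel. R x) \<longleftrightarrow> (AE z in lborel. R (frame_pt P u b z))"
  using J by (subst lborel_frame[OF J, of P]) (simp add: AE_density AE_distr_iff)

section \<open>Test functions and the flux through a segment\<close>

lemma test_functionI:
  assumes "smooth \<psi>" "compact K" "K \<subseteq> U" "\<And>x. \<psi> x \<noteq> 0 \<Longrightarrow> x \<in> K"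
  shows "test_function U \<psi>"
proof -
  have "closure {x. \<psi> x \<noteq> 0} \<subseteq> K"
    using assms(2,4) by (intro closure_minimal compact_imp_closed) auto
  moreover from this have "compact (closure {x. \<psi> x \<noteq> 0})"
    using assms(2) by (metis closed_Int_compact closed_closure inf.absorb1)
  ultimately show ?thesis using assms by (auto simp: test_function_def)
qed

lemma test_function_mono: "test_function U \<psi> \<Longrightarrow> U \<subseteq> V \<Longrightarrow> test_function V \<psi>"
  by (auto simp: test_function_def)

lemma test_function_smooth: "test_function U \<psi> \<Longrightarrow> smooth \<psi>"
  by (simp add: test_function_def)

lemma test_function_outside:
  assumes "test_function U \<psi>" "x \<notin> U"
  shows "\<psi> x = 0" "frechet_derivative \<psi> (at x) = (\<lambda>v. 0)"
proof -
  let ?K = "closure {x. \<psi> x \<noteq> 0}"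
  have x: "x \<in> - ?K" using assms by (auto simp: test_function_def)
  have sub: "{x. \<psi> x \<noteq> 0} \<subseteq> ?K" by (rule closure_subset)
  show "\<psi> x = 0" using x sub by auto
  have d0: "((\<lambda>x. 0) has_derivative (\<lambda>v. 0)) (at x)" by simp
  have op: "open (- ?K)" by (intro open_Compl closed_closure)
  have "0 = \<psi> y" if "y \<in> - ?K" for y using that sub by auto
  from has_derivative_transform_within_open[OF d0 op x this]
  have "(\<psi> has_derivative (\<lambda>v. 0)) (at x)" .
  then show "frechet_derivative \<psi> (at x) = (\<lambda>v. 0)" by (rule frechet_derivative_at[symmetric])
qed

lemma smooth_borel_measurable:
  "smooth \<psi> \<Longrightarrow> \<psi> \<in> borel_measurable borel"
  "smooth \<psi> \<Longrightarrow> (\<lambda>x. frechet_derivative \<psi> (at x) v) \<in> borel_measurable borel"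
  by (intro borel_measurable_continuous_onI continuous_on_smooth smooth_frechet_derivative; assumption)+

lemma test_function_bounded:
  assumes "test_function U \<psi>"
  obtains C where "0 < C" "\<And>x. \<bar>\<psi> x\<bar> \<le> C" "\<And>x. \<bar>frechet_derivative \<psi> (at x) v\<bar> \<le> C"
proof -
  let ?K = "closure {x. \<psi> x \<noteq> 0}"
  have K: "compact ?K" "test_function ?K \<psi>" "smooth \<psi>"
    using assms by (auto simp: test_function_def)
  have "bounded (f ` ?K)" if "smooth f" for f
    using K(1) continuous_on_smooth[OF that] by (intro compact_imp_bounded compact_continuous_image)
  from this[OF K(3)] this[OF smooth_frechet_derivative[OF K(3), of v]]
  obtain A B where A: "0 < A" "\<And>x. x \<in> ?K \<Longrightarrow> \<bar>\<psi> x\<bar> \<le> A"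
    and B: "\<And>x. x \<in> ?K \<Longrightarrow> \<bar>frechet_derivative \<psi> (at x) v\<bar> \<le> B"
    unfolding bounded_pos by (auto simp: image_iff)
  have "\<bar>\<psi> x\<bar> \<le> max A B" "\<bar>frechet_derivative \<psi> (at x) v\<bar> \<le> max A B" for x
    using A B test_function_outside[OF K(2), of x] by (cases "x \<in> ?K"; fastforce simp: le_max_iff_disj)+
  then show thesis using that[of "max A B"] A(1) by auto
qed

text \<open>Applied with \<open>v = b\<close>, the second statement says that differentiation along the flow is differentiation
  with respect to \<open>t\<close>.\<close>

lemma smooth_frechet_frame_product:
  assumes "smooth f" "smooth k"
    and f': "\<And>x. (f has_real_derivative f' x) (at x)" and k': "\<And>x. (k has_real_derivative k' x) (at x)"
  shows "smooth (\<lambda>x. f (scoord P u b x) * k (tcoord P u b x))"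
    and "frechet_derivative (\<lambda>x. f (scoord P u b x) * k (tcoord P u b x)) (at x) v =
      f (scoord P u b x) * (k' (tcoord P u b x) * (cross2 u v / cross2 u b)) +
      f' (scoord P u b x) * (cross2 v b / cross2 u b) * k (tcoord P u b x)"
proof -
  show "smooth (\<lambda>x. f (scoord P u b x) * k (tcoord P u b x))"
    unfolding scoord_affine tcoord_affine
    by (intro smooth_mult smooth_affine_comp bounded_linear_scoord bounded_linear_tcoord assms)
  have s: "(scoord P u b has_derivative (\<lambda>v. cross2 v b / cross2 u b)) (at x)"
    unfolding scoord_affine[abs_def]
    by (intro has_derivative_add_const bounded_linear_imp_has_derivative bounded_linear_scoord)
  have t: "(tcoord P u b has_derivative (\<lambda>v. cross2 u v / cross2 u b)) (at x)"
    unfolding tcoord_affine[abs_def]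
    by (intro has_derivative_add_const bounded_linear_imp_has_derivative bounded_linear_tcoord)
  have "((\<lambda>x. f (scoord P u b x)) has_derivative (\<lambda>v. f' (scoord P u b x) * (cross2 v b / cross2 u b))) (at x)"
    using has_derivative_compose[OF s f'[unfolded has_field_derivative_def]] by simp
  moreover have "((\<lambda>x. k (tcoord P u b x)) has_derivative (\<lambda>v. k' (tcoord P u b x) * (cross2 u v / cross2 u b))) (at x)"
    using has_derivative_compose[OF t k'[unfolded has_field_derivative_def]] by simp
  ultimately have "((\<lambda>x. f (scoord P u b x) * k (tcoord P u b x)) has_derivative
     (\<lambda>v. f (scoord P u b x) * (k' (tcoord P u b x) * (cross2 u v / cross2 u b)) +
      f' (scoord P u b x) * (cross2 v b / cross2 u b) * k (tcoord P u b x))) (at x)"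
    by (rule has_derivative_mult)
  from frechet_derivative_at[OF this, symmetric]
  show "frechet_derivative (\<lambda>x. f (scoord P u b x) * k (tcoord P u b x)) (at x) v =
      f (scoord P u b x) * (k' (tcoord P u b x) * (cross2 u v / cross2 u b)) +
      f' (scoord P u b x) * (cross2 v b / cross2 u b) * k (tcoord P u b x)"
    by simp
qed

lemma frame_bump_test_function:
  assumes J: "cross2 u b \<noteq> 0" and sub: "frame_pt P u b ` ({a..a'} \<times> {c..c'}) \<subseteq> U"
  shows "test_function U (\<lambda>x. bump n a a' (scoord P u b x) * bump m c c' (tcoord P u b x))"
proof (rule test_functionI[OF _ _ sub])
  show "smooth (\<lambda>x. bump n a a' (scoord P u b x) * bump m c c' (tcoord P u b x))"
    by (rule smooth_frechet_frame_product(1)[OF smooth_bump smooth_bump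
        bump_has_real_derivative bump_has_real_derivative])
  show "compact (frame_pt P u b ` ({a..a'} \<times> {c..c'}))"
    by (intro compact_continuous_image continuous_intros compact_Times compact_Icc)
  fix x assume "bump n a a' (scoord P u b x) * bump m c c' (tcoord P u b x) \<noteq> 0"
  then have "(scoord P u b x, tcoord P u b x) \<in> {a..a'} \<times> {c..c'}"
    by (auto simp: bump_eq_0_iff)
  then show "x \<in> frame_pt P u b ` ({a..a'} \<times> {c..c'})" using frame_coords[OF J] by (metis image_eqI)
qed

lemma integrable_product_lborel:
  fixes f h :: "real \<Rightarrow> real"
  assumes "integrable lborel f" "integrable lborel h"
  shows "integrable lborel (\<lambda>z::real \<times> real. f (fst z) * h (snd z))"
proof -
  have [measurable]: "f \<in> borel_measurable borel" "h \<in> borel_measurable borel"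
    using assms by (auto dest: borel_measurable_integrable)
  have "integrable (lborel \<Otimes>\<^sub>M lborel) (\<lambda>z::real \<times> real. f (fst z) * h (snd z))"
    using assms by (intro lborel_pair.Fubini_integrable) (auto simp: abs_mult)
  then show ?thesis by (simp add: lborel_prod)
qed

text \<open>The integrand \<open>w (b \<bullet> \<nabla>\<psi>) + D \<psi>\<close> of the weak equation \<open>div (w b) = D\<close> for \<open>w = D t + g(s)\<close>, cut off to the half plane
  upstream of the line \<open>t = 0\<close>.\<close>

definition half_plane_flux ::
    "real^2 \<Rightarrow> real^2 \<Rightarrow> real^2 \<Rightarrow> real \<Rightarrow> (real \<Rightarrow> real) \<Rightarrow> (real^2 \<Rightarrow> real) \<Rightarrow> real^2 \<Rightarrow> real" where
  "half_plane_flux P u b D g \<psi> x =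
    (if tcoord P u b x \<le> 0
     then (D * tcoord P u b x + g (scoord P u b x)) * frechet_derivative \<psi> (at x) b + D * \<psi> x
     else 0)"

text \<open>On a line of constant \<open>s\<close> the integrand is the \<open>t\<close>-derivative of \<open>(D t + g(s)) \<psi>\<close>, so integration over \<open>t \<le> 0\<close>
  leaves the value \<open>g(s) \<psi>\<close> at \<open>t = 0\<close>, which is the flux through the line weighted by the test function.\<close>

lemma half_plane_flux_integral:
  assumes J: "cross2 u b \<noteq> 0" and \<psi>: "test_function UNIV \<psi>" and g: "integrable lborel g"
  shows "integrable lborel (half_plane_flux P u b D g \<psi>)"
    and "(LINT x|lborel. half_plane_flux P u b D g \<psi> x) =
      \<bar>cross2 u b\<bar> * (LINT s|lborel. g s * \<psi> (P + s *\<^sub>R u))"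
proof -
  let ?K = "closure {x. \<psi> x \<noteq> 0}"
  let ?X = "frame_pt P u b"
  let ?d = "\<lambda>x. frechet_derivative \<psi> (at x) b"
  have K: "compact ?K" "test_function ?K \<psi>" "smooth \<psi>"
    using \<psi> by (auto simp: test_function_def)
  note [measurable] = smooth_borel_measurable[OF K(3)] borel_measurable_integrable[OF g, simplified]
  have hm [measurable]: "half_plane_flux P u b D g \<psi> \<in> borel_measurable borel"
    unfolding half_plane_flux_def[abs_def] by measurable
  have "bounded (scoord P u b ` ?K)" "bounded (tcoord P u b ` ?K)"
    by (intro compact_imp_bounded compact_continuous_image continuous_intros K)+
  then obtain M1 M2 where "0 < M1" "\<And>x. x \<in> ?K \<Longrightarrow> \<bar>scoord P u b x\<bar> \<le> M1"
    "\<And>x. x \<in> ?K \<Longrightarrow> \<bar>tcoord P u b x\<bar> \<le> M2"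
    unfolding bounded_pos by (auto simp: image_iff)
  then obtain M where M: "0 < M" "\<And>x. x \<in> ?K \<Longrightarrow> \<bar>scoord P u b x\<bar> \<le> M"
    "\<And>x. x \<in> ?K \<Longrightarrow> \<bar>tcoord P u b x\<bar> \<le> M"
    using that[of "max M1 M2"] by (auto simp: le_max_iff_disj)
  obtain C where C: "0 < C" "\<And>x. \<bar>\<psi> x\<bar> \<le> C" "\<And>x. \<bar>?d x\<bar> \<le> C"
    by (rule test_function_bounded[OF \<psi>, of b]) blast
  have off: "\<psi> (?X (s, t)) = 0" "?d (?X (s, t)) = 0" if "\<not> (\<bar>s\<bar> \<le> M \<and> \<bar>t\<bar> \<le> M)" for s t
  proof -
    have notin: "?X (s, t) \<notin> ?K" using M(2,3)[of "?X (s, t)"] that J by auto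
    show "\<psi> (?X (s, t)) = 0" "?d (?X (s, t)) = 0"
      using test_function_outside[OF K(2) notin] by simp_all
  qed
  let ?G = "\<lambda>z. half_plane_flux P u b D g \<psi> (?X z)"
  have G: "?G (s, t) = ((D * t + g s) * ?d (?X (s, t)) + D * \<psi> (?X (s, t))) * indicator {- M..0} t" for s t
    using off[of s t] J by (auto simp: half_plane_flux_def indicator_def)
  have intG: "integrable lborel ?G"
  proof (rule Bochner_Integration.integrable_bound)
    let ?I = "indicator {- M..M} :: real \<Rightarrow> real"
    have I: "integrable lborel ?I" by (simp add: integrable_indicator_iff emeasure_lborel_Icc_eq)
    have gI: "integrable lborel (\<lambda>s. \<bar>g s\<bar>)" using g by simp
    show "integrable lborel (\<lambda>z. (\<bar>D\<bar> * M * C + \<bar>D\<bar> * C) * (?I (fst z) * ?I (snd z)) + C * (\<bar>g (fst z)\<bar> * ?I (snd z)))"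
      by (intro Bochner_Integration.integrable_add integrable_mult_right integrable_product_lborel I gI)
    show "?G \<in> borel_measurable lborel" by measurable
    show "AE z in lborel. norm (?G z) \<le>
      norm ((\<bar>D\<bar> * M * C + \<bar>D\<bar> * C) * (?I (fst z) * ?I (snd z)) + C * (\<bar>g (fst z)\<bar> * ?I (snd z)))"
    proof (intro AE_I2)
      fix z :: "real \<times> real"
      obtain s t where z: "z = (s, t)" by fastforce
      show "norm (?G z) \<le>
        norm ((\<bar>D\<bar> * M * C + \<bar>D\<bar> * C) * (?I (fst z) * ?I (snd z)) + C * (\<bar>g (fst z)\<bar> * ?I (snd z)))"
      proof (cases "\<bar>s\<bar> \<le> M \<and> \<bar>t\<bar> \<le> M")
        case True
        have "norm (?G z) \<le> \<bar>D * t + g s\<bar> * \<bar>?d (?X z)\<bar> + \<bar>D\<bar> * \<bar>\<psi> (?X z)\<bar>"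
          unfolding z G by (auto simp: indicator_def abs_mult[symmetric])
        also have "\<dots> \<le> (\<bar>D\<bar> * M + \<bar>g s\<bar>) * C + \<bar>D\<bar> * C"
        proof (intro add_mono mult_mono C)
          have "\<bar>D * t\<bar> \<le> \<bar>D\<bar> * M" using True by (auto simp: abs_mult intro: mult_left_mono)
          then show "\<bar>D * t + g s\<bar> \<le> \<bar>D\<bar> * M + \<bar>g s\<bar>" by linarith
        qed (use M C in auto)
        finally show ?thesis using True M C by (auto simp: z algebra_simps abs_le_iff)
      next
        case False
        then show ?thesis using off[OF False] unfolding z G by simp
      qed
    qed
  qed
  then show "integrable lborel (half_plane_flux P u b D g \<psi>)"
    using lborel_integrable_frame[OF J hm] by blast
  have inner: "(LINT t|lborel. ?G (s, t)) = g s * \<psi> (P + s *\<^sub>R u)" for s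
  proof -
    have cd: "continuous_on UNIV ?d" "continuous_on UNIV \<psi>"
      using K(3) by (auto intro: continuous_on_smooth smooth_frechet_derivative)
    have cX: "continuous_on UNIV (\<lambda>t. ?X (s, t))"
      unfolding frame_pt_def by (auto intro!: continuous_intros)
    have "(LINT t|lborel. ?G (s, t)) =
        (D * 0 + g s) * \<psi> (?X (s, 0)) - (D * (- M - 1) + g s) * \<psi> (?X (s, - M - 1))"
    proof -
      have "(LINT t|lborel. ?G (s, t)) =
          (LINT t|lborel. ((D * t + g s) * ?d (?X (s, t)) + D * \<psi> (?X (s, t))) * indicator {- M - 1..0} t)"
        unfolding G using off[of s]
        by (intro Bochner_Integration.integral_cong refl) (auto simp: indicator_def)
      also have "\<dots> = (D * 0 + g s) * \<psi> (?X (s, 0)) - (D * (- M - 1) + g s) * \<psi> (?X (s, - M - 1))"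
      proof (rule integral_FTC_Icc_real)
        fix t
        have dX: "((\<lambda>t. ?X (s, t)) has_derivative (\<lambda>h. h *\<^sub>R b)) (at t)"
          unfolding frame_pt_def by (auto intro!: derivative_eq_intros)
        have d\<psi>: "(\<psi> has_derivative frechet_derivative \<psi> (at (?X (s, t)))) (at (?X (s, t)))"
          using smooth_differentiable[OF K(3)] frechet_derivative_works by blast
        have "((\<lambda>t. \<psi> (?X (s, t))) has_real_derivative ?d (?X (s, t))) (at t)"
        proof -
          have "(\<lambda>h. frechet_derivative \<psi> (at (?X (s, t))) (h *\<^sub>R b)) = (*) (?d (?X (s, t)))"
            using linear_scale[OF has_derivative_linear[OF d\<psi>]] by (auto simp: fun_eq_iff)
          then show ?thesis
            using has_derivative_compose[OF dX d\<psi>] unfolding has_field_derivative_def by (simp only:)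
        qed
        then show "((\<lambda>t. (D * t + g s) * \<psi> (?X (s, t))) has_real_derivative
            (D * t + g s) * ?d (?X (s, t)) + D * \<psi> (?X (s, t))) (at t)"
          by (auto intro!: derivative_eq_intros)
        show "isCont (\<lambda>t. (D * t + g s) * ?d (?X (s, t)) + D * \<psi> (?X (s, t))) t"
          using continuous_on_compose2[OF cd(1) cX] continuous_on_compose2[OF cd(2) cX]
          by (auto intro!: continuous_intros simp: continuous_on_eq_continuous_at)
      qed (use M in simp)
      finally show ?thesis .
    qed
    also have "\<dots> = g s * \<psi> (P + s *\<^sub>R u)"
      using off(1)[of s "- M - 1"] M(1) by (simp add: frame_pt_def)
    finally show ?thesis .
  qed
  have "(LINT z|lborel. ?G z) = (LINT s|lborel. LINT t|lborel. ?G (s, t))"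
    using lborel_pair.integral_fst'[of ?G] intG by (simp add: lborel_prod)
  then show "(LINT x|lborel. half_plane_flux P u b D g \<psi> x) =
      \<bar>cross2 u b\<bar> * (LINT s|lborel. g s * \<psi> (P + s *\<^sub>R u))"
    unfolding inner by (simp add: lborel_integral_frame[OF J hm, of P])
qed

text \<open>The open triangle with vertices \<open>P\<close>, \<open>P + u\<close> and \<open>P + u - \<tau> b\<close>. The flow \<open>b\<close> leaves it through the edge from \<open>P\<close>
  to \<open>P + u\<close> on the line \<open>t = 0\<close> and is parallel to the edge \<open>s = 1\<close>.\<close>

definition cell :: "real^2 \<Rightarrow> real^2 \<Rightarrow> real^2 \<Rightarrow> real \<Rightarrow> (real^2) set" where
  "cell P u b \<tau> = {x. 0 < scoord P u b x \<and> scoord P u b x < 1 \<and>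
     - \<tau> * scoord P u b x < tcoord P u b x \<and> tcoord P u b x < 0}"

lemma open_cell: "open (cell P u b \<tau>)"
  unfolding cell_def by (intro open_Collect_conj open_Collect_less continuous_intros)

lemma half_plane_flux_cell:
  assumes "test_function (cell P u b \<tau>) \<psi>"
  shows "half_plane_flux P u b D g \<psi> x = indicator (cell P u b \<tau>) x *
    ((D * tcoord P u b x + g (scoord P u b x)) * frechet_derivative \<psi> (at x) b + D * \<psi> x)"
  using test_function_outside[OF assms, of x]
  by (cases "x \<in> cell P u b \<tau>") (auto simp: half_plane_flux_def cell_def)

text \<open>Test functions inside the cell vanish on the line \<open>t = 0\<close>.\<close>

lemma cell_flux_zero:
  assumes J: "cross2 u b \<noteq> 0" and \<psi>: "test_function (cell P u b \<tau>) \<psi>" and g: "integrable lborel g"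
  shows "(LINT x|lborel. half_plane_flux P u b D g \<psi> x) = 0"
proof -
  have "P + s *\<^sub>R u \<notin> cell P u b \<tau>" for s
    using tcoord_frame_pt[OF J, of P s 0] by (auto simp: cell_def frame_pt_def)
  then have "\<psi> (P + s *\<^sub>R u) = 0" for s using test_function_outside[OF \<psi>] by blast
  then show ?thesis
    using half_plane_flux_integral(2)[OF J test_function_mono[OF \<psi>] g] by simp
qed

lemma lborel_shift_snd:
  fixes f :: "real \<times> real \<Rightarrow> real"
  assumes [measurable]: "f \<in> borel_measurable borel"
  shows "(LINT (s, t)|lborel. f (s, t + h)) = (LINT z|lborel. f z)"
    and "integrable lborel (\<lambda>(s, t). f (s, t + h)) \<longleftrightarrow> integrable lborel f"
proof -
  have eq: "(\<lambda>(s, t). f (s, t + h)) = (\<lambda>z. f ((0, h) + z))" by (auto simp: add.commute)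
  show "(LINT (s, t)|lborel. f (s, t + h)) = (LINT z|lborel. f z)"
    unfolding eq by (subst (2) lborel_distr_plus[of "(0, h)", symmetric]) (simp add: integral_distr)
  show "integrable lborel (\<lambda>(s, t). f (s, t + h)) \<longleftrightarrow> integrable lborel f"
    unfolding eq by (subst (2) lborel_distr_plus[of "(0, h)", symmetric]) (simp add: integrable_distr_eq)
qed

lemma smooth_shift: "smooth f \<Longrightarrow> smooth (\<lambda>x::real. f (x + c))"
  using smooth_affine_comp[OF bounded_linear_ident] .

lemma smooth_diff: "smooth f \<Longrightarrow> smooth g \<Longrightarrow> smooth (\<lambda>x. f x - g x)"
  unfolding smooth_def
proof
  fix k assume "\<forall>k. Ck k f" "\<forall>k. Ck k g"
  then have "Ck k (\<lambda>x. f x + - 1 * g x)" by (intro Ck_add Ck_mult Ck_const) auto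
  then show "Ck k (\<lambda>x. f x - g x)" by simp
qed

text \<open>Supplies compactly supported functions of \<open>t\<close> whose derivative is a bump minus its translate by \<open>h\<close>.
  Used as a factor of a test function, this turns the weak equation into a statement about translates.\<close>

lemma bump_difference_antiderivative:
  assumes "c < d"
  obtains k where "smooth k" "\<And>t. (k has_real_derivative bump n c d t - bump n c d (t - h)) (at t)"
    "\<And>t. k t \<noteq> 0 \<Longrightarrow> t \<in> {min c (c + h)..max d (d + h)}"
proof -
  obtain F where F: "smooth F" "\<And>x. (F has_real_derivative bump n c d x) (at x)"
    using smooth_antiderivative[OF smooth_bump[of n c d]] by blast
  define k where "k t = F t - F (t - h)" for t
  have "smooth k"
    unfolding k_def[abs_def] using smooth_diff[OF F(1) smooth_shift[OF F(1), of "- h"]] by simp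
  moreover have "(k has_real_derivative bump n c d t - bump n c d (t - h)) (at t)" for t
    unfolding k_def[abs_def] using DERIV_shift[of F _ t "- h"] F(2)
    by (intro DERIV_diff) auto
  moreover have "t \<in> {min c (c + h)..max d (d + h)}" if "k t \<noteq> 0" for t
  proof (rule ccontr)
    assume t: "t \<notin> {min c (c + h)..max d (d + h)}"
    have zero: "F x = F y" if xy: "x \<le> y" "y \<le> c \<or> d \<le> x" for x y
    proof (cases "x = y")
      case False
      then obtain z where "x < z" "z < y" "F y - F x = (y - x) * bump n c d z"
        using MVT2[of x y F "bump n c d"] F(2) xy by auto
      then show ?thesis using xy bump_eq_0_iff[of n c d z] by auto
    qed simp
    have "F t = F (t - h)"
    proof (cases "h \<ge> 0")
      case True
      then show ?thesis using t by (intro zero[symmetric]) auto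
    next
      case False
      then show ?thesis using t by (intro zero) auto
    qed
    then show False using that by (simp add: k_def)
  qed
  ultimately show thesis using that by blast
qed

section \<open>Functions with constant derivative along the flow\<close>

lemma AE_lborel_ex_Ioo:
  assumes "AE x in lborel. P x" "a < (b::real)"
  shows "\<exists>x\<in>{a<..<b}. P x"
proof (rule ccontr)
  assume neg: "\<not> ?thesis"
  have "AE x in lborel. x \<notin> {a<..<b}"
    using assms(1) by eventually_elim (use neg in blast)
  then have "{a<..<b} \<in> null_sets lborel"
    by (subst (asm) AE_iff_null_sets[symmetric]) auto
  then show False using assms(2) by (simp add: null_sets_def)
qed

lemma integrable_mult_bounded_real:
  fixes f h :: "'a \<Rightarrow> real"
  assumes f: "integrable M f" and [measurable]: "h \<in> borel_measurable M" and C: "\<And>x. \<bar>h x\<bar> \<le> C"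
  shows "integrable M (\<lambda>x. f x * h x)"
proof (rule Bochner_Integration.integrable_bound)
  have [measurable]: "f \<in> borel_measurable M" using f by auto
  show "integrable M (\<lambda>x. f x * C)" using f by simp
  show "(\<lambda>x. f x * h x) \<in> borel_measurable M" by measurable
  have "0 \<le> C" using C[of undefined] by linarith
  then show "AE x in M. norm (f x * h x) \<le> norm (f x * C)"
    using C by (auto simp: abs_mult intro!: mult_left_mono)
qed

lemma mem_cell_frame_pt:
  "cross2 u b \<noteq> 0 \<Longrightarrow> frame_pt P u b (s, t) \<in> cell P u b \<tau> \<longleftrightarrow> 0 < s \<and> s < 1 \<and> - \<tau> * s < t \<and> t < 0"
  by (simp add: cell_def)

text \<open>The test functions are a bump in \<open>s\<close> times a compactly supported antiderivative, in \<open>t\<close>, of a bump minus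
  its translate. Shifting the translate over to \<open>V\<close> shows that \<open>V - V(\<cdot> + h b)\<close> integrates to zero against
  all bumps supported where both points lie in the cell. The cell meets each streamline in an interval, so the
  test function stays in the cell.\<close>

lemma shift_invariant_along_flow:
  fixes V :: "real^2 \<Rightarrow> real"
  assumes J: "cross2 u b \<noteq> 0" and V: "integrable lborel V" and Vm: "V \<in> borel_measurable borel"
    and weak: "\<And>\<psi>. test_function (cell P u b \<tau>) \<psi> \<Longrightarrow>
      (LINT x|lborel. V x * frechet_derivative \<psi> (at x) b) = 0"
  defines "V' \<equiv> (\<lambda>z. V (frame_pt P u b z))"
  shows "AE (s, t) in lborel. frame_pt P u b (s, t) \<in> cell P u b \<tau> \<longrightarrow>
    frame_pt P u b (s, t + h) \<in> cell P u b \<tau> \<longrightarrow> V' (s, t) = V' (s, t + h)"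
proof -
  note [measurable] = Vm
  let ?C = "cell P u b \<tau>" and ?X = "frame_pt P u b"
  define U where "U = {z. ?X z \<in> ?C \<and> ?X (z + (0, h)) \<in> ?C}"
  have V'm [measurable]: "V' \<in> borel_measurable borel" unfolding V'_def by measurable
  have V'i: "integrable lborel V'"
    using lborel_integrable_frame[OF J Vm] V unfolding V'_def by blast
  have V'h: "integrable lborel (\<lambda>z. V' (z + (0, h)))"
    using lborel_shift_snd(2)[OF V'm, of h] V'i by (simp add: case_prod_beta' plus_prod_def)
  let ?f = "\<lambda>z. V' z - V' (z + (0, h))"
  have fi: "integrable lborel ?f" using V'i V'h by simp
  have "AE z in lborel. z \<in> U \<longrightarrow> ?f z = 0"
  proof (rule AE_zero_of_bump_integrals_prod)
    have "open (?X -` ?C)"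
      by (intro open_vimage open_cell continuous_intros)
    moreover have "U = ?X -` ?C \<inter> (\<lambda>z. z + (0, h)) -` (?X -` ?C)"
      by (auto simp: U_def)
    moreover have "open ((\<lambda>z. z + (0, h)) -` (?X -` ?C))"
      by (intro open_vimage[OF calculation(1)] continuous_intros)
    ultimately show "open U" by auto
    show "set_integrable lborel ({a..b} \<times> {c..d}) ?f" for a b c d
      unfolding set_integrable_def
      by (intro integrable_mult_indicator fi) (simp add: borel_closed closed_Times)
    fix a b' c d :: real and n
    assume ab: "a < b'" and cd: "c < d" and sub: "{a..b'} \<times> {c..d} \<subseteq> U"
    obtain k where k: "smooth k" "\<And>t. (k has_real_derivative bump n c d t - bump n c d (t - h)) (at t)"
      "\<And>t. k t \<noteq> 0 \<Longrightarrow> t \<in> {min c (c + h)..max d (d + h)}"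
      using bump_difference_antiderivative[OF cd, of n h] by blast
    define \<psi> where "\<psi> x = bump n a b' (scoord P u b x) * k (tcoord P u b x)" for x
    have "smooth \<psi>"
      unfolding \<psi>_def[abs_def] by (rule smooth_frechet_frame_product(1)[OF smooth_bump k(1) bump_has_real_derivative k(2)])
    have der: "frechet_derivative \<psi> (at x) b = bump n a b' (scoord P u b x) *
        (bump n c d (tcoord P u b x) - bump n c d (tcoord P u b x - h))" for x
      unfolding \<psi>_def[abs_def] using smooth_frechet_frame_product(2)[OF smooth_bump k(1) bump_has_real_derivative k(2), where v = b] J
      by simp
    let ?R = "{a..b'} \<times> {min c (c + h)..max d (d + h)}"
    have "test_function ?C \<psi>"
    proof (rule test_functionI[OF \<open>smooth \<psi>\<close>])
      show "compact (?X ` ?R)"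
        by (intro compact_continuous_image continuous_intros compact_Times compact_Icc)
      show "?X ` ?R \<subseteq> ?C"
      proof (clarsimp simp: mem_cell_frame_pt[OF J])
        fix s t assume st: "a \<le> s" "s \<le> b'" "min c (c + h) \<le> t" "t \<le> max d (d + h)"
        then have "(s, c) \<in> U" "(s, d) \<in> U" using sub cd by auto
        then show "0 < s \<and> s < 1 \<and> - (\<tau> * s) < t \<and> t < 0"
          using st by (auto simp: U_def mem_cell_frame_pt[OF J] min_def max_def split: if_splits)
      qed
      fix x assume "\<psi> x \<noteq> 0"
      then have "(scoord P u b x, tcoord P u b x) \<in> ?R"
        using k(3) bump_eq_0_iff[of n a b' "scoord P u b x"] by (force simp: \<psi>_def)
      then show "x \<in> ?X ` ?R" using frame_coords[OF J] by (metis image_eqI)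
    qed
    from weak[OF this]
    have "(LINT z|lborel. V' z * (bump n a b' (fst z) * (bump n c d (snd z) - bump n c d (snd z - h)))) = 0"
    proof -
      note [measurable] = smooth_borel_measurable[OF smooth_bump] smooth_borel_measurable(2)[OF \<open>smooth \<psi>\<close>]
      have "frechet_derivative \<psi> (at (?X z)) b = bump n a b' (fst z) * (bump n c d (snd z) - bump n c d (snd z - h))" for z
        unfolding der using J by (cases z) simp
      then show ?thesis
        using weak[OF \<open>test_function ?C \<psi>\<close>] J
        by (subst (asm) lborel_integral_frame[OF J, of _ P]) (auto simp: V'_def)
    qed
    note zero = this
    note [measurable] = smooth_borel_measurable[OF smooth_bump]
    have bm: "(\<lambda>z::real\<times>real. bump n a b' (fst z) * bump n c d (snd z - y)) \<in> borel_measurable borel" for y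
      unfolding borel_prod[symmetric] by measurable
    have bb: "\<bar>bump n a b' (fst z) * bump n c d (snd z - y)\<bar> \<le> 1" for z y
      using bump_nonneg[of n] bump_le_1[of n] by (auto simp: abs_mult intro!: mult_le_one)
    have i1: "integrable lborel (\<lambda>z. V' z * (bump n a b' (fst z) * bump n c d (snd z - y)))" for y
      using bm[of y] by (intro integrable_mult_bounded_real[OF V'i _ bb]) simp
    have i2: "integrable lborel (\<lambda>z. V' (z + (0, h)) * (bump n a b' (fst z) * bump n c d (snd z - 0)))"
      using bm[of 0] by (intro integrable_mult_bounded_real[OF V'h _ bb]) simp
    have m: "(\<lambda>z. V' z * (bump n a b' (fst z) * bump n c d (snd z - h))) \<in> borel_measurable borel"
      using bm[of h] by measurable
    have "(LINT z|lborel. V' (z + (0, h)) * (bump n a b' (fst z) * bump n c d (snd z - 0))) =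
        (LINT z|lborel. V' z * (bump n a b' (fst z) * bump n c d (snd z - h)))"
      unfolding lborel_shift_snd(1)[OF m, of h, symmetric] by (simp add: case_prod_beta' plus_prod_def)
    moreover have "(LINT z|lborel. V' z * (bump n a b' (fst z) * bump n c d (snd z - 0))) -
        (LINT z|lborel. V' z * (bump n a b' (fst z) * bump n c d (snd z - h))) = 0"
      unfolding Bochner_Integration.integral_diff[OF i1 i1, symmetric]
      using zero by (simp add: algebra_simps)
    ultimately have "(LINT z|lborel. V' z * (bump n a b' (fst z) * bump n c d (snd z - 0))) -
       (LINT z|lborel. V' (z + (0, h)) * (bump n a b' (fst z) * bump n c d (snd z - 0))) = 0"
      by simp
    then show "(LINT (s, t)|lborel. ?f (s, t) * (bump n a b' s * bump n c d t)) = 0"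
      unfolding Bochner_Integration.integral_diff[OF i1 i2, symmetric]
      by (simp add: case_prod_beta' algebra_simps plus_prod_def)
  qed
  then show ?thesis
    by eventually_elim (auto simp: U_def plus_prod_def)
qed

text \<open>Integrability on the cell follows from the bounds \<open>0 < s < 1\<close> and \<open>- \<tau> < t < 0\<close> in coordinates.\<close>

lemma integrable_indicator_cell:
  assumes J: "cross2 u b \<noteq> 0" and "0 < \<tau>"
  shows "integrable lborel (\<lambda>x. indicator (cell P u b \<tau>) x * tcoord P u b x)"
proof -
  have [measurable]: "cell P u b \<tau> \<in> sets borel" by (simp add: open_cell)
  let ?I = "indicator {-\<tau>..1} :: real \<Rightarrow> real"
  have I: "integrable lborel ?I" by (simp add: integrable_indicator_iff emeasure_lborel_Icc_eq)
  have "integrable lborel (\<lambda>z. indicator (cell P u b \<tau>) (frame_pt P u b z) * tcoord P u b (frame_pt P u b z))"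
  proof (rule Bochner_Integration.integrable_bound)
    show "integrable lborel (\<lambda>z. \<tau> * (?I (fst z) * ?I (snd z)))"
      by (intro integrable_mult_right integrable_product_lborel I)
    show "AE z in lborel. norm (indicator (cell P u b \<tau>) (frame_pt P u b z) * tcoord P u b (frame_pt P u b z))
        \<le> norm (\<tau> * (?I (fst z) * ?I (snd z)))"
    proof (intro AE_I2)
      fix z :: "real \<times> real"
      obtain s t where z: "z = (s, t)" by fastforce
      show "norm (indicator (cell P u b \<tau>) (frame_pt P u b z) * tcoord P u b (frame_pt P u b z))
        \<le> norm (\<tau> * (?I (fst z) * ?I (snd z)))"
      proof (cases "frame_pt P u b z \<in> cell P u b \<tau>")
        case True
        then have st: "0 < s" "s < 1" "- \<tau> * s < t" "t < 0" by (auto simp: z mem_cell_frame_pt[OF J])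
        have "\<tau> * s \<le> \<tau> * 1" using st assms by (intro mult_left_mono) auto
        with st have "- \<tau> \<le> t" "- \<tau> \<le> s" "\<bar>t\<bar> \<le> \<tau>" using \<open>0 < \<tau>\<close> by linarith+
        then show ?thesis using st J \<open>0 < \<tau>\<close> by (auto simp: z indicator_def)
      qed simp
    qed
  qed simp
  then show ?thesis by (subst lborel_integrable_frame[OF J, of _ P]) simp_all
qed

text \<open>The function \<open>V = w - D t\<close> has zero derivative along the flow, hence is invariant under every translation
  along it, up to a null set that depends on the translation. By Fubini's theorem, on almost every
  streamline \<open>V\<close> agrees almost everywhere with one of its values, which is then the mean value of \<open>V\<close> over
  that streamline; this mean value serves as \<open>g\<close> and is a measurable function of \<open>s\<close>. Since the length of
  the streamline tends to zero at the apex \<open>s = 0\<close>, integrability of \<open>g\<close> is obtained only away from it.\<close>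

lemma cell_profile:
  fixes w :: "real^2 \<Rightarrow> real"
  assumes J: "cross2 u b \<noteq> 0" and \<tau>: "0 < \<tau>"
    and w: "integrable lborel w" and wm: "w \<in> borel_measurable borel"
    and weak: "\<And>\<psi>. test_function (cell P u b \<tau>) \<psi> \<Longrightarrow>
      (LINT x|lborel. indicator (cell P u b \<tau>) x * (w x * frechet_derivative \<psi> (at x) b + D * \<psi> x)) = 0"
  obtains g where "g \<in> borel_measurable borel" "\<And>a. 0 < a \<Longrightarrow> set_integrable lborel {a..1} g"
    "AE x in lborel. x \<in> cell P u b \<tau> \<longrightarrow> w x = D * tcoord P u b x + g (scoord P u b x)"
proof -
  let ?C = "cell P u b \<tau>" and ?X = "frame_pt P u b"
  have Cm [measurable]: "?C \<in> sets borel" by (simp add: open_cell)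
  note [measurable] = wm
  define V where "V x = indicator ?C x * (w x - D * tcoord P u b x)" for x
  define V' where "V' = (\<lambda>z. V (?X z))"
  have Vm [measurable]: "V \<in> borel_measurable borel" unfolding V_def by measurable
  have Vi: "integrable lborel V"
  proof -
    have "V = (\<lambda>x. indicator ?C x *\<^sub>R w x - D * (indicator ?C x * tcoord P u b x))"
      by (auto simp: V_def algebra_simps)
    then show ?thesis
      using integrable_mult_indicator[of ?C lborel w] w integrable_indicator_cell[OF J \<tau>]
      by (simp only:) (intro Bochner_Integration.integrable_diff integrable_mult_right; simp)
  qed
  have Vweak: "(LINT x|lborel. V x * frechet_derivative \<psi> (at x) b) = 0" if \<psi>: "test_function ?C \<psi>" for \<psi>
  proof -
    have \<psi>': "test_function UNIV \<psi>" using \<psi> test_function_mono by blast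
    obtain K where K: "\<And>x. \<bar>frechet_derivative \<psi> (at x) b\<bar> \<le> K"
      using test_function_bounded[OF \<psi>] by metis
    have i1: "integrable lborel (\<lambda>x. V x * frechet_derivative \<psi> (at x) b)"
      using smooth_borel_measurable(2)[OF test_function_smooth[OF \<psi>]]
      by (intro integrable_mult_bounded_real[OF Vi _ K]) simp
    have i2: "integrable lborel (half_plane_flux P u b D (\<lambda>_. 0) \<psi>)"
      by (rule half_plane_flux_integral(1)[OF J \<psi>']) simp
    have eq: "indicator ?C x * (w x * frechet_derivative \<psi> (at x) b + D * \<psi> x) =
        V x * frechet_derivative \<psi> (at x) b + half_plane_flux P u b D (\<lambda>_. 0) \<psi> x" for x
      unfolding half_plane_flux_cell[OF \<psi>] by (auto simp: V_def algebra_simps indicator_def)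
    have "0 = (LINT x|lborel. V x * frechet_derivative \<psi> (at x) b) +
        (LINT x|lborel. half_plane_flux P u b D (\<lambda>_. 0) \<psi> x)"
      using weak[OF \<psi>] unfolding eq Bochner_Integration.integral_add[OF i1 i2] by simp
    then show ?thesis using cell_flux_zero[OF J \<psi>, of "\<lambda>_. 0" D] by simp
  qed
  have V'm [measurable]: "V' \<in> borel_measurable borel" unfolding V'_def by measurable
  have V'pm [measurable]: "V' \<in> borel_measurable (borel \<Otimes>\<^sub>M borel)" using V'm by (simp add: borel_prod)
  have V'i: "integrable lborel V'"
    using lborel_integrable_frame[OF J Vm] Vi unfolding V'_def by blast
  define U where "U s t \<longleftrightarrow> 0 < s \<and> s < 1 \<and> - \<tau> * s < t \<and> t < 0" for s t
  have UC: "?X (s, t) \<in> ?C \<longleftrightarrow> U s t" for s t using mem_cell_frame_pt[OF J] by (simp add: U_def)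
  have Um [measurable]: "Measurable.pred (borel \<Otimes>\<^sub>M borel) (\<lambda>z. U (fst z) (snd z))"
    unfolding U_def by measurable
  define R where "R h z \<longleftrightarrow> (U (fst z) (snd z) \<longrightarrow> U (fst z) (snd z + h) \<longrightarrow> V' z = V' (fst z, snd z + h))" for h z
  have R1: "AE z in lborel. R h z" for h
  proof -
    have "AE (s, t) in lborel. ?X (s, t) \<in> ?C \<longrightarrow> ?X (s, t + h) \<in> ?C \<longrightarrow>
        V (?X (s, t)) = V (?X (s, t + h))"
      using J Vi Vm Vweak by (rule shift_invariant_along_flow)
    then show ?thesis by eventually_elim (auto simp: R_def UC V'_def)
  qed
  have Rm: "Measurable.pred (borel \<Otimes>\<^sub>M (borel \<Otimes>\<^sub>M borel)) (\<lambda>(h, z). R h z)"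
    unfolding R_def U_def case_prod_beta' by measurable
  have "AE h in lborel. AE z in lborel. R h z" using R1 by simp
  then have "AE z in lborel. AE h in lborel. R h z"
  proof (subst (asm) lborel_pair.AE_commute)
    have "sets (lborel \<Otimes>\<^sub>M lborel) = sets (borel \<Otimes>\<^sub>M (borel :: (real \<times> real) measure) :: (real \<times> real \<times> real) measure)"
      by (intro sets_pair_measure_cong sets_lborel)
    then show "{z \<in> space (lborel \<Otimes>\<^sub>M lborel). R (fst z) (snd z)} \<in> sets (lborel \<Otimes>\<^sub>M lborel)"
      using Rm unfolding pred_def borel_prod[symmetric] by (simp add: case_prod_beta' space_pair_measure)
  qed
  then have "AE z in lborel \<Otimes>\<^sub>M lborel. AE h in lborel. R h z" unfolding lborel_prod .
  then have AEst: "AE s in lborel. AE t in lborel. AE h in lborel. R h (s, t)"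
    by (rule lborel_pair.AE_pair)
  \<comment> \<open>The function \<open>V\<close> vanishes outside the cell, whose intersection with the streamline has length \<open>\<tau> s\<close> in \<open>t\<close>.\<close>
  define g where "g s = (LINT t|lborel. V' (s, t)) / (\<tau> * s)" for s
  have gm [measurable]: "g \<in> borel_measurable borel"
  proof -
    have "(\<lambda>(s, t). V' (s, t)) \<in> borel_measurable (borel \<Otimes>\<^sub>M lborel)"
      using V'pm by (simp add: measurable_cong_sets[OF sets_pair_measure_cong[OF refl sets_lborel] refl])
    then have [measurable]: "(\<lambda>s. LINT t|lborel. V' (s, t)) \<in> borel_measurable borel"
      by (rule lborel.borel_measurable_lebesgue_integral)
    show ?thesis unfolding g_def by measurable
  qed
  have gs: "AE t in lborel. U s t \<longrightarrow> V' (s, t) = g s" if s: "0 < s" "s < 1"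
    and R: "AE t in lborel. AE h in lborel. R h (s, t)" for s
  proof -
    have pos: "- \<tau> * s < 0" using \<tau> s by simp
    obtain t0 where t0: "t0 \<in> {- \<tau> * s<..<0}" and R0: "AE h in lborel. R h (s, t0)"
      using AE_lborel_ex_Ioo[OF R pos] by blast
    have "Measurable.pred borel (\<lambda>h. R h (s, t0))"
      unfolding R_def U_def by measurable
    from AE_borel_affine[OF _ this, of 1 "- t0"] R0
    have "AE t in lborel. R (t - t0) (s, t0)" by simp
    then have const: "AE t in lborel. U s t \<longrightarrow> V' (s, t) = V' (s, t0)"
      by eventually_elim (use t0 s in \<open>auto simp: R_def U_def\<close>)
    have "AE t in lborel. V' (s, t) = V' (s, t0) * indicator {- \<tau> * s<..<0} t"
      using const by eventually_elim (use s in \<open>auto simp: U_def V'_def V_def UC indicator_def\<close>)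
    then have "(LINT t|lborel. V' (s, t)) = (LINT t|lborel. V' (s, t0) * indicator {- \<tau> * s<..<0} t)"
      by (intro integral_cong_AE) auto
    also have "\<dots> = V' (s, t0) * (\<tau> * s)" using pos by simp
    finally have "g s = V' (s, t0)" using \<tau> s by (simp add: g_def)
    with const show ?thesis by simp
  qed
  have "AE s in lborel. AE t in lborel. U s t \<longrightarrow> V' (s, t) = g s"
    using AEst
  proof eventually_elim
    case (elim s)
    show ?case
    proof (cases "0 < s \<and> s < 1")
      case True
      then show ?thesis using gs elim by blast
    qed (auto simp: U_def)
  qed
  then have "AE z in lborel \<Otimes>\<^sub>M lborel. U (fst z) (snd z) \<longrightarrow> V' z = g (fst z)"
  proof (rule lborel_pair.AE_pair_measure[rotated, of "\<lambda>z. U (fst z) (snd z) \<longrightarrow> V' z = g (fst z)", simplified fst_conv snd_conv])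
    have "Measurable.pred (borel \<Otimes>\<^sub>M borel) (\<lambda>z. U (fst z) (snd z) \<longrightarrow> V' z = g (fst z))" by measurable
    then show "{z \<in> space (lborel \<Otimes>\<^sub>M lborel). U (fst z) (snd z) \<longrightarrow> V' z = g (fst z)} \<in> sets (lborel \<Otimes>\<^sub>M lborel)"
      by (simp add: pred_def space_pair_measure sets_pair_measure_cong[OF sets_lborel sets_lborel])
  qed
  then have "AE z in lborel. ?X z \<in> ?C \<longrightarrow> w (?X z) = D * tcoord P u b (?X z) + g (scoord P u b (?X z))"
    unfolding lborel_prod
  proof eventually_elim
    case (elim z)
    obtain s t where z: "z = (s, t)" by fastforce
    show ?case using elim J by (auto simp: z UC V'_def V_def)
  qed
  then have "AE x in lborel. x \<in> ?C \<longrightarrow> w x = D * tcoord P u b x + g (scoord P u b x)"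
    by (subst AE_lborel_frame[OF J, of _ P]) simp_all
  moreover have "set_integrable lborel {a..1} g" if a: "0 < a" for a
  proof -
    have iV: "integrable lborel (\<lambda>s. LINT t|lborel. V' (s, t))"
      using lborel_pair.integrable_fst'[of V'] V'i by (simp add: lborel_prod)
    have "integrable lborel (\<lambda>s. (LINT t|lborel. V' (s, t)) * (indicator {a..1} s / (\<tau> * s)))"
    proof (rule integrable_mult_bounded_real[OF iV])
      show "\<bar>indicator {a..1} s / (\<tau> * s)\<bar> \<le> 1 / (\<tau> * a)" for s
        using a \<tau> by (auto simp: indicator_def intro!: divide_left_mono mult_left_mono)
    qed measurable
    then show ?thesis by (simp add: set_integrable_def g_def mult.commute)
  qed
  ultimately show thesis using gm that by blast
qed

section \<open>Traces on the two sides of a segment\<close>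

lemma scoord_uminus [simp]: "scoord P u (- b) x = scoord P u b x"
  and tcoord_uminus [simp]: "tcoord P u (- b) x = - tcoord P u b x"
  by (simp_all add: scoord_def tcoord_def)

text \<open>Lets the profile be cut off outside the support of a test function, where it need not be integrable.\<close>

lemma half_plane_flux_cong_profile:
  assumes "test_function K \<psi>" "\<And>x. x \<in> K \<Longrightarrow> g (scoord P u b x) = g' (scoord P u b x)"
  shows "half_plane_flux P u b D g \<psi> x = half_plane_flux P u b D g' \<psi> x"
  using assms test_function_outside[OF assms(1), of x]
  by (cases "x \<in> K") (auto simp: half_plane_flux_def)

text \<open>The function is \<open>D t + g(s)\<close> upstream of the segment from \<open>P\<close> to \<open>P + u\<close> and is given by \<open>g'\<close> downstream, where the
  flow direction is \<open>b'\<close>; the downstream side is treated as an upstream side for the reversed direction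
  \<open>- b'\<close>. The difference of the two half-plane fluxes is, up to a constant factor, the integral of
  \<open>(g - g') \<psi>\<close> over the segment, and the restriction of \<open>\<psi>\<close> to the segment can be any bump.\<close>

lemma trace_match:
  assumes J: "cross2 u b \<noteq> 0" and J': "cross2 u b' \<noteq> 0" and JJ: "\<bar>cross2 u b'\<bar> = \<bar>cross2 u b\<bar>"
    and g: "\<And>a b. 0 < a \<Longrightarrow> b < 1 \<Longrightarrow> set_integrable lborel {a..b} g"
    and g': "\<And>a b. 0 < a \<Longrightarrow> b < 1 \<Longrightarrow> set_integrable lborel {a..b} g'"
    and N: "open N" "\<And>s. 0 < s \<Longrightarrow> s < 1 \<Longrightarrow> P + s *\<^sub>R u \<in> N"
    and weak: "\<And>\<psi>. test_function N \<psi> \<Longrightarrow>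
      (LINT x|lborel. half_plane_flux P u b D g \<psi> x - half_plane_flux P u (- b') D' g' \<psi> x) = 0"
  shows "AE s in lborel. s \<in> {0<..<1} \<longrightarrow> g s = g' s"
proof -
  have "AE s in lborel. s \<in> {0<..<1} \<longrightarrow> g s - g' s = 0"
  proof (rule AE_zero_of_bump_integrals_real)
    fix a c :: real assume ac: "{a..c} \<subseteq> {0<..<1}"
    then show "set_integrable lborel {a..c} (\<lambda>s. g s - g' s)"
    proof (cases "a \<le> c")
      case True
      then have "0 < a" "c < 1" using ac by auto
      then show ?thesis by (intro set_integral_diff(1) g g')
    qed (simp add: set_integrable_def)
  next
    fix a c :: real and n
    assume ac: "a < c" "{a..c} \<subseteq> {0<..<1}"
    then have ac': "0 < a" "c < 1" by (auto simp: subset_eq)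
    \<comment> \<open>On this smaller set the downstream profile is needed only on a compact part of \<open>(0, 1)\<close>.\<close>
    define N' where "N' = N \<inter> {x. a / 2 < scoord P u b' x \<and> scoord P u b' x < (1 + c) / 2}"
    have "open N'" unfolding N'_def
      by (intro open_Int N open_Collect_conj open_Collect_less continuous_intros)
    define W where "W = frame_pt P u b -` N'"
    have opW: "open W" unfolding W_def
      by (intro open_vimage \<open>open N'\<close> continuous_intros)
    have segW: "(\<lambda>s. (s, 0)) ` {a..c} \<subseteq> W"
    proof clarify
      fix s assume s: "s \<in> {a..c}"
      have "scoord P u b' (P + s *\<^sub>R u) = s"
        using scoord_frame_pt[OF J', of P s 0] by (simp add: frame_pt_def)
      then show "(s, 0) \<in> W" using s ac' N(2)[of s] by (simp add: W_def N'_def frame_pt_def)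
    qed
    have opn: "openin (top_of_set ({a..c} \<times> UNIV)) (W \<inter> {a..c} \<times> UNIV)"
      using opW openin_open_Int[of W "{a..c} \<times> UNIV"] by (simp only: Int_commute)
    have ne: "{a..c} \<noteq> {}" using ac by simp
    have img: "(\<lambda>s. (s, 0)) ` {a..c} \<subseteq> W \<inter> {a..c} \<times> UNIV" using segW by blast
    obtain X0 where "openin (top_of_set UNIV) X0" "0 \<in> X0" "{a..c} \<times> X0 \<subseteq> W \<inter> {a..c} \<times> UNIV"
      by (rule tube_lemma[OF compact_Icc ne img opn])
    then have X0: "0 \<in> X0" "open X0" "{a..c} \<times> X0 \<subseteq> W" by auto
    from X0(1,2) obtain \<delta> where \<delta>: "0 < \<delta>" "cball 0 \<delta> \<subseteq> X0" using open_contains_cball by blast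
    let ?K = "frame_pt P u b ` ({a..c} \<times> {- \<delta>..\<delta>})"
    have KN': "?K \<subseteq> N'"
    proof clarsimp
      fix s t assume "a \<le> s" "s \<le> c" "- \<delta> \<le> t" "t \<le> \<delta>"
      then have "(s, t) \<in> W" using \<delta> X0 by (intro subsetD[OF X0(3)]) (auto simp: abs_le_iff subset_eq)
      then show "frame_pt P u b (s, t) \<in> N'" by (simp add: W_def)
    qed
    define \<psi> where "\<psi> x = bump n a c (scoord P u b x) * bump 0 (- \<delta>) \<delta> (tcoord P u b x)" for x
    have tK: "test_function ?K \<psi>"
      unfolding \<psi>_def by (rule frame_bump_test_function[OF J order_refl])
    have tN: "test_function N \<psi>" and tU: "test_function UNIV \<psi>"
      using test_function_mono[OF tK] KN' by (auto simp: N'_def)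
    let ?I = "{a / 2..(1 + c) / 2}"
    let ?g = "\<lambda>s. indicator ?I s *\<^sub>R g s" and ?g' = "\<lambda>s. indicator ?I s *\<^sub>R g' s"
    have gi: "integrable lborel ?g" "integrable lborel ?g'"
      using g[of "a / 2" "(1 + c) / 2"] g'[of "a / 2" "(1 + c) / 2"] ac' by (auto simp: set_integrable_def)
    have J'': "cross2 u (- b') \<noteq> 0" using J' by simp
    have e1: "half_plane_flux P u b D g \<psi> x = half_plane_flux P u b D ?g \<psi> x" for x
      by (rule half_plane_flux_cong_profile[OF tK]) (use J ac ac' in auto)
    have e2: "half_plane_flux P u (- b') D' g' \<psi> x = half_plane_flux P u (- b') D' ?g' \<psi> x" for x
    proof (rule half_plane_flux_cong_profile[OF tK])
      fix y assume "y \<in> ?K"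
      then have "y \<in> N'" using KN' by blast
      then have "scoord P u b' y \<in> ?I" by (simp add: N'_def)
      then show "g' (scoord P u (- b') y) = ?g' (scoord P u (- b') y)" by simp
    qed
    define \<kappa> where "\<kappa> = bump 0 (- \<delta>) \<delta> 0"
    have \<kappa>: "\<kappa> \<noteq> 0" using \<delta> by (simp add: \<kappa>_def bump_eq_0_iff)
    have \<psi>u: "\<psi> (P + s *\<^sub>R u) = bump n a c s * \<kappa>" for s
      using scoord_frame_pt[OF J, of P s 0] tcoord_frame_pt[OF J, of P s 0]
      by (simp add: frame_pt_def \<psi>_def \<kappa>_def)
    have ib: "integrable lborel (\<lambda>s. h s * (bump n a c s * \<kappa>))" if "integrable lborel h" for h
    proof (rule integrable_mult_bounded_real[OF that])
      show "\<bar>bump n a c x * \<kappa>\<bar> \<le> \<bar>\<kappa>\<bar>" for x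
        using bump_nonneg[of n a c x] bump_le_1[of n a c x] by (auto simp: abs_mult intro: mult_left_le_one_le)
    qed (use smooth_borel_measurable[OF smooth_bump] in simp)
    note h1 = half_plane_flux_integral[OF J tU gi(1), of P D]
    note h2 = half_plane_flux_integral[OF J'' tU gi(2), of P D']
    have "0 = (LINT x|lborel. half_plane_flux P u b D ?g \<psi> x) - (LINT x|lborel. half_plane_flux P u (- b') D' ?g' \<psi> x)"
      using weak[OF tN] unfolding e1 e2 Bochner_Integration.integral_diff[OF h1(1) h2(1)] by simp
    also have "\<dots> = \<bar>cross2 u b\<bar> * ((LINT s|lborel. ?g s * (bump n a c s * \<kappa>)) - (LINT s|lborel. ?g' s * (bump n a c s * \<kappa>)))"
      unfolding h1(2) h2(2) \<psi>u using JJ by (simp add: right_diff_distrib)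
    also have "\<dots> = \<bar>cross2 u b\<bar> * (LINT s|lborel. ?g s * (bump n a c s * \<kappa>) - ?g' s * (bump n a c s * \<kappa>))"
      by (subst Bochner_Integration.integral_diff[OF ib ib]) (use gi in auto)
    also have "(\<lambda>s. ?g s * (bump n a c s * \<kappa>) - ?g' s * (bump n a c s * \<kappa>)) = (\<lambda>s. ((g s - g' s) * bump n a c s) * \<kappa>)"
    proof
      fix s show "?g s * (bump n a c s * \<kappa>) - ?g' s * (bump n a c s * \<kappa>) = ((g s - g' s) * bump n a c s) * \<kappa>"
      proof (cases "bump n a c s = 0")
        case False
        then have "s \<in> ?I" using ac ac' by (auto simp: bump_eq_0_iff)
        then show ?thesis by (simp add: algebra_simps)
      qed simp
    qed
    finally show "(LINT s|lborel. (g s - g' s) * bump n a c s) = 0" using \<kappa> J by simp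
  qed simp
  then show ?thesis by simp
qed

section \<open>Triangles in flow coordinates\<close>

lemma AE_lebesgue_on_iff:
  "S \<in> sets lebesgue \<Longrightarrow> (AE x in lebesgue_on S. P x) \<longleftrightarrow> (AE x in lborel. x \<in> S \<longrightarrow> P x)"
  by (simp add: AE_restrict_space_iff AE_completion_iff)

lemma AE_lborel_ex_open:
  fixes U :: "'a::euclidean_space set"
  assumes "AE x in lborel. P x" "open U" "U \<noteq> {}"
  shows "\<exists>x\<in>U. P x"
proof (rule ccontr)
  assume neg: "\<not> ?thesis"
  have "AE x in lborel. x \<notin> U"
    using assms(1) by eventually_elim (use neg in blast)
  then have "U \<in> null_sets lborel"
    using assms(2) by (subst (asm) AE_iff_null_sets[symmetric]) auto
  then have "negligible U" by (simp add: negligible_iff_null_sets null_sets_completionI)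
  then show False using assms(2,3) open_not_negligible by blast
qed

text \<open>Rotation by a right angle; \<open>perp u\<close> spans the normals of a segment in direction \<open>u\<close>.\<close>

definition perp :: "real^2 \<Rightarrow> real^2" where
  "perp u = vector [- (u $ 2), u $ 1]"

lemma inner_perp: "v \<bullet> perp u = cross2 u v" "perp u \<bullet> v = cross2 u v"
  by (simp_all add: perp_def cross2_def inner_vec_def UNIV_2)

lemma norm_perp [simp]: "norm (perp u) = norm u"
  by (simp add: norm_eq_sqrt_inner inner_vec_def UNIV_2 perp_def)

lemma cross2_eq_0D:
  assumes "cross2 u v = 0" "u \<noteq> 0"
  obtains k where "v = k *\<^sub>R u"
proof (cases "u $ 1 = 0")
  case True
  then have "u $ 2 \<noteq> 0" using assms(2) by (simp add: vec2_eq_iff)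
  then have "v = (v $ 2 / u $ 2) *\<^sub>R u" using True assms(1) by (simp add: vec2_eq_iff cross2_def)
  then show thesis using that by blast
next
  case False
  then have "v = (v $ 1 / u $ 1) *\<^sub>R u" using assms(1) by (simp add: vec2_eq_iff cross2_def field_simps)
  then show thesis using that by blast
qed

definition closed_cell :: "real^2 \<Rightarrow> real^2 \<Rightarrow> real^2 \<Rightarrow> real \<Rightarrow> (real^2) set" where
  "closed_cell P u b \<tau> = {x. scoord P u b x \<le> 1 \<and> - \<tau> * scoord P u b x \<le> tcoord P u b x \<and> tcoord P u b x \<le> 0}"

lemma convex_hull_closed_cell:
  assumes J: "cross2 u b \<noteq> 0" and \<tau>: "0 < \<tau>"
  shows "convex hull {P, P + u, P + u - \<tau> *\<^sub>R b} = closed_cell P u b \<tau>"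
proof (intro equalityI subsetI)
  fix x assume "x \<in> convex hull {P, P + u, P + u - \<tau> *\<^sub>R b}"
  then obtain p q r where pqr: "x = p *\<^sub>R P + q *\<^sub>R (P + u) + r *\<^sub>R (P + u - \<tau> *\<^sub>R b)"
    "0 \<le> p" "0 \<le> q" "0 \<le> r" "p + q + r = 1"
    unfolding convex_hull_3 by blast
  then have p: "p = 1 - q - r" by simp
  have "x = frame_pt P u b (q + r, - r * \<tau>)"
    unfolding pqr(1) p by (simp add: frame_pt_def algebra_simps)
  then show "x \<in> closed_cell P u b \<tau>" using pqr J \<tau> by (simp add: closed_cell_def algebra_simps)
next
  fix x assume "x \<in> closed_cell P u b \<tau>"
  then have st: "scoord P u b x \<le> 1" "- \<tau> * scoord P u b x \<le> tcoord P u b x" "tcoord P u b x \<le> 0"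
    by (auto simp: closed_cell_def)
  define r where "r = - tcoord P u b x / \<tau>"
  define q where "q = scoord P u b x - r"
  have "r \<le> scoord P u b x" using st \<tau> by (simp add: r_def field_simps)
  then have qr: "0 \<le> r" "0 \<le> q" "q + r \<le> 1" using st \<tau> by (auto simp: r_def q_def divide_nonpos_pos)
  have "x = frame_pt P u b (q + r, - r * \<tau>)"
    using frame_coords[OF J, of P x] \<tau> by (simp add: q_def r_def)
  also have "\<dots> = (1 - q - r) *\<^sub>R P + q *\<^sub>R (P + u) + r *\<^sub>R (P + u - \<tau> *\<^sub>R b)"
    by (simp add: frame_pt_def algebra_simps)
  finally show "x \<in> convex hull {P, P + u, P + u - \<tau> *\<^sub>R b}"
    unfolding convex_hull_3 using qr by force
qed

lemma cell_subset_closed_cell: "cell P u b \<tau> \<subseteq> closed_cell P u b \<tau>"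
  by (auto simp: cell_def closed_cell_def)

lemma small_scaling:
  fixes v :: "'a::real_normed_vector"
  assumes "0 < e"
  obtains c where "0 < c" "norm (c *\<^sub>R v) < e"
proof (cases "v = 0")
  case False
  then show thesis using assms by (intro that[of "e / (2 * norm v)"]) auto
qed (use assms that[of 1] in auto)

lemma mem_interiorD_shift:
  fixes x v :: "'a::real_normed_vector"
  assumes "x \<in> interior S"
  obtains \<epsilon> where "0 < \<epsilon>" "x + \<epsilon> *\<^sub>R v \<in> S"
proof -
  obtain e where e: "0 < e" "ball x e \<subseteq> S" using assms by (auto simp: mem_interior)
  obtain c where c: "0 < c" "norm (c *\<^sub>R v) < e" using small_scaling[OF e(1)] by blast
  then have "x + c *\<^sub>R v \<in> ball x e" by (simp add: dist_norm)
  then show thesis using e(2) c(1) that by blast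
qed

lemma coords_shift:
  "cross2 u b \<noteq> 0 \<Longrightarrow> scoord P u b (x + c *\<^sub>R v) = scoord P u b x + c * (cross2 v b / cross2 u b)"
  "cross2 u b \<noteq> 0 \<Longrightarrow> tcoord P u b (x + c *\<^sub>R v) = tcoord P u b x + c * (cross2 u v / cross2 u b)"
  by (simp_all add: scoord_affine tcoord_affine cross2_add add_divide_distrib)

lemma interior_closed_cell:
  assumes J: "cross2 u b \<noteq> 0" and \<tau>: "0 < \<tau>"
  shows "interior (closed_cell P u b \<tau>) = cell P u b \<tau>"
proof
  show "cell P u b \<tau> \<subseteq> interior (closed_cell P u b \<tau>)"
    by (intro interior_maximal open_cell cell_subset_closed_cell)
  show "interior (closed_cell P u b \<tau>) \<subseteq> cell P u b \<tau>"
  proof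
    fix x assume x: "x \<in> interior (closed_cell P u b \<tau>)"
    obtain e1 where e1: "0 < e1" "x + e1 *\<^sub>R b \<in> closed_cell P u b \<tau>" by (rule mem_interiorD_shift[OF x])
    obtain e2 where e2: "0 < e2" "x + e2 *\<^sub>R (- b) \<in> closed_cell P u b \<tau>" by (rule mem_interiorD_shift[OF x])
    obtain e3 where e3: "0 < e3" "x + e3 *\<^sub>R u \<in> closed_cell P u b \<tau>" by (rule mem_interiorD_shift[OF x])
    have t: "tcoord P u b x < 0" and s: "scoord P u b x < 1" and st: "- \<tau> * scoord P u b x < tcoord P u b x"
      using e1 e2 e3 J unfolding closed_cell_def mem_Collect_eq coords_shift[OF J] by auto
    then have "0 < \<tau> * scoord P u b x" by simp
    then have "0 < scoord P u b x" using \<tau> by (simp add: zero_less_mult_iff)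
    then show "x \<in> cell P u b \<tau>" using t s st by (simp add: cell_def)
  qed
qed

lemma AE_closed_cell:
  assumes J: "cross2 u b \<noteq> 0" and \<tau>: "0 < \<tau>"
  shows "AE x in lborel. x \<in> closed_cell P u b \<tau> \<longrightarrow> x \<in> cell P u b \<tau>"
proof -
  have cl: "closed (closed_cell P u b \<tau>)" and cv: "convex (closed_cell P u b \<tau>)"
    unfolding convex_hull_closed_cell[OF J \<tau>, symmetric]
    by (auto intro!: compact_imp_closed[OF compact_convex_hull[OF finite_imp_compact]] convex_convex_hull)
  have "negligible (frontier (closed_cell P u b \<tau>))" using cv by (rule negligible_convex_frontier)
  then have "AE x in lebesgue. x \<notin> frontier (closed_cell P u b \<tau>)"
    by (simp add: negligible_iff_null_sets AE_not_in)
  then have "AE x in lborel. x \<notin> frontier (closed_cell P u b \<tau>)" by (simp add: AE_completion_iff)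
  then show ?thesis
    by eventually_elim (use cl in \<open>auto simp: frontier_def interior_closed_cell[OF J \<tau>]\<close>)
qed

lemma cell_nonempty:
  assumes J: "cross2 u b \<noteq> 0" and \<tau>: "0 < \<tau>"
  shows "cell P u b \<tau> \<noteq> {}"
proof -
  have "frame_pt P u b (1 / 2, - \<tau> / 4) \<in> cell P u b \<tau>"
    using \<tau> by (simp add: mem_cell_frame_pt[OF J])
  then show ?thesis by blast
qed

text \<open>An open neighbourhood of the relative interior of the exit edge in which the sign of \<open>t\<close> alone decides
  membership in the triangle.\<close>

definition near_exit :: "real^2 \<Rightarrow> real^2 \<Rightarrow> real^2 \<Rightarrow> real \<Rightarrow> (real^2) set" where
  "near_exit P u b \<tau> = {y. 0 < scoord P u b y \<and> scoord P u b y < 1 \<and> - \<tau> * scoord P u b y < tcoord P u b y}"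

lemma open_near_exit: "open (near_exit P u b \<tau>)"
  unfolding near_exit_def by (intro open_Collect_conj open_Collect_less continuous_intros)

lemma exit_edge_near_exit:
  assumes "cross2 u b \<noteq> 0" "0 < \<tau>" "0 < s" "s < 1"
  shows "P + s *\<^sub>R u \<in> near_exit P u b \<tau>"
  using scoord_frame_pt[OF assms(1), of P s 0] tcoord_frame_pt[OF assms(1), of P s 0] assms
  by (simp add: frame_pt_def near_exit_def)

lemma near_exit_cell:
  assumes "y \<in> near_exit P u b \<tau>"
  shows "y \<in> closed_cell P u b \<tau> \<longleftrightarrow> tcoord P u b y \<le> 0" "y \<in> cell P u b \<tau> \<longleftrightarrow> tcoord P u b y < 0"
  using assms by (auto simp: near_exit_def closed_cell_def cell_def)

lemma exit_edge_neighbourhood: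
  assumes J: "cross2 u b \<noteq> 0" and \<tau>: "0 < \<tau>" and s0: "0 < s0" "s0 < 1"
  obtains r where "0 < r"
    "\<And>y. y \<in> ball (P + s0 *\<^sub>R u) r \<Longrightarrow> y \<in> cell P u b \<tau> \<longleftrightarrow> tcoord P u b y < 0"
proof -
  obtain r where r: "0 < r" "ball (P + s0 *\<^sub>R u) r \<subseteq> near_exit P u b \<tau>"
    by (rule openE[OF open_near_exit exit_edge_near_exit[OF J \<tau> s0]])
  show thesis
  proof (rule that[OF r(1)])
    fix y assume "y \<in> ball (P + s0 *\<^sub>R u) r"
    then show "y \<in> cell P u b \<tau> \<longleftrightarrow> tcoord P u b y < 0"
      using near_exit_cell(2) r(2) by blast
  qed
qed

text \<open>The sign makes the normal point out of the cell, whatever the orientation of \<open>u\<close> and \<open>b\<close>.\<close>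

definition exit_normal :: "real^2 \<Rightarrow> real^2 \<Rightarrow> real^2" where
  "exit_normal u b = (sgn (cross2 u b) / norm u) *\<^sub>R perp u"

lemma exit_normal:
  assumes J: "cross2 u b \<noteq> 0"
  shows "norm (exit_normal u b) = 1" "v \<bullet> exit_normal u b = sgn (cross2 u b) * cross2 u v / norm u"
    "b \<bullet> exit_normal u b > 0"
    "(y - (P + s0 *\<^sub>R u)) \<bullet> exit_normal u b < 0 \<longleftrightarrow> tcoord P u b y < 0"
proof -
  have u: "norm u > 0" using J by auto
  show "norm (exit_normal u b) = 1" using u J by (simp add: exit_normal_def abs_sgn_eq)
  show *: "v \<bullet> exit_normal u b = sgn (cross2 u b) * cross2 u v / norm u" for v
    by (simp add: exit_normal_def inner_perp)
  have c: "sgn (cross2 u b) * cross2 u b = \<bar>cross2 u b\<bar>" by (simp add: abs_sgn mult.commute)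
  show "b \<bullet> exit_normal u b > 0" unfolding * c using u J by simp
  have "cross2 u (y - (P + s0 *\<^sub>R u)) = cross2 u b * tcoord P u b y"
    using J by (simp add: tcoord_def cross2_diff cross2_add)
  then have "(y - (P + s0 *\<^sub>R u)) \<bullet> exit_normal u b = \<bar>cross2 u b\<bar> / norm u * tcoord P u b y"
    unfolding * c[symmetric] by simp
  then show "(y - (P + s0 *\<^sub>R u)) \<bullet> exit_normal u b < 0 \<longleftrightarrow> tcoord P u b y < 0"
    using u J by (simp add: mult_less_0_iff divide_less_0_iff zero_less_divide_iff)
qed

lemma outward_normal_cell:
  assumes J: "cross2 u b \<noteq> 0" and \<tau>: "0 < \<tau>" and s0: "0 < s0" "s0 < 1"
  shows "outward_normal (cell P u b \<tau>) (P + s0 *\<^sub>R u) (exit_normal u b)"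
proof -
  obtain r where r: "0 < r" "\<And>y. y \<in> ball (P + s0 *\<^sub>R u) r \<Longrightarrow> y \<in> cell P u b \<tau> \<longleftrightarrow> tcoord P u b y < 0"
    by (rule exit_edge_neighbourhood[OF J \<tau> s0, of P]) blast
  then have "cell P u b \<tau> \<inter> ball (P + s0 *\<^sub>R u) r =
      {y \<in> ball (P + s0 *\<^sub>R u) r. (y - (P + s0 *\<^sub>R u)) \<bullet> exit_normal u b < 0}"
    unfolding exit_normal(4)[OF J] by blast
  then show ?thesis using r(1) exit_normal(1)[OF J] by (auto simp: outward_normal_def)
qed

text \<open>Both normals define the same half ball around \<open>x\<close>, hence the same half space, but \<open>\<nu> - \<nu>'\<close> would lie in only
  one of the two half spaces if \<open>\<nu> \<noteq> \<nu>'\<close>.\<close>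

lemma outward_normal_unique:
  assumes "outward_normal \<Omega> x \<nu>" "outward_normal \<Omega> x \<nu>'"
  shows "\<nu> = \<nu>'"
proof -
  obtain r r' where r: "0 < r" "\<Omega> \<inter> ball x r = {y \<in> ball x r. (y - x) \<bullet> \<nu> < 0}"
    and r': "0 < r'" "\<Omega> \<inter> ball x r' = {y \<in> ball x r'. (y - x) \<bullet> \<nu>' < 0}"
    and n: "norm \<nu> = 1" "norm \<nu>' = 1"
    using assms by (auto simp: outward_normal_def)
  have n': "\<nu> \<bullet> \<nu> = 1" "\<nu>' \<bullet> \<nu>' = 1" using n by (simp_all add: norm_eq_1)
  have iff: "v \<bullet> \<nu> < 0 \<longleftrightarrow> v \<bullet> \<nu>' < 0" for v
  proof -
    have "0 < min r r'" using r(1) r'(1) by simp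
    then obtain e where e: "0 < e" "norm (e *\<^sub>R v) < min r r'" using small_scaling by blast
    have "x + e *\<^sub>R v \<in> ball x r" "x + e *\<^sub>R v \<in> ball x r'" using e(2) by (auto simp: dist_norm)
    then have "(e *\<^sub>R v) \<bullet> \<nu> < 0 \<longleftrightarrow> (e *\<^sub>R v) \<bullet> \<nu>' < 0"
      using r(2) r'(2) by (metis (no_types, lifting) IntE IntI add_diff_cancel_left' mem_Collect_eq)
    then show ?thesis using e by (simp add: mult_less_0_iff)
  qed
  have "\<nu> \<bullet> \<nu>' = 1"
  proof (rule ccontr)
    assume "\<nu> \<bullet> \<nu>' \<noteq> 1"
    moreover have "\<nu> \<bullet> \<nu>' \<le> 1" using norm_cauchy_schwarz[of \<nu> \<nu>'] n by simp
    ultimately have "(\<nu> - \<nu>') \<bullet> \<nu>' < 0" "\<not> (\<nu> - \<nu>') \<bullet> \<nu> < 0"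
      using n' unfolding inner_diff_left inner_commute[of \<nu>' \<nu>] by linarith+
    then show False using iff by blast
  qed
  then have "(\<nu> - \<nu>') \<bullet> (\<nu> - \<nu>') = 0"
    using n' by (simp add: inner_diff_left inner_diff_right inner_commute)
  then show ?thesis by simp
qed

section \<open>Boundaries of Lipschitz domains\<close>

lemma boundary_value_unique:
  assumes "open \<Omega>" "x \<in> closure \<Omega>" "boundary_value \<Omega> \<beta> x b" "boundary_value \<Omega> \<beta> x b'"
  shows "b = b'"
proof -
  obtain r r' where r: "0 < r" "AE y in lebesgue_on (\<Omega> \<inter> ball x r). \<beta> y = b"
    and r': "0 < r'" "AE y in lebesgue_on (\<Omega> \<inter> ball x r'). \<beta> y = b'"
    using assms(3,4) by (auto simp: boundary_value_def)
  have s: "\<Omega> \<inter> ball x e \<in> sets lebesgue" for e using assms(1) by (auto intro: borel_open)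
  let ?U = "\<Omega> \<inter> ball x (min r r')"
  have "AE y in lborel. y \<in> ?U \<longrightarrow> b = b'"
    using r(2) r'(2) unfolding AE_lebesgue_on_iff[OF s] by eventually_elim auto
  moreover have "open ?U" using assms(1) by (intro open_Int open_ball)
  moreover have "?U \<noteq> {}"
  proof -
    have "0 < min r r'" using r(1) r'(1) by simp
    then obtain y where "y \<in> \<Omega>" "dist y x < min r r'" using assms(2) unfolding closure_approachable by blast
    then have "y \<in> ?U" by (simp add: dist_commute)
    then show ?thesis by blast
  qed
  ultimately show ?thesis using AE_lborel_ex_open by blast
qed

lemma outward_normal_frontier:
  assumes "outward_normal \<Omega> x \<nu>" "open \<Omega>"
  shows "x \<in> frontier \<Omega>"
proof -
  obtain r where r: "0 < r" "\<Omega> \<inter> ball x r = {y \<in> ball x r. (y - x) \<bullet> \<nu> < 0}" and n: "norm \<nu> = 1"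
    using assms(1) by (auto simp: outward_normal_def)
  have "x \<notin> \<Omega>"
  proof
    assume "x \<in> \<Omega>"
    then have "x \<in> \<Omega> \<inter> ball x r" using r(1) by simp
    then show False unfolding r(2) by simp
  qed
  moreover have "x \<in> closure \<Omega>"
    unfolding closure_approachable
  proof (intro allI impI)
    fix e :: real assume "0 < e"
    define d where "d = min e r / 2"
    have d: "0 < d" "d < e" "d < r" using \<open>0 < e\<close> r(1) by (auto simp: d_def min_def)
    have "((x - d *\<^sub>R \<nu>) - x) \<bullet> \<nu> < 0" using d n by (simp add: norm_eq_1)
    moreover have "x - d *\<^sub>R \<nu> \<in> ball x r" using d n by (simp add: dist_norm)
    ultimately have "x - d *\<^sub>R \<nu> \<in> \<Omega> \<inter> ball x r" unfolding r(2) by simp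
    then have "x - d *\<^sub>R \<nu> \<in> \<Omega>" by simp
    moreover have "dist (x - d *\<^sub>R \<nu>) x < e" using d n by (simp add: dist_norm)
    ultimately show "\<exists>y\<in>\<Omega>. dist y x < e" by blast
  qed
  ultimately show ?thesis using assms(2) by (simp add: frontier_def interior_open)
qed

text \<open>The description defining \<open>normal_flux\<close> is unique because the boundary value and the outward normal are.\<close>

lemma normal_flux_eq:
  assumes "open \<Omega>" "boundary_value \<Omega> \<beta> x b" "outward_normal \<Omega> x \<nu>"
  shows "normal_flux \<Omega> \<beta> x = b \<bullet> \<nu>"
proof -
  have cl: "x \<in> closure \<Omega>" using outward_normal_frontier[OF assms(3,1)] by (simp add: frontier_def)
  have "(THE c. \<exists>b \<nu>. boundary_value \<Omega> \<beta> x b \<and> outward_normal \<Omega> x \<nu> \<and> c = b \<bullet> \<nu>) = b \<bullet> \<nu>"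
  proof (rule the_equality)
    show "\<exists>b' \<nu>'. boundary_value \<Omega> \<beta> x b' \<and> outward_normal \<Omega> x \<nu>' \<and> b \<bullet> \<nu> = b' \<bullet> \<nu>'"
      using assms by blast
    fix c assume "\<exists>b \<nu>. boundary_value \<Omega> \<beta> x b \<and> outward_normal \<Omega> x \<nu> \<and> c = b \<bullet> \<nu>"
    then show "c = b \<bullet> \<nu>"
      using boundary_value_unique[OF assms(1) cl _ assms(2)] outward_normal_unique[OF _ assms(3)] by blast
  qed
  then show ?thesis using assms unfolding normal_flux_def by auto
qed

lemma normal_flux_nonzeroE:
  assumes "normal_flux \<Omega> \<beta> x \<noteq> 0"
  obtains b \<nu> where "boundary_value \<Omega> \<beta> x b" "outward_normal \<Omega> x \<nu>"
  using assms unfolding normal_flux_def by (auto split: if_splits)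

text \<open>Near a point where the boundary is flat and the field is constant, all boundary points lie on the same
  line and see the same half disc and the same field.\<close>

lemma normal_flux_locally_constant:
  assumes op: "open \<Omega>" and b: "boundary_value \<Omega> \<beta> x b" and n: "outward_normal \<Omega> x \<nu>"
  obtains r where "0 < r" "\<And>y. y \<in> frontier \<Omega> \<Longrightarrow> y \<in> ball x r \<Longrightarrow> normal_flux \<Omega> \<beta> y = normal_flux \<Omega> \<beta> x"
proof -
  obtain r1 where r1: "0 < r1" "AE y in lebesgue_on (\<Omega> \<inter> ball x r1). \<beta> y = b"
    using b by (auto simp: boundary_value_def)
  obtain r2 where r2: "0 < r2" "\<Omega> \<inter> ball x r2 = {y \<in> ball x r2. (y - x) \<bullet> \<nu> < 0}" and n1: "norm \<nu> = 1"
    using n by (auto simp: outward_normal_def)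
  have s: "\<Omega> \<inter> ball z e \<in> sets lebesgue" for z e using op by (auto intro: borel_open)
  show thesis
  proof (rule that[of "min r1 r2"])
    fix y assume y: "y \<in> frontier \<Omega>" "y \<in> ball x (min r1 r2)"
    define e where "e = min r1 r2 - dist x y"
    have e: "0 < e" using y by (simp add: e_def)
    have sub: "ball y e \<subseteq> ball x r1" "ball y e \<subseteq> ball x r2"
    proof -
      have "dist x z < min r1 r2" if "z \<in> ball y e" for z
      proof -
        have "dist x z \<le> dist x y + dist y z" "dist y z < min r1 r2 - dist x y"
          using dist_triangle[of x z y] that by (simp_all add: e_def)
        then show ?thesis by linarith
      qed
      then show "ball y e \<subseteq> ball x r1" "ball y e \<subseteq> ball x r2" by auto
    qed
    have y0: "(y - x) \<bullet> \<nu> = 0"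
    proof (rule ccontr)
      assume ne: "(y - x) \<bullet> \<nu> \<noteq> 0"
      have "y \<notin> \<Omega>" using y(1) op by (simp add: frontier_def interior_open)
      have "y \<in> ball x r2" using y(2) by simp
      have "\<not> (y - x) \<bullet> \<nu> < 0"
      proof
        assume "(y - x) \<bullet> \<nu> < 0"
        then have "y \<in> \<Omega> \<inter> ball x r2" unfolding r2(2) using \<open>y \<in> ball x r2\<close> by simp
        then show False using \<open>y \<notin> \<Omega>\<close> by simp
      qed
      then have pos: "(y - x) \<bullet> \<nu> > 0" using ne by simp
      let ?H = "{z. (z - x) \<bullet> \<nu> > 0} \<inter> ball x r2"
      have "open ?H" by (intro open_Int open_Collect_less continuous_intros open_ball)
      moreover have "y \<in> ?H" using pos y(2) by simp
      moreover have "y \<in> closure \<Omega>" using y(1) by (simp add: frontier_def)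
      ultimately have "?H \<inter> \<Omega> \<noteq> {}" using open_Int_closure_eq_empty[of ?H \<Omega>] by (metis (no_types) IntI empty_iff)
      then obtain z where "z \<in> ?H \<inter> \<Omega>" unfolding ex_in_conv[symmetric] by (rule exE)
      then have z: "(z - x) \<bullet> \<nu> > 0" "z \<in> \<Omega> \<inter> ball x r2" by simp_all
      then show False unfolding r2(2) by simp
    qed
    have "AE z in lebesgue_on (\<Omega> \<inter> ball y e). \<beta> z = b"
      using r1(2) unfolding AE_lebesgue_on_iff[OF s] by eventually_elim (use sub(1) in blast)
    then have "boundary_value \<Omega> \<beta> y b" using e by (auto simp: boundary_value_def)
    moreover have "(z - y) \<bullet> \<nu> = (z - x) \<bullet> \<nu>" for z using y0 by (simp add: inner_diff_left)
    then have "\<Omega> \<inter> ball y e = {z \<in> ball y e. (z - y) \<bullet> \<nu> < 0}"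
    proof -
      have "z \<in> \<Omega> \<longleftrightarrow> (z - x) \<bullet> \<nu> < 0" if "z \<in> ball y e" for z
      proof -
        have z: "z \<in> ball x r2" using sub(2) that by blast
        then have "z \<in> \<Omega> \<longleftrightarrow> z \<in> \<Omega> \<inter> ball x r2" by blast
        also have "\<dots> \<longleftrightarrow> (z - x) \<bullet> \<nu> < 0" unfolding r2(2) using z by blast
        finally show ?thesis .
      qed
      then show ?thesis using \<open>\<And>z. (z - y) \<bullet> \<nu> = (z - x) \<bullet> \<nu>\<close> by auto
    qed
    then have "outward_normal \<Omega> y \<nu>" using e n1 by (auto simp: outward_normal_def)
    ultimately show "normal_flux \<Omega> \<beta> y = normal_flux \<Omega> \<beta> x"
      using normal_flux_eq[OF op b n] normal_flux_eq[OF op, of \<beta> y b \<nu>] by simp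
  qed (use r1 r2 in auto)
qed

lemma normal_flux_pred_sets:
  assumes op: "open \<Omega>" and "\<not> p 0"
  shows "{x. p (normal_flux \<Omega> \<beta> x)} \<in> sets borel"
proof -
  let ?S = "{x. p (normal_flux \<Omega> \<beta> x)}"
  have ex: "\<exists>r>0. frontier \<Omega> \<inter> ball x r \<subseteq> ?S" and fr: "x \<in> frontier \<Omega>" if "x \<in> ?S" for x
  proof -
    have "normal_flux \<Omega> \<beta> x \<noteq> 0" using that assms(2) by auto
    then obtain b \<nu> where bn: "boundary_value \<Omega> \<beta> x b" "outward_normal \<Omega> x \<nu>"
      by (rule normal_flux_nonzeroE)
    obtain r where "0 < r" "\<And>y. y \<in> frontier \<Omega> \<Longrightarrow> y \<in> ball x r \<Longrightarrow> normal_flux \<Omega> \<beta> y = normal_flux \<Omega> \<beta> x"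
      using normal_flux_locally_constant[OF op bn] by blast
    then show "\<exists>r>0. frontier \<Omega> \<inter> ball x r \<subseteq> ?S" using that by (intro exI[of _ r]) auto
    show "x \<in> frontier \<Omega>" using outward_normal_frontier[OF bn(2) op] .
  qed
  then obtain r where "\<forall>x\<in>?S. 0 < r x \<and> frontier \<Omega> \<inter> ball x (r x) \<subseteq> ?S"
    using bchoice[of ?S "\<lambda>x r. 0 < r \<and> frontier \<Omega> \<inter> ball x r \<subseteq> ?S"] by blast
  then have r: "\<And>x. x \<in> ?S \<Longrightarrow> 0 < r x" "\<And>x. x \<in> ?S \<Longrightarrow> frontier \<Omega> \<inter> ball x (r x) \<subseteq> ?S"
    by blast+
  have "?S = frontier \<Omega> \<inter> (\<Union>x\<in>?S. ball x (r x))"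
  proof (intro equalityI subsetI)
    fix x assume "x \<in> ?S"
    then show "x \<in> frontier \<Omega> \<inter> (\<Union>x\<in>?S. ball x (r x))" using fr[of x] r(1)[of x] by auto
  qed (use r(2) in blast)
  moreover have "frontier \<Omega> \<inter> (\<Union>x\<in>?S. ball x (r x)) \<in> sets borel"
    by (intro sets.Int borel_closed frontier_closed borel_open open_UN) auto
  ultimately show ?thesis by simp
qed

text \<open>Local constancy makes the set of boundary points with a given nonzero flux relatively open in the boundary.
  Measurability is what gives the density defining \<open>flux_measure\<close> its usual meaning.\<close>

lemma normal_flux_measurable:
  assumes "open \<Omega>"
  shows "normal_flux \<Omega> \<beta> \<in> borel_measurable borel"
proof (rule borel_measurableI_greater)
  fix a
  show "{x \<in> space borel. a < normal_flux \<Omega> \<beta> x} \<in> sets borel"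
  proof (cases "a \<ge> 0")
    case True
    then show ?thesis using normal_flux_pred_sets[OF assms, of "\<lambda>c. a < c"] by simp
  next
    case False
    then have "{x. normal_flux \<Omega> \<beta> x \<le> a} \<in> sets borel"
      using normal_flux_pred_sets[OF assms, of "\<lambda>c. c \<le> a"] by simp
    then have "- {x. normal_flux \<Omega> \<beta> x \<le> a} \<in> sets borel" by (metis borel_comp)
    moreover have "- {x. normal_flux \<Omega> \<beta> x \<le> a} = {x \<in> space borel. a < normal_flux \<Omega> \<beta> x}" by auto
    ultimately show ?thesis by simp
  qed
qed

text \<open>A Lipschitz domain lies locally on one side of its boundary, so it has no slits. Consequently open sets covered
  by triangles of the mesh lie in the domain.\<close>

lemma lipschitz_interior_closure:
  assumes op: "open \<Omega>" and lip: "lipschitz_boundary \<Omega>"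
  shows "interior (closure \<Omega>) = \<Omega>"
proof
  show "\<Omega> \<subseteq> interior (closure \<Omega>)" using op by (intro interior_maximal closure_subset)
  show "interior (closure \<Omega>) \<subseteq> \<Omega>"
  proof (rule ccontr)
    assume "\<not> ?thesis"
    then obtain x where x: "x \<in> interior (closure \<Omega>)" "x \<notin> \<Omega>" by blast
    then have "x \<in> frontier \<Omega>" using op interior_subset by (auto simp: frontier_def interior_open)
    then obtain r and R :: "real^2 \<Rightarrow> real^2" and g L where r: "0 < r" and R: "orthogonal_transformation R"
      and g: "L-lipschitz_on UNIV g"
      and eq: "\<Omega> \<inter> ball x r = {y \<in> ball x r. R y $ 2 > g (R y $ 1)}"
      using lip unfolding lipschitz_boundary_def by blast
    have lin: "linear R" using R by (simp add: orthogonal_transformation_def)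
    have cR: "continuous_on UNIV R" using lin by (simp add: linear_continuous_on linear_conv_bounded_linear)
    have cg: "continuous_on UNIV g" using g by (rule lipschitz_on_continuous_on)
    have xg: "R x $ 2 \<le> g (R x $ 1)"
    proof (rule ccontr)
      assume "\<not> ?thesis"
      then have "x \<in> \<Omega> \<inter> ball x r" unfolding eq using r by simp
      then show False using x(2) by simp
    qed
    \<comment> \<open>Moving from \<open>x\<close> against the axis of the epigraph leaves the closure of \<open>\<Omega>\<close>.\<close>
    obtain v where v: "R v = axis 2 1"
      using orthogonal_transformation_surj[OF R] by (metis surjD)
    have "x \<in> interior (closure \<Omega> \<inter> ball x r)" using x(1) r by (simp add: interior_Int interior_open)
    then obtain c where c: "0 < c" "x + c *\<^sub>R (- v) \<in> closure \<Omega> \<inter> ball x r"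
      by (rule mem_interiorD_shift)
    let ?y = "x + c *\<^sub>R (- v)"
    have "R ?y = R x - c *\<^sub>R axis 2 1"
      using v lin by (simp add: linear_diff linear_scale)
    then have Ry: "R ?y $ 1 = R x $ 1" "R ?y $ 2 = R x $ 2 - c" by (simp_all add: axis_def)
    let ?H = "{y. R y $ 2 < g (R y $ 1)} \<inter> ball x r"
    have "open ?H"
      by (intro open_Int open_Collect_less open_ball continuous_intros cR continuous_on_compose2[OF cg]) auto
    moreover have "?y \<in> ?H" using c Ry xg by simp
    moreover have "?y \<in> closure \<Omega>" using c by blast
    ultimately have "?H \<inter> \<Omega> \<noteq> {}" using open_Int_closure_eq_empty[of ?H \<Omega>] by (metis (no_types) IntI empty_iff)
    then obtain z where "z \<in> ?H \<inter> \<Omega>" unfolding ex_in_conv[symmetric] by (rule exE)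
    then have z: "R z $ 2 < g (R z $ 1)" "z \<in> \<Omega> \<inter> ball x r" by simp_all
    then show False unfolding eq by simp
  qed
qed

lemma const_on_unique:
  assumes "const_on T f c" "const_on T f c'" "T \<in> sets lebesgue" "open U" "U \<noteq> {}" "U \<subseteq> T"
  shows "c = c'"
proof -
  have "AE x in lborel. x \<in> T \<longrightarrow> c = c'"
    using assms(1,2) unfolding const_on_def AE_lebesgue_on_iff[OF assms(3)] by eventually_elim auto
  from AE_lborel_ex_open[OF this assms(4,5)] show ?thesis using assms(6) by blast
qed

lemma closed_cell_sets: 
  assumes "cross2 u b \<noteq> 0" "0 < \<tau>"
  shows "closed (closed_cell P u b \<tau>)" "convex (closed_cell P u b \<tau>)" "compact (closed_cell P u b \<tau>)"
    "closed_cell P u b \<tau> \<in> sets lebesgue"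
proof -
  show "compact (closed_cell P u b \<tau>)" "convex (closed_cell P u b \<tau>)"
    unfolding convex_hull_closed_cell[OF assms, symmetric]
    by (intro compact_convex_hull finite_imp_compact convex_convex_hull; simp)+
  then show "closed (closed_cell P u b \<tau>)" by (simp add: compact_imp_closed)
  then show "closed_cell P u b \<tau> \<in> sets lebesgue" by (simp add: lebesgue_closedin borel_closed)
qed

lemma cell_value_eq:
  assumes "cross2 u e \<noteq> 0" "0 < \<tau>" "const_on (closed_cell P u e \<tau>) \<beta> b"
  shows "cell_value \<beta> (closed_cell P u e \<tau>) = b"
  unfolding cell_value_def
proof (rule the_equality[where P = "const_on (closed_cell P u e \<tau>) \<beta>", OF assms(3)])
  fix b' assume "const_on (closed_cell P u e \<tau>) \<beta> b'"
  then show "b' = b"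
    using assms(3) closed_cell_sets(4)[OF assms(1,2)] open_cell cell_nonempty[OF assms(1,2)]
      cell_subset_closed_cell by (rule const_on_unique)
qed

section \<open>Triangles with one tangential edge\<close>

lemma triangle_closed_cell:
  assumes "cross2 (B - A) (C - A) \<noteq> 0"
  shows "cross2 (B - A) (B - C) \<noteq> 0" "convex hull {A, B, C} = closed_cell A (B - A) (B - C) 1"
proof -
  have "cross2 (B - A) (B - C) = - cross2 (B - A) (C - A)"
    by (simp add: cross2_def algebra_simps)
  then show J: "cross2 (B - A) (B - C) \<noteq> 0" using assms by simp
  show "convex hull {A, B, C} = closed_cell A (B - A) (B - C) 1"
    using convex_hull_closed_cell[OF J zero_less_one, of A] by simp
qed

lemma triangle_independent:
  assumes "cross2 (B - A) (C - A) \<noteq> 0"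
  shows "\<not> affine_dependent {A, B, C}" "A \<noteq> B" "A \<noteq> C" "B \<noteq> C"
proof -
  show ne: "A \<noteq> B" "A \<noteq> C" "B \<noteq> C" using assms by auto
  have "\<not> collinear {A, B, C}"
  proof
    assume "collinear {A, B, C}"
    then obtain u where u: "\<forall>x\<in>{A, B, C}. \<forall>y\<in>{A, B, C}. \<exists>c. x - y = c *\<^sub>R u"
      unfolding collinear_def by blast
    then obtain c d where "B - A = c *\<^sub>R u" "C - A = d *\<^sub>R u" by blast
    then show False using assms by simp
  qed
  then show "\<not> affine_dependent {A, B, C}" using collinear_3_eq_affine_dependent by blast
qed

text \<open>Affine independence of three points in the plane is nonvanishing of the signed area.\<close>

lemma simplex_2_triangle:
  assumes "2 simplex T"
  obtains A B C :: "real^2" where "T = convex hull {A, B, C}" "cross2 (B - A) (C - A) \<noteq> 0"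
proof -
  obtain S where S: "\<not> affine_dependent S" "int (card S) = 2 + 1" "T = convex hull S"
    using assms unfolding simplex_def by blast
  then have "card S = 3" by simp
  then obtain A B C where ABC: "S = {A, B, C}" "A \<noteq> B" "A \<noteq> C" "B \<noteq> C"
    by (auto simp: card_3_iff)
  have "cross2 (B - A) (C - A) \<noteq> 0"
  proof
    assume "cross2 (B - A) (C - A) = 0"
    then obtain k where k: "C - A = k *\<^sub>R (B - A)" using cross2_eq_0D[of "B - A" "C - A"] ABC by auto
    have "collinear {A, B, C}"
      unfolding collinear_def
    proof (rule exI[of _ "B - A"], intro ballI)
      have AB: "A = A + 0 *\<^sub>R (B - A)" "B = A + 1 *\<^sub>R (B - A)" "C = A + k *\<^sub>R (B - A)" using k by (simp_all add: algebra_simps)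
      fix x y assume "x \<in> {A, B, C}" "y \<in> {A, B, C}"
      then obtain c d where xy: "x = A + c *\<^sub>R (B - A)" "y = A + d *\<^sub>R (B - A)" using AB by blast
      have "x - y = (c - d) *\<^sub>R (B - A)" unfolding xy scaleR_left_diff_distrib by simp
      then show "\<exists>c. x - y = c *\<^sub>R (B - A)" by blast
    qed
    then show False using S(1) ABC collinear_3_eq_affine_dependent by blast
  qed
  then show thesis using that S(3) ABC(1) by blast
qed

lemma cross2_rotate: "cross2 (C - B) (A - B) = cross2 (B - A) (C - A)"
  by (simp add: cross2_def algebra_simps)

lemma cross2_shear:
  "cross2 (Y - Z) (Y - X) = cross2 (Y - X) (Z - X)" "cross2 (X - Z) (Y - X) = cross2 (Y - X) (Z - X)"
  by (simp_all add: cross2_def algebra_simps)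

lemma edge_of_triangleD:
  assumes nd: "cross2 (B - A) (C - A) \<noteq> 0" and F: "F edge_of (convex hull {A, B, C})"
  obtains X Y Z where "{X, Y, Z} = {A, B, C}" "F = closed_segment X Y" "cross2 (Y - X) (Z - X) \<noteq> 0"
proof -
  have F': "F face_of (convex hull {A, B, C})" "aff_dim F = 1" using F by (auto simp: edge_of_def)
  then obtain c where c: "c \<subseteq> {A, B, C}" "F = convex hull c"
    using face_of_convex_hull_affine_independent[OF triangle_independent(1)[OF nd]] by blast
  have "\<not> affine_dependent c" using c(1) triangle_independent(1)[OF nd] affine_independent_subset by blast
  then have "aff_dim c = int (card c) - 1" using aff_dim_affine_independent[of c] by simp
  then have card: "card c = 2" using F'(2) c(2) by (simp add: aff_dim_convex_hull)
  note ne = triangle_independent(2-4)[OF nd]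
  have "c = {A, B} \<or> c = {B, C} \<or> c = {C, A}"
  proof -
    obtain x y where "c = {x, y}" "x \<noteq> y" using card by (meson card_2_iff)
    then show ?thesis using c(1) by (auto simp: insert_commute)
  qed
  moreover have "cross2 (C - B) (A - B) \<noteq> 0" "cross2 (A - C) (B - C) \<noteq> 0"
    using nd cross2_rotate[of C B A] cross2_rotate[of A C B] by auto
  moreover have "{B, C, A} = {A, B, C}" "{C, A, B} = {A, B, C}" by auto
  ultimately show thesis
    using that[of A B C] that[of B C A] that[of C A B] c(2) nd by (auto simp: segment_convex_hull)
qed

lemma triangle_edge:
  assumes nd: "cross2 (B - A) (C - A) \<noteq> 0"
  shows "closed_segment A B edge_of (convex hull {A, B, C})"
proof -
  have "closed_segment A B face_of (convex hull {A, B, C})"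
    using face_of_convex_hull_affine_independent[OF triangle_independent(1)[OF nd]]
    by (auto simp: segment_convex_hull intro!: exI[of _ "{A, B}"])
  moreover have "aff_dim (closed_segment A B) = 1"
    using triangle_independent(2)[OF nd] by (simp add: segment_convex_hull aff_dim_convex_hull aff_dim_2)
  ultimately show ?thesis by (simp add: edge_of_def)
qed

lemma outward_normal_triangle:
  assumes nd: "cross2 (Y - X) (Z - X) \<noteq> 0" and s: "0 < s" "s < 1"
  shows "outward_normal (interior (convex hull {X, Y, Z})) (X + s *\<^sub>R (Y - X)) (exit_normal (Y - X) (Y - Z))"
  using outward_normal_cell[OF triangle_closed_cell(1)[OF nd] zero_less_one s]
    interior_closed_cell[OF triangle_closed_cell(1)[OF nd] zero_less_one]
  by (simp add: triangle_closed_cell(2)[OF nd])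

text \<open>The outward normal at the midpoint of the edge exists and is orthogonal to the edge.\<close>

lemma tangential_face_cross2:
  assumes nd: "cross2 (Y - X) (Z - X) \<noteq> 0"
    and tf: "tangential_face \<beta> (convex hull {X, Y, Z}) (closed_segment X Y)"
  shows "cross2 (Y - X) (cell_value \<beta> (convex hull {X, Y, Z})) = 0"
proof -
  let ?b = "cell_value \<beta> (convex hull {X, Y, Z})"
  have ne: "X \<noteq> Y" using triangle_independent[OF nd] by blast
  have "X + (1/2) *\<^sub>R (Y - X) \<in> open_segment X Y"
    using ne by (auto simp: in_segment algebra_simps intro!: exI[of _ "1/2"])
  then have "X + (1/2) *\<^sub>R (Y - X) \<in> rel_interior (closed_segment X Y)"
    using ne by (simp add: rel_interior_closed_segment)
  then have "?b \<bullet> exit_normal (Y - X) (Y - Z) = 0"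
    using tf outward_normal_triangle[OF nd, of "1/2"] unfolding tangential_face_def by auto
  then show ?thesis
    unfolding exit_normal(2)[OF triangle_closed_cell(1)[OF nd]]
    using triangle_closed_cell(1)[OF nd] ne by (auto simp: sgn_0_0)
qed

lemma tangential_face_zero:
  assumes "cross2 (Y - X) (Z - X) \<noteq> 0" "cell_value \<beta> (convex hull {X, Y, Z}) = 0"
  shows "tangential_face \<beta> (convex hull {X, Y, Z}) (closed_segment X Y)"
  using triangle_edge[OF assms(1)] assms(2) by (simp add: tangential_face_def)

text \<open>\<open>T\<close> is placed in coordinates along its own field \<open>b\<close>, with exit edge from \<open>P\<close> to \<open>P + u\<close> and tangential edge
  from \<open>P + u\<close> to \<open>P + u - \<tau> b\<close>.\<close>

definition flow_frame :: "(real^2 \<Rightarrow> real^2) \<Rightarrow> (real^2) set \<Rightarrow> real^2 \<Rightarrow> real^2 \<Rightarrow> real^2 \<Rightarrow> real \<Rightarrow> bool" where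
  "flow_frame \<beta> T P u b \<tau> \<longleftrightarrow> cross2 u b \<noteq> 0 \<and> 0 < \<tau> \<and> T = closed_cell P u b \<tau> \<and> const_on T \<beta> b"

text \<open>The field is parallel to the tangential edge, whose endpoints are ordered so that the field points from the
  third vertex \<open>P + u - \<tau> b\<close> to \<open>P + u\<close>; the remaining vertex is \<open>P\<close>.\<close>

lemma flow_frame_exists:
  assumes "2 simplex T" and c: "const_on T \<beta> b" and tf: "\<exists>!F. tangential_face \<beta> T F"
  shows "\<exists>P u \<tau>. flow_frame \<beta> T P u b \<tau>"
proof -
  obtain A B C where T: "T = convex hull {A, B, C}" and nd: "cross2 (B - A) (C - A) \<noteq> 0"
    using simplex_2_triangle[OF assms(1)] .
  have cv: "cell_value \<beta> T = b"
    using cell_value_eq[OF triangle_closed_cell(1)[OF nd] zero_less_one] c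
    by (simp add: T triangle_closed_cell(2)[OF nd])
  \<comment> \<open>If the field vanished, all edges would be tangential.\<close>
  have b0: "b \<noteq> 0"
  proof
    assume "b = 0"
    have nd': "cross2 (C - B) (A - B) \<noteq> 0" using nd by (simp add: cross2_rotate)
    have perm: "convex hull {B, C, A} = T" by (simp add: T insert_commute)
    have "tangential_face \<beta> T (closed_segment A B)" "tangential_face \<beta> T (closed_segment B C)"
      using tangential_face_zero[OF nd, of \<beta>] tangential_face_zero[OF nd', of \<beta>] cv perm T \<open>b = 0\<close> by auto
    then have "closed_segment A B = closed_segment B C" using tf by blast
    then have "{A, B} = {B, C}" by simp
    then show False using triangle_independent[OF nd] by (auto simp: doubleton_eq_iff)
  qed
  obtain F where F: "tangential_face \<beta> T F" using tf by blast
  then have "F edge_of (convex hull {A, B, C})" by (simp add: T tangential_face_def)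
  then obtain X Y Z where XYZ: "{X, Y, Z} = {A, B, C}" "F = closed_segment X Y" and nd2: "cross2 (Y - X) (Z - X) \<noteq> 0"
    by (rule edge_of_triangleD[OF nd])
  have T2: "T = convex hull {X, Y, Z}" using XYZ(1) T by simp
  have "cross2 (Y - X) b = 0" using tangential_face_cross2[OF nd2, of \<beta>] F XYZ(2) T2 cv by simp
  moreover have XY: "Y - X \<noteq> 0" using nd2 by auto
  ultimately obtain k where k: "b = k *\<^sub>R (Y - X)" by (rule cross2_eq_0D)
  then have k0: "k \<noteq> 0" using b0 by auto
  have frame: "flow_frame \<beta> T Z (Q - Z) b \<tau>"
    if "0 < \<tau>" "R = Q - \<tau> *\<^sub>R b" "{Q, R} = {X, Y}" "cross2 (Q - Z) b \<noteq> 0" for Q R \<tau>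
  proof -
    have "closed_cell Z (Q - Z) b \<tau> = convex hull {Z, Q, R}"
      using convex_hull_closed_cell[OF that(4,1), of Z] that(2) by simp
    also have "{Z, Q, R} = {X, Y, Z}" using that(3) by blast
    finally show ?thesis using that T2 c by (simp add: flow_frame_def)
  qed
  show ?thesis
  proof (cases "k > 0")
    case True
    have "flow_frame \<beta> T Z (Y - Z) b (1 / k)"
    proof (rule frame[of _ X])
      show "cross2 (Y - Z) b \<noteq> 0" using nd2 k0 cross2_shear(1)[of Y Z X] unfolding k by simp
    qed (use True in \<open>auto simp: k\<close>)
    then show ?thesis by blast
  next
    case False
    have "flow_frame \<beta> T Z (X - Z) b (- 1 / k)"
    proof (rule frame[of _ Y])
      show "cross2 (X - Z) b \<noteq> 0" using nd2 k0 cross2_shear(2)[of X Z Y] unfolding k by simp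
    qed (use False k0 in \<open>auto simp: k\<close>)
    then show ?thesis by blast
  qed
qed

lemma tcoord_0_edge:
  assumes "cross2 u b \<noteq> 0" "tcoord P u b x = 0"
  shows "x = P + scoord P u b x *\<^sub>R u"
  using frame_coords[OF assms(1), of P x] assms(2) by (simp add: frame_pt_def)

lemma edge_param: "x \<in> closed_segment P (P + u) \<longleftrightarrow> (\<exists>s. 0 \<le> s \<and> s \<le> 1 \<and> x = P + s *\<^sub>R u)"
  by (auto simp: in_segment algebra_simps)

lemma triangle_pair:
  assumes "c \<subseteq> {A, B, C}" "\<not> {A, B, C} \<subseteq> c"
  shows "c \<subseteq> {A, B} \<or> c \<subseteq> {B, C} \<or> c \<subseteq> {A, C}"
  using assms by blast

lemma closed_cell_triangle_nd:
  assumes "cross2 u b \<noteq> 0" "0 < \<tau>"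
  shows "cross2 ((P + u) - P) ((P + u - \<tau> *\<^sub>R b) - P) \<noteq> 0"
  using assms by (simp add: cross2_diff algebra_simps)

text \<open>A face of a triangle is spanned by some of its vertices, so a proper face with two points is an edge.\<close>

lemma proper_face_of_cell:
  assumes J: "cross2 u b \<noteq> 0" and \<tau>: "0 < \<tau>"
    and E: "E face_of closed_cell P u b \<tau>" "E \<noteq> closed_cell P u b \<tau>" and AB: "A \<in> E" "B \<in> E" "A \<noteq> B"
  obtains X Y where "E = closed_segment X Y"
    "X = P \<and> Y = P + u \<or> X = P + u \<and> Y = P + u - \<tau> *\<^sub>R b \<or> X = P \<and> Y = P + u - \<tau> *\<^sub>R b"
proof -
  let ?V = "{P, P + u, P + u - \<tau> *\<^sub>R b}"
  have hull: "closed_cell P u b \<tau> = convex hull ?V" using convex_hull_closed_cell[OF J \<tau>] by simp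
  have ind: "\<not> affine_dependent ?V" by (rule triangle_independent(1)[OF closed_cell_triangle_nd[OF J \<tau>]])
  obtain c where c: "c \<subseteq> ?V" "E = convex hull c"
    using E(1) face_of_convex_hull_affine_independent[OF ind] unfolding hull by blast
  have "\<not> ?V \<subseteq> c" using E(2) c unfolding hull by (metis subset_antisym)
  from triangle_pair[OF c(1) this] obtain X Y where XY: "c \<subseteq> {X, Y}"
    "X = P \<and> Y = P + u \<or> X = P + u \<and> Y = P + u - \<tau> *\<^sub>R b \<or> X = P \<and> Y = P + u - \<tau> *\<^sub>R b" by blast
  have "c = {X, Y}"
  proof (rule ccontr)
    assume "c \<noteq> {X, Y}"
    then have "c = {} \<or> c = {X} \<or> c = {Y}" using XY(1) by blast
    then show False using AB c(2) by auto
  qed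
  then show thesis using that XY(2) c(2) by (simp add: segment_convex_hull)
qed

lemma unit_normal_exit:
  assumes J: "cross2 u b \<noteq> 0" and F: "F \<subseteq> closed_segment P (P + u)"
  shows "unit_normal F (exit_normal u b)"
proof -
  have "(x - y) \<bullet> exit_normal u b = 0" if "x \<in> F" "y \<in> F" for x y
  proof -
    have "x \<in> closed_segment P (P + u)" "y \<in> closed_segment P (P + u)" using that F by auto
    then obtain s t where "x = P + s *\<^sub>R u" "y = P + t *\<^sub>R u" unfolding edge_param by metis
    then have "x - y = (s - t) *\<^sub>R u" by (simp add: algebra_simps)
    then show ?thesis unfolding exit_normal(2)[OF J] by simp
  qed
  then show ?thesis using exit_normal(1)[OF J] by (auto simp: unit_normal_def)
qed

text \<open>The triangle seen against the flow: with \<open>- b\<close> as direction, the entry edge from \<open>P\<close> to \<open>P + u - \<tau> b\<close> takes the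
  role of the exit edge, with the same \<open>s\<close> and with \<open>t\<close> counted from the entry edge.\<close>

lemma entry_coords:
  assumes J: "cross2 u b \<noteq> 0"
  shows "cross2 (u - \<tau> *\<^sub>R b) (- b) \<noteq> 0"
    "scoord P (u - \<tau> *\<^sub>R b) (- b) x = scoord P u b x"
    "tcoord P (u - \<tau> *\<^sub>R b) (- b) x = - (tcoord P u b x + \<tau> * scoord P u b x)"
proof -
  have *: "cross2 (u - \<tau> *\<^sub>R b) (- b) = - cross2 u b" by (simp add: cross2_diff)
  show "cross2 (u - \<tau> *\<^sub>R b) (- b) \<noteq> 0" unfolding * using J by simp
  show "scoord P (u - \<tau> *\<^sub>R b) (- b) x = scoord P u b x"
    unfolding scoord_def * by simp
  have "cross2 (u - \<tau> *\<^sub>R b) (x - P) = cross2 u (x - P) + \<tau> * cross2 (x - P) b"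
    using cross2_diff(1)[of u "\<tau> *\<^sub>R b" "x - P"] cross2_commute[of b "x - P"] by (simp only: cross2_simps)
  then show "tcoord P (u - \<tau> *\<^sub>R b) (- b) x = - (tcoord P u b x + \<tau> * scoord P u b x)"
    unfolding tcoord_def scoord_def * by (simp add: add_divide_distrib)
qed

lemma entry_cell:
  assumes J: "cross2 u b \<noteq> 0"
  shows "closed_cell P (u - \<tau> *\<^sub>R b) (- b) \<tau> = closed_cell P u b \<tau>"
    "cell P (u - \<tau> *\<^sub>R b) (- b) \<tau> = cell P u b \<tau>"
  unfolding closed_cell_def cell_def entry_coords[OF J] by auto

lemma reversed_coords:
  assumes "cross2 u b \<noteq> 0"
  shows "scoord (P + u) (- u) b x = 1 - scoord P u b x"
    "tcoord (P + u) (- u) b x = tcoord P u b x"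
  using assms by (simp_all add: scoord_def tcoord_def diff_diff_eq[symmetric] cross2_diff cross2_add diff_divide_distrib)

section \<open>Successors of a triangle along the flow\<close>

text \<open>A mesh together with a choice of flow coordinates on each of its triangles.\<close>

locale flow_mesh =
  fixes \<Omega> :: "(real^2) set" and \<T> :: "(real^2) set set" and \<beta> :: "real^2 \<Rightarrow> real^2"
    and P u b :: "(real^2) set \<Rightarrow> real^2" and \<tau> :: "(real^2) set \<Rightarrow> real"
  assumes open_domain: "open \<Omega>" and interior_closure_domain: "interior (closure \<Omega>) = \<Omega>"
    and mesh: "simplicial_mesh \<Omega> \<T>"
    and frame: "\<And>T. T \<in> \<T> \<Longrightarrow> flow_frame \<beta> T (P T) (u T) (b T) (\<tau> T)"
    and jump: "normal_jump_free \<T> \<beta>"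
begin

lemma frameD:
  assumes "T \<in> \<T>"
  shows "cross2 (u T) (b T) \<noteq> 0" "0 < \<tau> T" "T = closed_cell (P T) (u T) (b T) (\<tau> T)" "const_on T \<beta> (b T)"
  using frame[OF assms] by (auto simp: flow_frame_def)

lemma finite_mesh: "finite \<T>" and mesh_cover: "\<Union>\<T> = closure \<Omega>"
  and mesh_face: "T\<^sub>1 \<in> \<T> \<Longrightarrow> T\<^sub>2 \<in> \<T> \<Longrightarrow> (T\<^sub>1 \<inter> T\<^sub>2) face_of T\<^sub>1 \<and> (T\<^sub>1 \<inter> T\<^sub>2) face_of T\<^sub>2"
  using mesh by (auto simp: simplicial_mesh_def)

abbreviation cell_of :: "(real^2) set \<Rightarrow> (real^2) set" where
  "cell_of T \<equiv> cell (P T) (u T) (b T) (\<tau> T)"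

abbreviation s_of :: "(real^2) set \<Rightarrow> real^2 \<Rightarrow> real" where
  "s_of T \<equiv> scoord (P T) (u T) (b T)"

abbreviation t_of :: "(real^2) set \<Rightarrow> real^2 \<Rightarrow> real" where
  "t_of T \<equiv> tcoord (P T) (u T) (b T)"

lemma cell_of_interior: "T \<in> \<T> \<Longrightarrow> interior T = cell_of T"
  using interior_closed_cell frameD by metis

lemma cell_of_subset: "T \<in> \<T> \<Longrightarrow> cell_of T \<subseteq> T"
  using cell_of_interior interior_subset by metis

lemma cell_of_domain: "T \<in> \<T> \<Longrightarrow> cell_of T \<subseteq> \<Omega>"
  using cell_of_interior mesh_cover interior_closure_domain interior_mono by (metis Union_upper)

lemma mesh_sets: "T \<in> \<T> \<Longrightarrow> T \<in> sets lebesgue" "T \<in> \<T> \<Longrightarrow> closed T" "T \<in> \<T> \<Longrightarrow> convex T"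
  using closed_cell_sets frameD by metis+

lemma AE_cell_of: "T \<in> \<T> \<Longrightarrow> AE x in lborel. x \<in> T \<longrightarrow> x \<in> cell_of T"
  using AE_closed_cell frameD by metis

lemma cell_value_mesh: "T \<in> \<T> \<Longrightarrow> cell_value \<beta> T = b T"
  using cell_value_eq frameD by metis

abbreviation exit_edge :: "(real^2) set \<Rightarrow> (real^2) set" where
  "exit_edge T \<equiv> closed_segment (P T) (P T + u T)"

lemma exit_edge_tcoord: 
  assumes "T \<in> \<T>" "x \<in> exit_edge T"
  shows "t_of T x = 0"
proof -
  obtain s where "x = P T + s *\<^sub>R u T" using assms(2) unfolding edge_param by blast
  then show ?thesis by (simp add: tcoord_def)
qed

lemma exit_edge_subset:
  assumes T: "T \<in> \<T>" 
  shows "exit_edge T \<subseteq> T"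
proof
  fix x assume "x \<in> exit_edge T"
  then obtain s where s: "0 \<le> s" "s \<le> 1" "x = frame_pt (P T) (u T) (b T) (s, 0)"
    unfolding edge_param by (auto simp: frame_pt_def)
  have "x \<in> closed_cell (P T) (u T) (b T) (\<tau> T)"
    unfolding s(3) using s frameD(1,2)[OF T] by (simp add: closed_cell_def)
  then show "x \<in> T" using frameD(3)[OF T] by simp
qed

text \<open>By conformity the intersection is a face of both triangles, it contains the exit edge of \<open>T\<close>, and it is proper
  because two different triangles of the mesh are not faces of each other.\<close>

lemma successor_intersection:
  assumes T: "T \<in> \<T>" and T': "T' \<in> \<T>" "T' \<noteq> T" and sub: "exit_edge T \<subseteq> T'"
  shows "T \<inter> T' = exit_edge T" "T \<inter> T' \<noteq> T" "T \<inter> T' \<noteq> T'"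
proof -
  note J = frameD(1)[OF T] and \<tau> = frameD(2)[OF T] and Teq = frameD(3)[OF T]
  have face: "(T \<inter> T') face_of T" "(T \<inter> T') face_of T'" using mesh_face[OF T T'(1)] by auto
  have dim: "aff_dim S = 2" if "S \<in> \<T>" for S
    using mesh that unfolding simplicial_mesh_def by (simp add: aff_dim_simplex)
  \<comment> \<open>A face different from the whole triangle has smaller dimension, but both triangles have dimension two.\<close>
  show neT: "T \<inter> T' \<noteq> T"
  proof
    assume "T \<inter> T' = T"
    then have "T face_of T'" "T \<noteq> T'" using face T' by auto
    then have "aff_dim T < aff_dim T'" using face_of_aff_dim_lt mesh_sets(3)[OF T'(1)] by blast
    then show False using dim T T' by simp
  qed
  show "T \<inter> T' \<noteq> T'"
  proof
    assume "T \<inter> T' = T'"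
    then have "T' face_of T" "T \<noteq> T'" using face T' by auto
    then have "aff_dim T' < aff_dim T" using face_of_aff_dim_lt mesh_sets(3)[OF T] by blast
    then show False using dim T T' by simp
  qed
  have u: "u T \<noteq> 0" using J by auto
  have mem: "P T \<in> T \<inter> T'" "P T + u T \<in> T \<inter> T'" using sub exit_edge_subset[OF T] by auto
  have ne: "P T \<noteq> P T + u T" using u by simp
  obtain X Y where XY: "T \<inter> T' = closed_segment X Y"
    "X = P T \<and> Y = P T + u T \<or> X = P T + u T \<and> Y = P T + u T - \<tau> T *\<^sub>R b T \<or> X = P T \<and> Y = P T + u T - \<tau> T *\<^sub>R b T"
    using proper_face_of_cell[OF J \<tau> _ _ mem ne] face(1) neT Teq by metis
  define R where "R = P T + u T - \<tau> T *\<^sub>R b T"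
  have "R \<notin> closed_segment X Y"
  proof
    assume "R \<in> closed_segment X Y"
    then have "{P T, P T + u T, R} \<subseteq> T \<inter> T'" using mem XY(1) by auto
    moreover have "convex (T \<inter> T')" using mesh_sets(3) T T' by (auto intro: convex_Int)
    ultimately have "convex hull {P T, P T + u T, R} \<subseteq> T \<inter> T'" by (rule hull_minimal)
    then have "T \<subseteq> T \<inter> T'" using convex_hull_closed_cell[OF J \<tau>, of "P T"] Teq by (simp add: R_def)
    then show False using neT by blast
  qed
  then show "T \<inter> T' = exit_edge T" using XY unfolding R_def[symmetric] by auto
qed

text \<open>Continuity of the normal component, since \<open>cross2 u b\<close> is the flux of \<open>b\<close> through the segment \<open>u\<close> up to sign.\<close>

lemma successor_flux:
  assumes T: "T \<in> \<T>" and T': "T' \<in> \<T>" "T' \<noteq> T" and sub: "exit_edge T \<subseteq> T'"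
  shows "cross2 (u T) (b T') = cross2 (u T) (b T)"
proof -
  note J = frameD(1)[OF T]
  note int = successor_intersection[OF T T' sub]
  have face: "(T \<inter> T') face_of T" "(T \<inter> T') face_of T'" using mesh_face[OF T T'(1)] by auto
  have "exit_edge T \<inter> interior T = {}" "exit_edge T \<inter> interior T' = {}"
    using face_of_disjoint_interior[OF face(1) int(2)] face_of_disjoint_interior[OF face(2) int(3)] int(1) by auto
  then have "exit_edge T \<subseteq> frontier T \<inter> frontier T'"
    using mesh_sets(2) T T' exit_edge_subset[OF T] sub by (auto simp: frontier_def)
  moreover have u: "u T \<noteq> 0" using J by auto
  ultimately have "P T \<noteq> P T + u T \<and> exit_edge T \<subseteq> frontier T \<inter> frontier T'" by simp
  then have "interior_face \<T> T T' (frontier T \<inter> frontier T')"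
    unfolding interior_face_def using T T' by blast
  moreover have "frontier T \<inter> frontier T' \<subseteq> exit_edge T"
    unfolding int(1)[symmetric] using mesh_sets(2)[OF T] mesh_sets(2)[OF T'(1)] frontier_subset_closed by blast
  then have "unit_normal (frontier T \<inter> frontier T') (exit_normal (u T) (b T))" by (rule unit_normal_exit[OF J])
  ultimately have "b T \<bullet> exit_normal (u T) (b T) - b T' \<bullet> exit_normal (u T) (b T) = 0"
    using jump unfolding normal_jump_free_def by (metis cell_value_mesh[OF T] cell_value_mesh[OF T'(1)])
  then have "sgn (cross2 (u T) (b T)) * (cross2 (u T) (b T) - cross2 (u T) (b T')) / norm (u T) = 0"
    unfolding exit_normal(2)[OF J] by (simp add: right_diff_distrib diff_divide_distrib)
  then show ?thesis using J u by (simp add: sgn_0_0)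
qed

text \<open>The common edge is not the tangential edge of \<open>T'\<close>, since the flux through it is nonzero. It is not the exit
  edge of \<open>T'\<close> either, since the flux has the same sign for both triangles and they would overlap. The two
  alternatives record which end of the edge is the apex of \<open>T'\<close>.\<close>

lemma successor_entry:
  assumes T: "T \<in> \<T>" and T': "T' \<in> \<T>" "T' \<noteq> T" and sub: "exit_edge T \<subseteq> T'"
  shows "(P T' = P T \<and> u T' - \<tau> T' *\<^sub>R b T' = u T) \<or>
    (P T' = P T + u T \<and> u T' - \<tau> T' *\<^sub>R b T' = - u T)"
proof -
  note J = frameD(1)[OF T] and \<tau> = frameD(2)[OF T] and Teq = frameD(3)[OF T]
  note J' = frameD(1)[OF T'(1)] and \<tau>' = frameD(2)[OF T'(1)] and Teq' = frameD(3)[OF T'(1)]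
  note int = successor_intersection[OF T T' sub]
  note flux = successor_flux[OF T T' sub]
  have face: "(T \<inter> T') face_of T'" using mesh_face[OF T T'(1)] by auto
  have u: "u T \<noteq> 0" using J by auto
  have mem: "P T \<in> T \<inter> T'" "P T + u T \<in> T \<inter> T'" using sub exit_edge_subset[OF T] by auto
  have ne: "P T \<noteq> P T + u T" using u by simp
  obtain X Y where XY: "T \<inter> T' = closed_segment X Y"
    "X = P T' \<and> Y = P T' + u T' \<or> X = P T' + u T' \<and> Y = P T' + u T' - \<tau> T' *\<^sub>R b T' \<or>
     X = P T' \<and> Y = P T' + u T' - \<tau> T' *\<^sub>R b T'"
    using proper_face_of_cell[OF J' \<tau>' _ _ mem ne] face int(3) Teq' by metis
  have "{X, Y} = {P T, P T + u T}" using XY(1) int(1) by simp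
  then have ends: "X = P T \<and> Y = P T + u T \<or> X = P T + u T \<and> Y = P T" by (auto simp: doubleton_eq_iff)
  then have YX: "Y - X = u T \<or> Y - X = - u T" by auto
  consider (exit) "X = P T'" "Y = P T' + u T'" | (tang) "X = P T' + u T'" "Y = P T' + u T' - \<tau> T' *\<^sub>R b T'"
    | (entry) "X = P T'" "Y = P T' + u T' - \<tau> T' *\<^sub>R b T'" using XY(2) by blast
  then show ?thesis
  proof cases
    case entry
    then show ?thesis using ends by (auto simp: algebra_simps)
  next
    case tang
    then have "Y - X = - \<tau> T' *\<^sub>R b T'" by simp
    then have "cross2 (Y - X) (b T') = 0" by simp
    then show ?thesis using YX flux J by auto
  next
    case exit
    then have u': "u T' = Y - X" "P T' = X" by auto
    have tc: "t_of T' y = t_of T y" for y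
    proof -
      have "t_of T' y = tcoord (P T) (u T) (b T') y"
        using ends u' reversed_coords(2)[of "u T" "b T'" "P T" y] flux J by auto
      then show ?thesis using flux by (simp add: tcoord_def)
    qed
    \<comment> \<open>Near the midpoint of the common edge, both triangles would fill the same half disc.\<close>
    define x0 where "x0 = P T + (1/2) *\<^sub>R u T"
    have x0': "x0 = P T' + (1/2) *\<^sub>R u T'"
      using ends u' by (auto simp: x0_def vec2_eq_iff)
    obtain r where r: "0 < r" "\<And>y. y \<in> ball x0 r \<Longrightarrow> y \<in> cell_of T \<longleftrightarrow> t_of T y < 0"
      by (rule exit_edge_neighbourhood[OF J \<tau>, of "1/2" "P T"]) (auto simp: x0_def)
    obtain r' where r': "0 < r'" "\<And>y. y \<in> ball x0 r' \<Longrightarrow> y \<in> cell_of T' \<longleftrightarrow> t_of T' y < 0"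
      by (rule exit_edge_neighbourhood[OF J' \<tau>', of "1/2" "P T'"]) (auto simp: x0')
    have "0 < min r r'" using r(1) r'(1) by simp
    then obtain c where c: "0 < c" "norm (c *\<^sub>R (- b T)) < min r r'" using small_scaling by blast
    define y where "y = x0 + c *\<^sub>R (- b T)"
    have yb: "y \<in> ball x0 r" "y \<in> ball x0 r'" using c by (auto simp: y_def dist_norm)
    have "t_of T y = - c"
      using tcoord_frame_pt[OF J, of "P T" "1/2" "- c"] by (simp add: y_def x0_def frame_pt_def)
    then have "y \<in> cell_of T" "y \<in> cell_of T'" using r(2)[OF yb(1)] r'(2)[OF yb(2)] tc c(1) by auto
    then have "y \<in> exit_edge T" using cell_of_subset T T'(1) int(1) by blast
    then have "t_of T y = 0" using exit_edge_tcoord[OF T] by simp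
    then show ?thesis using \<open>t_of T y = - c\<close> c by simp
  qed
qed

text \<open>The part around the common edge where the sign of \<open>t\<close> decides between \<open>T\<close> and \<open>T'\<close>.\<close>

definition interface :: "(real^2) set \<Rightarrow> (real^2) set \<Rightarrow> (real^2) set" where
  "interface T T' = near_exit (P T) (u T) (b T) (\<tau> T) \<inter>
     near_exit (P T') (u T' - \<tau> T' *\<^sub>R b T') (- b T') (\<tau> T')"

text \<open>Relates the coordinates of \<open>T'\<close>, which start at its exit edge, to those of \<open>T\<close>. The last statement says that
  equal parameter lengths carry equal fluxes on both sides.\<close>

lemma successor_coords:
  assumes T: "T \<in> \<T>" and T': "T' \<in> \<T>" "T' \<noteq> T" and sub: "exit_edge T \<subseteq> T'"
  shows "t_of T' x + \<tau> T' * s_of T' x = t_of T x"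
    "P T' = P T \<Longrightarrow> s_of T' x = scoord (P T) (u T) (b T') x"
    "P T' \<noteq> P T \<Longrightarrow> s_of T' x = 1 - scoord (P T) (u T) (b T') x"
    "\<bar>cross2 (u T') (b T')\<bar> = \<bar>cross2 (u T) (b T)\<bar>"
proof -
  note J = frameD(1)[OF T] and J' = frameD(1)[OF T'(1)]
  note flux = successor_flux[OF T T' sub]
  note ent = successor_entry[OF T T' sub]
  note ec2 = entry_coords(2)[OF J', where P = "P T'" and \<tau> = "\<tau> T'" and x = x]
  note ec3 = entry_coords(3)[OF J', where P = "P T'" and \<tau> = "\<tau> T'" and x = x]
  have u: "u T \<noteq> 0" using J by auto
  have Jn: "cross2 (u T) (- b T') \<noteq> 0" using flux J by simp
  have tt: "tcoord (P T) (u T) (- b T') x = - t_of T x"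
    using flux by (simp add: tcoord_def)
  have "tcoord (P T') (u T' - \<tau> T' *\<^sub>R b T') (- b T') x = - t_of T x"
    using ent reversed_coords(2)[OF Jn, of "P T" x] tt by auto
  then show "t_of T' x + \<tau> T' * s_of T' x = t_of T x"
    unfolding ec3 by simp
  show "s_of T' x = scoord (P T) (u T) (b T') x" if "P T' = P T"
  proof -
    have "u T' - \<tau> T' *\<^sub>R b T' = u T" using ent that u by auto
    then show ?thesis using ec2 that by simp
  qed
  show "s_of T' x = 1 - scoord (P T) (u T) (b T') x" if "P T' \<noteq> P T"
  proof -
    have "P T' = P T + u T" "u T' - \<tau> T' *\<^sub>R b T' = - u T" using ent that by auto
    then show ?thesis using ec2 reversed_coords(1)[OF Jn, of "P T" x] by simp
  qed
  have "cross2 (u T') (b T') = cross2 (u T' - \<tau> T' *\<^sub>R b T') (b T')" by (simp add: cross2_diff)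
  then show "\<bar>cross2 (u T') (b T')\<bar> = \<bar>cross2 (u T) (b T)\<bar>" using ent flux by auto
qed

lemma interface:
  assumes T: "T \<in> \<T>" and T': "T' \<in> \<T>" "T' \<noteq> T" and sub: "exit_edge T \<subseteq> T'"
  shows "open (interface T T')" "interface T T' \<subseteq> \<Omega>"
    "\<And>s. 0 < s \<Longrightarrow> s < 1 \<Longrightarrow> P T + s *\<^sub>R u T \<in> interface T T'"
    "\<And>x. x \<in> interface T T' \<Longrightarrow> t_of T x < 0 \<Longrightarrow> x \<in> cell_of T"
    "\<And>x. x \<in> interface T T' \<Longrightarrow> t_of T x > 0 \<Longrightarrow> x \<in> cell_of T'"
proof -
  note J = frameD(1)[OF T] and J' = frameD(1)[OF T'(1)] and \<tau> = frameD(2)[OF T] and \<tau>' = frameD(2)[OF T'(1)]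
  note ec1 = entry_coords(1)[OF J', where \<tau> = "\<tau> T'"]
  note ec3 = entry_coords(3)[OF J', where P = "P T'" and \<tau> = "\<tau> T'"]
  note sc = successor_coords[OF T T' sub]
  show op: "open (interface T T')" unfolding interface_def by (intro open_Int open_near_exit)
  have tt: "tcoord (P T') (u T' - \<tau> T' *\<^sub>R b T') (- b T') x = - t_of T x" for x
    unfolding ec3 sc(1) ..
  show A: "x \<in> cell_of T" if "x \<in> interface T T'" "t_of T x < 0" for x
    using near_exit_cell(2)[of x "P T" "u T" "b T" "\<tau> T"] that by (auto simp: interface_def)
  show "x \<in> cell_of T'" if "x \<in> interface T T'" "t_of T x > 0" for x
  proof -
    have "x \<in> cell (P T') (u T' - \<tau> T' *\<^sub>R b T') (- b T') (\<tau> T')"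
      using near_exit_cell(2)[of x "P T'"] that tt by (auto simp: interface_def)
    then show ?thesis unfolding entry_cell[OF J'] .
  qed
  have "interface T T' \<subseteq> closure \<Omega>"
  proof
    fix x assume x: "x \<in> interface T T'"
    have "x \<in> T \<union> T'"
    proof (cases "t_of T x \<le> 0")
      case True
      then show ?thesis
        using near_exit_cell(1)[of x "P T"] x frameD(3)[OF T] by (auto simp: interface_def)
    next
      case False
      then have "x \<in> closed_cell (P T') (u T' - \<tau> T' *\<^sub>R b T') (- b T') (\<tau> T')"
        using near_exit_cell(1)[of x "P T'"] x tt by (auto simp: interface_def)
      then show ?thesis unfolding entry_cell[OF J'] using frameD(3)[OF T'(1)] by simp
    qed
    then show "x \<in> closure \<Omega>" using mesh_cover T T' by blast
  qed
  then show "interface T T' \<subseteq> \<Omega>" using op interior_maximal interior_closure_domain by metis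
  show "P T + s *\<^sub>R u T \<in> interface T T'" if s: "0 < s" "s < 1" for s
  proof -
    have "P T + s *\<^sub>R u T \<in> near_exit (P T) (u T) (b T) (\<tau> T)" by (rule exit_edge_near_exit[OF J \<tau> s])
    moreover have "P T + s *\<^sub>R u T \<in> near_exit (P T') (u T' - \<tau> T' *\<^sub>R b T') (- b T') (\<tau> T')"
      using successor_entry[OF T T' sub]
    proof
      assume "P T' = P T \<and> u T' - \<tau> T' *\<^sub>R b T' = u T"
      then show ?thesis using exit_edge_near_exit[OF ec1 \<tau>' s, of "P T'"] by simp
    next
      assume *: "P T' = P T + u T \<and> u T' - \<tau> T' *\<^sub>R b T' = - u T"
      have "P T' + (1 - s) *\<^sub>R (u T' - \<tau> T' *\<^sub>R b T') \<in> near_exit (P T') (u T' - \<tau> T' *\<^sub>R b T') (- b T') (\<tau> T')"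
        using exit_edge_near_exit[OF ec1 \<tau>', of "1 - s" "P T'"] s by simp
      moreover have "P T' + (1 - s) *\<^sub>R (u T' - \<tau> T' *\<^sub>R b T') = P T + s *\<^sub>R u T"
        unfolding conjunct1[OF *] conjunct2[OF *] by (simp add: algebra_simps)
      ultimately show ?thesis by simp
    qed
    ultimately show ?thesis by (simp add: interface_def)
  qed
qed

text \<open>If the exit edge belongs to no other triangle, the domain is near this edge the half plane upstream of
  it.\<close>

definition outflow_side :: "(real^2) set \<Rightarrow> (real^2) set" where
  "outflow_side T = near_exit (P T) (u T) (b T) (\<tau> T) - \<Union>(\<T> - {T})"

lemma outflow_side:
  assumes T: "T \<in> \<T>" and last: "\<forall>T'\<in>\<T>. exit_edge T \<subseteq> T' \<longrightarrow> T' = T"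
  shows "open (outflow_side T)"
    "\<And>s. 0 < s \<Longrightarrow> s < 1 \<Longrightarrow> P T + s *\<^sub>R u T \<in> outflow_side T"
    "\<And>x. x \<in> outflow_side T \<Longrightarrow> t_of T x < 0 \<Longrightarrow> x \<in> cell_of T"
    "\<And>x. x \<in> outflow_side T \<Longrightarrow> t_of T x \<ge> 0 \<Longrightarrow> x \<notin> \<Omega>"
    "\<And>x. x \<in> outflow_side T \<Longrightarrow> x \<in> frontier \<Omega> \<Longrightarrow> normal_flux \<Omega> \<beta> x > 0"
proof -
  note J = frameD(1)[OF T] and \<tau> = frameD(2)[OF T] and Teq = frameD(3)[OF T]
  show op: "open (outflow_side T)"
    unfolding outflow_side_def using finite_mesh mesh_sets(2)
    by (intro open_Diff open_near_exit closed_Union) auto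
  show "P T + s *\<^sub>R u T \<in> outflow_side T" if s: "0 < s" "s < 1" for s
  proof -
    let ?x = "P T + s *\<^sub>R u T"
    have u: "u T \<noteq> 0" using J by auto
    have "?x \<notin> T'" if T': "T' \<in> \<T>" "T' \<noteq> T" for T'
    proof
      assume x: "?x \<in> T'"
      have "?x \<in> open_segment (P T) (P T + u T)"
        using s u by (auto simp: in_segment algebra_simps intro!: exI[of _ s])
      moreover have "?x \<in> exit_edge T" unfolding edge_param using s by (intro exI[of _ s]) simp
      then have xT: "?x \<in> T" using exit_edge_subset[OF T] by blast
      moreover have "P T \<in> T" "P T + u T \<in> T" using exit_edge_subset[OF T] by auto
      ultimately have "P T \<in> T \<inter> T'" "P T + u T \<in> T \<inter> T'"
        using mesh_face[OF T T'(1)] x unfolding face_of_def by blast+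
      then have "exit_edge T \<subseteq> T'"
        using mesh_sets(3)[OF T'(1)] closed_segment_subset by blast
      then show False using last T' by blast
    qed
    then show ?thesis
      using exit_edge_near_exit[OF J \<tau> s, of "P T"] by (auto simp: outflow_side_def)
  qed
  show A: "x \<in> cell_of T" if "x \<in> outflow_side T" "t_of T x < 0" for x
    using near_exit_cell(2)[of x "P T" "u T" "b T" "\<tau> T"] that by (auto simp: outflow_side_def)
  have clT: "x \<in> T" if "x \<in> outflow_side T" "x \<in> closure \<Omega>" for x
    using that mesh_cover by (auto simp: outflow_side_def)
  show B: "x \<notin> \<Omega>" if x: "x \<in> outflow_side T" "t_of T x \<ge> 0" for x
  proof
    assume "x \<in> \<Omega>"
    have "\<Omega> \<inter> outflow_side T \<subseteq> T" using clT closure_subset by blast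
    then have "\<Omega> \<inter> outflow_side T \<subseteq> interior T" using op open_domain by (intro interior_maximal open_Int)
    then have "x \<in> cell_of T" using x(1) \<open>x \<in> \<Omega>\<close> cell_of_interior[OF T] by blast
    then show False using x(2) by (simp add: cell_def)
  qed
  show "normal_flux \<Omega> \<beta> x > 0" if x: "x \<in> outflow_side T" "x \<in> frontier \<Omega>" for x
  proof -
    have "x \<in> T" using clT x by (simp add: frontier_def)
    then have "t_of T x \<le> 0" using Teq by (auto simp: closed_cell_def)
    moreover have "x \<notin> \<Omega>" using x(2) open_domain by (simp add: frontier_def interior_open)
    then have "\<not> t_of T x < 0" using A[OF x(1)] cell_of_domain[OF T] by blast
    ultimately have t0: "t_of T x = 0" by simp
    obtain r where r: "0 < r" "ball x r \<subseteq> outflow_side T" by (rule openE[OF op x(1)])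
    have xs: "x = P T + s_of T x *\<^sub>R u T" by (rule tcoord_0_edge[OF J t0])
    have half: "y \<in> \<Omega> \<longleftrightarrow> t_of T y < 0" if "y \<in> ball x r" for y
      using A[of y] B[of y] cell_of_domain[OF T] that r(2) by (meson not_less subsetD)
    have "(y - x) \<bullet> exit_normal (u T) (b T) < 0 \<longleftrightarrow> t_of T y < 0" for y
      by (subst xs) (rule exit_normal(4)[OF J])
    then have "\<Omega> \<inter> ball x r = {y \<in> ball x r. (y - x) \<bullet> exit_normal (u T) (b T) < 0}"
      using half by blast
    then have on: "outward_normal \<Omega> x (exit_normal (u T) (b T))"
      using r(1) exit_normal(1)[OF J] by (auto simp: outward_normal_def)
    have sets: "\<Omega> \<inter> ball x r \<in> sets lebesgue" using open_domain by (auto intro: borel_open)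
    have sub: "\<Omega> \<inter> ball x r \<subseteq> T" using half A r(2) cell_of_subset[OF T] by blast
    have "AE y in lborel. y \<in> T \<longrightarrow> \<beta> y = b T"
      using frameD(4)[OF T] unfolding const_on_def AE_lebesgue_on_iff[OF mesh_sets(1)[OF T]] .
    then have "AE y in lborel. y \<in> \<Omega> \<inter> ball x r \<longrightarrow> \<beta> y = b T"
      by eventually_elim (use sub in blast)
    then have "AE y in lebesgue_on (\<Omega> \<inter> ball x r). \<beta> y = b T" unfolding AE_lebesgue_on_iff[OF sets] .
    then have "boundary_value \<Omega> \<beta> x (b T)" using r(1) by (auto simp: boundary_value_def)
    from normal_flux_eq[OF open_domain this on] show ?thesis using exit_normal(3)[OF J] by simp
  qed
qed

end

section \<open>Weak divergences\<close>

lemma borel_lebesgue_on: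
  "f \<in> borel_measurable borel \<Longrightarrow> f \<in> borel_measurable (lebesgue_on S)"
  by (intro measurable_restrict_space1 measurable_completion) simp

lemma lebesgue_on_integral_eq:
  fixes F G :: "'a::euclidean_space \<Rightarrow> real"
  assumes S: "S \<in> sets lebesgue" and F: "F \<in> borel_measurable (lebesgue_on S)"
    and G: "G \<in> borel_measurable borel" and eq: "AE x in lborel. G x = indicator S x * F x"
  shows "(LINT x|lebesgue_on S. F x) = (LINT x|lborel. G x)"
    and "integrable (lebesgue_on S) F \<longleftrightarrow> integrable lborel G"
proof -
  have Fm: "(\<lambda>x. indicator S x *\<^sub>R F x) \<in> borel_measurable lebesgue"
    using F S by (simp add: borel_measurable_restrict_space_iff)
  have G': "G \<in> borel_measurable lborel" using G by simp
  then have Gm: "G \<in> borel_measurable lebesgue" by (rule measurable_completion)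
  have eq': "AE x in lebesgue. indicator S x *\<^sub>R F x = G x"
    unfolding AE_completion_iff using eq by eventually_elim simp
  have "(LINT x|lebesgue_on S. F x) = (LINT x|lebesgue. indicator S x *\<^sub>R F x)"
    using S by (simp add: integral_restrict_space)
  also have "\<dots> = (LINT x|lebesgue. G x)" by (rule integral_cong_AE[OF Fm Gm eq'])
  also have "\<dots> = (LINT x|lborel. G x)" by (rule integral_completion[OF G'])
  finally show "(LINT x|lebesgue_on S. F x) = (LINT x|lborel. G x)" .
  have "integrable (lebesgue_on S) F \<longleftrightarrow> integrable lebesgue (\<lambda>x. indicator S x *\<^sub>R F x)"
    using S by (simp add: integrable_restrict_space)
  also have "\<dots> \<longleftrightarrow> integrable lebesgue G" by (rule integrable_cong_AE[OF Fm Gm eq'])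
  also have "\<dots> \<longleftrightarrow> integrable lborel G" by (rule integrable_completion[OF G'])
  finally show "integrable (lebesgue_on S) F \<longleftrightarrow> integrable lborel G" .
qed

lemma borel_representative:
  fixes \<phi> :: "'a::euclidean_space \<Rightarrow> real"
  assumes S: "S \<in> sets lebesgue" and "\<phi> \<in> borel_measurable (lebesgue_on S)"
  obtains w where "w \<in> borel_measurable borel" "AE x in lborel. w x = indicator S x * \<phi> x"
proof -
  have "(\<lambda>x. indicator S x *\<^sub>R \<phi> x) \<in> borel_measurable lebesgue"
    using assms by (simp add: borel_measurable_restrict_space_iff)
  then obtain w where "w \<in> borel_measurable lborel" "AE x in lborel. indicator S x *\<^sub>R \<phi> x = w x"
    using completion_ex_borel_measurable_real by blast
  note w = this
  have "AE x in lborel. w x = indicator S x * \<phi> x" using w(2) by eventually_elim simp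
  then show thesis using that[of w] w(1) by simp
qed

lemma frechet_derivative_scaleR:
  "f differentiable (at x) \<Longrightarrow> frechet_derivative f (at x) (c *\<^sub>R v) = c *\<^sub>R frechet_derivative f (at x) v"
  using linear_frechet_derivative linear_scale by blast

lemma frechet_derivative_expand:
  fixes \<psi> :: "real^2 \<Rightarrow> real"
  assumes "smooth \<psi>"
  shows "frechet_derivative \<psi> (at x) v =
    v $ 1 * frechet_derivative \<psi> (at x) (axis 1 1) + v $ 2 * frechet_derivative \<psi> (at x) (axis 2 1)"
proof -
  have lin: "linear (frechet_derivative \<psi> (at x))"
    using smooth_differentiable[OF assms] by (rule linear_frechet_derivative)
  have "v = v $ 1 *\<^sub>R axis 1 1 + v $ 2 *\<^sub>R axis 2 1" by (auto simp: vec2_eq_iff axis_def)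
  then have "frechet_derivative \<psi> (at x) v = frechet_derivative \<psi> (at x) (v $ 1 *\<^sub>R axis 1 1 + v $ 2 *\<^sub>R axis 2 1)"
    by simp
  also have "\<dots> = v $ 1 * frechet_derivative \<psi> (at x) (axis 1 1) + v $ 2 * frechet_derivative \<psi> (at x) (axis 2 1)"
    by (simp only: linear_add[OF lin] linear_scale[OF lin] real_scaleR_def)
  finally show ?thesis .
qed

text \<open>Products of bumps in the standard coordinates are test functions.\<close>

lemma fundamental_lemma:
  fixes f :: "real^2 \<Rightarrow> real"
  assumes f: "integrable lborel f" and fm: "f \<in> borel_measurable borel" and U: "open U"
    and zero: "\<And>\<psi>. test_function U \<psi> \<Longrightarrow> (LINT x|lborel. f x * \<psi> x) = 0"
  shows "AE x in lborel. x \<in> U \<longrightarrow> f x = 0"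
proof -
  note [measurable] = fm
  let ?u = "axis 1 1 :: real^2" and ?b = "axis 2 1 :: real^2"
  let ?X = "frame_pt 0 ?u ?b"
  have J: "cross2 ?u ?b \<noteq> 0" by (simp add: cross2_def axis_def)
  have Um [measurable]: "U \<in> sets borel" using U by simp
  have fi: "integrable lborel (\<lambda>z. f (?X z))" using lborel_integrable_frame[OF J fm] f by blast
  have "AE z in lborel. z \<in> ?X -` U \<longrightarrow> f (?X z) = 0"
  proof (rule AE_zero_of_bump_integrals_prod)
    show "open (?X -` U)" by (intro open_vimage U continuous_intros)
    show "set_integrable lborel ({a..b} \<times> {c..d}) (\<lambda>z. f (?X z))" for a b c d
      unfolding set_integrable_def
      by (intro integrable_mult_indicator fi) (simp add: borel_closed closed_Times)
    fix a b c d :: real and n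
    assume sub: "{a..b} \<times> {c..d} \<subseteq> ?X -` U"
    define \<psi> where "\<psi> x = bump n a b (scoord 0 ?u ?b x) * bump n c d (tcoord 0 ?u ?b x)" for x
    have t: "test_function U \<psi>"
      unfolding \<psi>_def by (rule frame_bump_test_function[OF J]) (use sub in blast)
    have [measurable]: "\<psi> \<in> borel_measurable borel" by (rule smooth_borel_measurable[OF test_function_smooth[OF t]])
    have "\<psi> (?X (s, t)) = bump n a b s * bump n c d t" for s t
      using J by (simp add: \<psi>_def)
    then have "(LINT (s, t)|lborel. f (?X (s, t)) * (bump n a b s * bump n c d t)) = (LINT z|lborel. f (?X z) * \<psi> (?X z))"
      by (auto intro!: Bochner_Integration.integral_cong)
    also have "\<dots> = 0"
      using zero[OF t] J by (subst (asm) lborel_integral_frame[OF J, of _ 0]) auto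
    finally show "(LINT (s, t)|lborel. f (?X (s, t)) * (bump n a b s * bump n c d t)) = 0" .
  qed
  then have "AE z in lborel. ?X z \<in> U \<longrightarrow> f (?X z) = 0" by simp
  then show ?thesis by (subst AE_lborel_frame[OF J, of _ 0]) simp_all
qed

lemma Lp_measurable: "f \<in> Lp \<rho> M \<Longrightarrow> f \<in> borel_measurable M"
  by (simp add: Lp_def)

text \<open>On a finite measure space \<open>1 + |f|\<^sup>q\<close> is integrable, and it dominates \<open>|f|\<close> for \<open>q \<ge> 1\<close>.\<close>

lemma (in finite_measure) Lp_integrable:
  fixes f :: "'a \<Rightarrow> real"
  assumes f: "f \<in> Lp \<rho> M" and \<rho>: "1 \<le> \<rho>"
  shows "integrable M f"
proof (cases "\<rho> = \<infinity>")
  case True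
  then obtain C where "AE x in M. norm (f x) \<le> C" using f by (auto simp: Lp_def)
  then show ?thesis using Lp_measurable[OF f] by (rule integrable_const_bound)
next
  case False
  then obtain q where q: "\<rho> = ereal q" "1 \<le> q" using \<rho> by (cases \<rho>) auto
  have i: "integrable M (\<lambda>x. 1 + norm (f x) powr q)"
    using f q by (simp add: Lp_def)
  show ?thesis
  proof (rule Bochner_Integration.integrable_bound[OF i Lp_measurable[OF f]], intro AE_I2)
    fix x
    have "\<bar>f x\<bar> \<le> 1 + \<bar>f x\<bar> powr q"
    proof (cases "\<bar>f x\<bar> \<le> 1")
      case False
      then have "\<bar>f x\<bar> powr 1 \<le> \<bar>f x\<bar> powr q" using q by (intro powr_mono) auto
      then show ?thesis using False by simp
    qed (use powr_ge_zero[of "\<bar>f x\<bar>" q] in linarith)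
    then show "norm (f x) \<le> norm (1 + norm (f x) powr q)" by simp
  qed
qed

lemma weak_div_unique:
  assumes S: "open S" and d: "integrable (lebesgue_on S) d1" "integrable (lebesgue_on S) d2"
    and w: "has_weak_div S v d1" "has_weak_div S v d2"
  shows "AE x in lebesgue_on (S::(real^2) set). d1 x = d2 x"
proof -
  have Sm: "S \<in> sets lebesgue" using S by (simp add: borel_open)
  let ?d = "\<lambda>x. d1 x - d2 x"
  have dm: "?d \<in> borel_measurable (lebesgue_on S)" using d by (auto intro: borel_measurable_integrable)
  obtain f where f: "f \<in> borel_measurable borel" "AE x in lborel. f x = indicator S x * ?d x"
    using borel_representative[OF Sm dm] .
  have "AE x in lborel. x \<in> S \<longrightarrow> f x = 0"
  proof (rule fundamental_lemma[OF _ f(1) S])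
    show "integrable lborel f" using lebesgue_on_integral_eq(2)[OF Sm dm f] d by simp
    fix \<psi> :: "real^2 \<Rightarrow> real" assume \<psi>: "test_function S \<psi>"
    obtain C where C: "\<And>x. \<bar>\<psi> x\<bar> \<le> C" using test_function_bounded[OF \<psi>] by metis
    have \<psi>m: "\<psi> \<in> borel_measurable borel" by (rule smooth_borel_measurable[OF test_function_smooth[OF \<psi>]])
    have \<psi>m': "\<psi> \<in> borel_measurable (lebesgue_on S)"
      using \<psi>m by (rule borel_lebesgue_on)
    have i: "integrable (lebesgue_on S) (\<lambda>x. d1 x * \<psi> x)" "integrable (lebesgue_on S) (\<lambda>x. d2 x * \<psi> x)"
      by (rule integrable_mult_bounded_real[OF _ \<psi>m' C], rule d)+
    have "(LINT x|lborel. f x * \<psi> x) = (LINT x|lebesgue_on S. ?d x * \<psi> x)"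
    proof (rule lebesgue_on_integral_eq(1)[OF Sm, symmetric])
      show "(\<lambda>x. ?d x * \<psi> x) \<in> borel_measurable (lebesgue_on S)" using dm \<psi>m' by (rule borel_measurable_times)
      show "(\<lambda>x. f x * \<psi> x) \<in> borel_measurable borel" using f(1) \<psi>m by (rule borel_measurable_times)
      show "AE x in lborel. f x * \<psi> x = indicator S x * (?d x * \<psi> x)" using f(2) by eventually_elim simp
    qed
    also have "\<dots> = (LINT x|lebesgue_on S. d1 x * \<psi> x) - (LINT x|lebesgue_on S. d2 x * \<psi> x)"
      unfolding Bochner_Integration.integral_diff[OF i, symmetric] by (simp add: left_diff_distrib)
    also have "\<dots> = 0" 
    proof -
      have "(LINT x|lebesgue_on S. frechet_derivative \<psi> (at x) (v x)) = - (LINT x|lebesgue_on S. d1 x * \<psi> x)"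
        "(LINT x|lebesgue_on S. frechet_derivative \<psi> (at x) (v x)) = - (LINT x|lebesgue_on S. d2 x * \<psi> x)"
        using w \<psi> unfolding has_weak_div_def by blast+
      then show ?thesis by simp
    qed
    finally show "(LINT x|lborel. f x * \<psi> x) = 0" .
  qed
  with f(2) have "AE x in lborel. x \<in> S \<longrightarrow> d1 x = d2 x" by eventually_elim auto
  then show ?thesis unfolding AE_lebesgue_on_iff[OF Sm] .
qed

section \<open>Weak solutions on a flow-aligned mesh\<close>

lemma AE_tcoord_nonzero:
  assumes "cross2 u b \<noteq> 0"
  shows "AE x in lborel. tcoord P u b x \<noteq> 0"
proof -
  have "AE t in lborel. t \<noteq> (0::real)" by (rule AE_lborel_singleton)
  then have "AE s in (lborel :: real measure). AE t in lborel. snd (s :: real, t :: real) \<noteq> 0" by simp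
  then have "AE z in lborel \<Otimes>\<^sub>M lborel. snd (z :: real \<times> real) \<noteq> 0"
    by (rule lborel_pair.AE_pair_measure[rotated]) measurable
  then have "AE z in lborel. tcoord P u b (frame_pt P u b z) \<noteq> 0"
    unfolding lborel_prod by eventually_elim (use assms in auto)
  then show ?thesis by (subst AE_lborel_frame[OF assms, of _ P]) simp_all
qed

lemma AE_scoord:
  assumes J: "cross2 u b \<noteq> 0" and R: "AE s in lborel. R s" and Rm: "Measurable.pred borel R"
  shows "AE x in lborel. R (scoord P u b x)"
proof -
  note [measurable] = Rm
  have "AE s in (lborel :: real measure). AE t in (lborel :: real measure). R (fst (s, t))"
    using R by eventually_elim simp
  then have "AE z in lborel \<Otimes>\<^sub>M lborel. R (fst (z :: real \<times> real))"
    by (rule lborel_pair.AE_pair_measure[rotated]) measurable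
  then have "AE z in lborel. R (scoord P u b (frame_pt P u b z))"
    unfolding lborel_prod by eventually_elim (use J in auto)
  then show ?thesis by (subst AE_lborel_frame[OF J, of _ P]) simp_all
qed

text \<open>Every streamline meets the cell in an interval of positive length, so a property of \<open>s\<close> holding almost
  everywhere on the cell holds for almost every streamline.\<close>

lemma AE_scoord_cell:
  assumes J: "cross2 u b \<noteq> 0" and \<tau>: "0 < \<tau>" and Rm: "Measurable.pred borel R"
    and R: "AE x in lborel. x \<in> cell P u b \<tau> \<longrightarrow> R (scoord P u b x)"
  shows "AE s in lborel. s \<in> {0<..<1} \<longrightarrow> R s"
proof -
  note [measurable] = Rm
  have [measurable]: "cell P u b \<tau> \<in> sets borel" by (simp add: open_cell)
  have "AE z in lborel. frame_pt P u b z \<in> cell P u b \<tau> \<longrightarrow> R (scoord P u b (frame_pt P u b z))"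
    using R by (subst (asm) AE_lborel_frame[OF J, of _ P]) simp_all
  then have "AE z in lborel \<Otimes>\<^sub>M lborel. frame_pt P u b z \<in> cell P u b \<tau> \<longrightarrow> R (scoord P u b (frame_pt P u b z))"
    unfolding lborel_prod .
  then have "AE s in lborel. AE t in lborel. frame_pt P u b (s, t) \<in> cell P u b \<tau> \<longrightarrow> R (scoord P u b (frame_pt P u b (s, t)))"
    by (rule lborel_pair.AE_pair)
  then show ?thesis
  proof eventually_elim
    case (elim s)
    show ?case
    proof
      assume s: "s \<in> {0<..<1}"
      then have "- \<tau> * s < 0" using \<tau> by simp
      then obtain t where "t \<in> {- \<tau> * s<..<0}" "frame_pt P u b (s, t) \<in> cell P u b \<tau> \<longrightarrow> R (scoord P u b (frame_pt P u b (s, t)))"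
        using AE_lborel_ex_Ioo[OF elim] by blast
      then show "R s" using s J by (simp add: mem_cell_frame_pt)
    qed
  qed
qed

lemma affine_of_coords:
  "\<exists>a c. \<forall>x. D * tcoord P u b x + (\<alpha> * scoord P u b x + \<kappa>) = a \<bullet> x + c"
proof (intro exI allI)
  fix x
  have "cross2 x b = - (perp b \<bullet> x)" unfolding inner_perp by (rule cross2_commute)
  then show "D * tcoord P u b x + (\<alpha> * scoord P u b x + \<kappa>) =
      ((D / cross2 u b) *\<^sub>R perp u - (\<alpha> / cross2 u b) *\<^sub>R perp b) \<bullet> x +
      (\<kappa> - D * (cross2 u P / cross2 u b) - \<alpha> * (cross2 P b / cross2 u b))"
    unfolding tcoord_affine scoord_affine by (simp add: inner_diff_left inner_perp(2)[of u] algebra_simps)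
qed

lemma sets_arclength [simp]: "sets (arclength \<Gamma>) = sets borel"
  by (simp add: arclength_def Let_def)

lemma set_integral_reflect:
  "(LINT s:{0<..<1}|lborel. f (1 - s)) = (LINT s:{0<..<1}|lborel. (f (s::real) :: real))"
proof -
  have "(LINT s:{0<..<1}|lborel. f s) = (LINT s|lborel. indicator {0<..<1} (1 + (-1) * s) *\<^sub>R f (1 + (-1) * s))"
    unfolding set_lebesgue_integral_def by (subst lborel_integral_real_affine[where c = "-1" and t = 1]) auto
  also have "\<dots> = (LINT s:{0<..<1}|lborel. f (1 - s))"
    unfolding set_lebesgue_integral_def by (intro Bochner_Integration.integral_cong) (auto simp: indicator_def)
  finally show ?thesis ..
qed

lemma set_integral_id: "set_integrable lborel {0<..<1} (\<lambda>s::real. s)" "(LINT s:{0<..<1}|lborel. (s::real)) = 1 / 2"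
proof -
  have si: "set_integrable lborel {0..1} (\<lambda>s::real. s)"
    by (intro borel_integrable_atLeastAtMost') (auto intro!: continuous_intros)
  then show "set_integrable lborel {0<..<1} (\<lambda>s::real. s)"
    by (rule set_integrable_subset) auto
  have "(LINT s|lborel. s * indicator {0..1} s) = (1::real)^2 / 2 - 0^2 / 2"
    by (rule integral_FTC_Icc_real) (auto intro!: derivative_eq_intros)
  moreover have "(LINT s:{0<..<1}|lborel. (s::real)) = (LINT s|lborel. s * indicator {0..1} s)"
    unfolding set_lebesgue_integral_def
  proof (rule integral_cong_AE)
    show "AE x in lborel. indicat_real {0<..<1} x *\<^sub>R x = x * indicat_real {0..1} x"
      using AE_lborel_singleton[of 1] by eventually_elim (auto simp: indicator_def)
  qed auto
  ultimately show "(LINT s:{0<..<1}|lborel. (s::real)) = 1 / 2" by simp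
qed

locale flow_field = flow_mesh +
  assumes bounded_domain: "bounded \<Omega>" and field_bounded: "\<beta> \<in> Lp \<infinity> (lebesgue_on \<Omega>)"
begin

lemma domain_sets: "\<Omega> \<in> sets lebesgue"
  using open_domain by (simp add: borel_open)

lemma finite_measure_domain: "finite_measure (lebesgue_on \<Omega>)"
  using open_domain bounded_domain by (intro finite_measure_lebesgue_on lmeasurable_open)

lemma AE_on_cell_of:
  assumes T: "T \<in> \<T>" and d: "const_on T d D"
  shows "AE x in lborel. x \<in> cell_of T \<longrightarrow> x \<in> \<Omega> \<and> \<beta> x = b T \<and> d x = D"
proof -
  have "AE x in lborel. x \<in> T \<longrightarrow> \<beta> x = b T" "AE x in lborel. x \<in> T \<longrightarrow> d x = D"
    using frameD(4)[OF T] d unfolding const_on_def AE_lebesgue_on_iff[OF mesh_sets(1)[OF T]] by auto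
  then show ?thesis by eventually_elim (use cell_of_domain[OF T] cell_of_subset[OF T] in blast)
qed

lemma flux_measurable:
  assumes "smooth \<psi>"
  shows "(\<lambda>x. frechet_derivative \<psi> (at x) (\<beta> x)) \<in> borel_measurable (lebesgue_on \<Omega>)"
proof -
  have [measurable]: "\<beta> \<in> borel_measurable (lebesgue_on \<Omega>)" using Lp_measurable[OF field_bounded] .
  have [measurable]: "(\<lambda>x. frechet_derivative \<psi> (at x) v) \<in> borel_measurable (lebesgue_on \<Omega>)" for v
    using smooth_borel_measurable(2)[OF assms] by (rule borel_lebesgue_on)
  show ?thesis
    unfolding frechet_derivative_expand[OF assms, of _ "\<beta> _"] cart_eq_inner_axis by measurable
qed

lemma flux_bounded:
  assumes \<psi>: "test_function N \<psi>"
  obtains C where "AE x in lebesgue_on \<Omega>. \<bar>frechet_derivative \<psi> (at x) (\<beta> x)\<bar> \<le> C"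
proof -
  obtain B where B: "AE x in lebesgue_on \<Omega>. norm (\<beta> x) \<le> B"
    using field_bounded by (auto simp: Lp_def)
  obtain C1 where C1: "0 < C1" "\<And>x. \<bar>frechet_derivative \<psi> (at x) (axis 1 1)\<bar> \<le> C1"
    using test_function_bounded[OF \<psi>, of "axis 1 1"] by metis
  obtain C2 where C2: "0 < C2" "\<And>x. \<bar>frechet_derivative \<psi> (at x) (axis 2 1)\<bar> \<le> C2"
    using test_function_bounded[OF \<psi>, of "axis 2 1"] by metis
  have "AE x in lebesgue_on \<Omega>. \<bar>frechet_derivative \<psi> (at x) (\<beta> x)\<bar> \<le> B * C1 + B * C2"
    using B
  proof eventually_elim
    case (elim x)
    have c: "\<bar>\<beta> x $ i\<bar> \<le> B" for i using component_le_norm_cart[of "\<beta> x" i] elim by simp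
    then have "0 \<le> B" using abs_ge_zero[of "\<beta> x $ 1"] order_trans by blast
    have "\<bar>frechet_derivative \<psi> (at x) (\<beta> x)\<bar> \<le>
        \<bar>\<beta> x $ 1\<bar> * \<bar>frechet_derivative \<psi> (at x) (axis 1 1)\<bar> + \<bar>\<beta> x $ 2\<bar> * \<bar>frechet_derivative \<psi> (at x) (axis 2 1)\<bar>"
      unfolding frechet_derivative_expand[OF test_function_smooth[OF \<psi>], of x "\<beta> x"] abs_mult[symmetric]
      by (rule abs_triangle_ineq)
    also have "\<dots> \<le> B * C1 + B * C2"
      using c C1 C2 \<open>0 \<le> B\<close> by (intro add_mono mult_mono) auto
    finally show ?case .
  qed
  then show thesis using that by blast
qed

text \<open>The weak equation \<open>div (w \<beta>) = d\<close> tested with functions supported in \<open>N\<close>. The set \<open>N\<close> may extend beyond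
  \<open>\<Omega>\<close>: then the condition also states that \<open>w\<close> has zero trace on the part of the boundary inside \<open>N\<close>, wherever
  the flux is nonzero.\<close>

definition weak_on :: "(real^2) set \<Rightarrow> (real^2 \<Rightarrow> real) \<Rightarrow> (real^2 \<Rightarrow> real) \<Rightarrow> bool" where
  "weak_on N w d \<longleftrightarrow> (\<forall>\<psi>. test_function N \<psi> \<longrightarrow>
     (LINT x|lebesgue_on \<Omega>. w x * frechet_derivative \<psi> (at x) (\<beta> x) + d x * \<psi> x) = 0)"

lemma smooth_measurable_domain:
  "smooth \<psi> \<Longrightarrow> \<psi> \<in> borel_measurable (lebesgue_on \<Omega>)"
  by (intro borel_lebesgue_on smooth_borel_measurable(1))

lemma integrand_measurable:
  assumes "w \<in> borel_measurable (lebesgue_on \<Omega>)" "d \<in> borel_measurable (lebesgue_on \<Omega>)" "smooth \<psi>"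
  shows "(\<lambda>x. w x * frechet_derivative \<psi> (at x) (\<beta> x) + d x * \<psi> x) \<in> borel_measurable (lebesgue_on \<Omega>)"
  using assms flux_measurable[OF assms(3)] smooth_measurable_domain[OF assms(3)]
  by (intro borel_measurable_add borel_measurable_times)

lemma weak_on_cong:
  assumes "w \<in> borel_measurable (lebesgue_on \<Omega>)" "w' \<in> borel_measurable (lebesgue_on \<Omega>)"
    and "d \<in> borel_measurable (lebesgue_on \<Omega>)"
    and eq: "AE x in lebesgue_on \<Omega>. w x = w' x" and weak: "weak_on N w d"
  shows "weak_on N w' d"
  unfolding weak_on_def
proof (intro allI impI)
  fix \<psi> :: "real^2 \<Rightarrow> real" assume \<psi>: "test_function N \<psi>"
  note sm = test_function_smooth[OF \<psi>]
  have "(LINT x|lebesgue_on \<Omega>. w' x * frechet_derivative \<psi> (at x) (\<beta> x) + d x * \<psi> x) =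
      (LINT x|lebesgue_on \<Omega>. w x * frechet_derivative \<psi> (at x) (\<beta> x) + d x * \<psi> x)"
  proof (rule integral_cong_AE)
    show "AE x in lebesgue_on \<Omega>. w' x * frechet_derivative \<psi> (at x) (\<beta> x) + d x * \<psi> x =
        w x * frechet_derivative \<psi> (at x) (\<beta> x) + d x * \<psi> x"
      using eq by eventually_elim simp
  qed (rule integrand_measurable assms sm)+
  then show "(LINT x|lebesgue_on \<Omega>. w' x * frechet_derivative \<psi> (at x) (\<beta> x) + d x * \<psi> x) = 0"
    using weak \<psi> by (simp add: weak_on_def)
qed

lemma weak_on_of_weak_div:
  assumes w: "integrable (lebesgue_on \<Omega>) w" and d: "integrable (lebesgue_on \<Omega>) d"
    and div: "has_weak_div \<Omega> (\<lambda>x. w x *\<^sub>R \<beta> x) d"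
  shows "weak_on \<Omega> w d"
  unfolding weak_on_def
proof (intro allI impI)
  fix \<psi> :: "real^2 \<Rightarrow> real" assume \<psi>: "test_function \<Omega> \<psi>"
  note sm = test_function_smooth[OF \<psi>]
  obtain C where C: "AE x in lebesgue_on \<Omega>. \<bar>frechet_derivative \<psi> (at x) (\<beta> x)\<bar> \<le> C"
    using flux_bounded[OF \<psi>] .
  obtain K where K: "\<And>x. \<bar>\<psi> x\<bar> \<le> K" using test_function_bounded[OF \<psi>] by metis
  have i1: "integrable (lebesgue_on \<Omega>) (\<lambda>x. w x * frechet_derivative \<psi> (at x) (\<beta> x))"
  proof (rule Bochner_Integration.integrable_bound)
    show "integrable (lebesgue_on \<Omega>) (\<lambda>x. w x * C)" using w by simp
    show "(\<lambda>x. w x * frechet_derivative \<psi> (at x) (\<beta> x)) \<in> borel_measurable (lebesgue_on \<Omega>)"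
      using w flux_measurable[OF sm] by (intro borel_measurable_times) auto
    show "AE x in lebesgue_on \<Omega>. norm (w x * frechet_derivative \<psi> (at x) (\<beta> x)) \<le> norm (w x * C)"
      using C by eventually_elim (auto simp: abs_mult intro!: mult_left_mono)
  qed
  have i2: "integrable (lebesgue_on \<Omega>) (\<lambda>x. d x * \<psi> x)"
    by (rule integrable_mult_bounded_real[OF d smooth_measurable_domain[OF sm] K])
  have "(LINT x|lebesgue_on \<Omega>. w x * frechet_derivative \<psi> (at x) (\<beta> x)) = - (LINT x|lebesgue_on \<Omega>. d x * \<psi> x)"
    using div \<psi> frechet_derivative_scaleR[OF smooth_differentiable[OF sm]]
    unfolding has_weak_div_def by auto
  then show "(LINT x|lebesgue_on \<Omega>. w x * frechet_derivative \<psi> (at x) (\<beta> x) + d x * \<psi> x) = 0"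
    unfolding Bochner_Integration.integral_add[OF i1 i2] by simp
qed

lemma weak_on_integral:
  assumes "weak_on N w d" "test_function N \<psi>" "w \<in> borel_measurable (lebesgue_on \<Omega>)" "d \<in> borel_measurable (lebesgue_on \<Omega>)"
    "G \<in> borel_measurable borel"
    "AE x in lborel. G x = indicator \<Omega> x * (w x * frechet_derivative \<psi> (at x) (\<beta> x) + d x * \<psi> x)"
  shows "(LINT x|lborel. G x) = 0"
  using assms lebesgue_on_integral_eq(1)[OF domain_sets integrand_measurable[OF assms(3,4) test_function_smooth[OF assms(2)]] assms(5,6)]
  unfolding weak_on_def by auto

text \<open>The representation of \<open>w\<close> on \<open>T\<close> by its trace \<open>g\<close> on the exit edge. Integrability of \<open>g\<close> is not asked for up to the
  apex \<open>s = 0\<close>, where the streamlines shrink to a point.\<close>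

definition profile :: "(real^2) set \<Rightarrow> (real^2 \<Rightarrow> real) \<Rightarrow> real \<Rightarrow> (real \<Rightarrow> real) \<Rightarrow> bool" where
  "profile T w D g \<longleftrightarrow> g \<in> borel_measurable borel \<and> (\<forall>a>0. set_integrable lborel {a..1} g) \<and>
     (AE x in lborel. x \<in> cell_of T \<longrightarrow> w x = D * t_of T x + g (s_of T x))"

lemma profile_exists:
  assumes T: "T \<in> \<T>" and w: "integrable lborel w" "w \<in> borel_measurable borel"
    and d: "d \<in> borel_measurable (lebesgue_on \<Omega>)" "const_on T d D" and weak: "weak_on \<Omega> w d"
  shows "\<exists>g. profile T w D g"
proof -
  have wm: "w \<in> borel_measurable (lebesgue_on \<Omega>)"
    using w(2) by (rule borel_lebesgue_on)
  have [measurable]: "cell_of T \<in> sets borel" by (simp add: open_cell)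
  note [measurable] = w(2)
  have "(LINT x|lborel. indicator (cell_of T) x * (w x * frechet_derivative \<psi> (at x) (b T) + D * \<psi> x)) = 0"
    if \<psi>: "test_function (cell_of T) \<psi>" for \<psi>
  proof (rule weak_on_integral[OF weak test_function_mono[OF \<psi> cell_of_domain[OF T]] wm d(1)])
    note [measurable] = smooth_borel_measurable[OF test_function_smooth[OF \<psi>]]
    show "(\<lambda>x. indicator (cell_of T) x * (w x * frechet_derivative \<psi> (at x) (b T) + D * \<psi> x)) \<in> borel_measurable borel"
      by measurable
    show "AE x in lborel. indicator (cell_of T) x * (w x * frechet_derivative \<psi> (at x) (b T) + D * \<psi> x) =
        indicator \<Omega> x * (w x * frechet_derivative \<psi> (at x) (\<beta> x) + d x * \<psi> x)"
      using AE_on_cell_of[OF T d(2)]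
    proof eventually_elim
      case (elim x)
      then show ?case using test_function_outside[OF \<psi>, of x] by (cases "x \<in> cell_of T") auto
    qed
  qed
  from cell_profile[OF frameD(1,2)[OF T] w this] show ?thesis unfolding profile_def by blast
qed

text \<open>The trace on the entry edge of \<open>T'\<close>, reached from the exit edge after going back by the time \<open>\<tau> r\<close>, as a function of
  the parameter \<open>s\<close> on the exit edge of \<open>T\<close>. The parameter is reversed if the apices of \<open>T\<close> and \<open>T'\<close> are at
  different ends of the common edge.\<close>

definition entry_trace :: "(real^2) set \<Rightarrow> (real^2) set \<Rightarrow> real \<Rightarrow> (real \<Rightarrow> real) \<Rightarrow> real \<Rightarrow> real" where
  "entry_trace T T' D g s = (let r = if P T' = P T then s else 1 - s in g r - D * \<tau> T' * r)"

lemma set_integrable_reflect: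
  assumes "set_integrable lborel {1 - d..1 - c} (f :: real \<Rightarrow> real)"
  shows "set_integrable lborel {c..d} (\<lambda>s. f (1 - s))"
proof -
  have "integrable lborel (\<lambda>x. indicator {1 - d..1 - c} (1 + (- 1) * x) *\<^sub>R f (1 + (- 1) * x))"
    using assms unfolding set_integrable_def by (intro lborel_integrable_real_affine) auto
  moreover have "indicator {1 - d..1 - c} (1 + (- 1) * x) = (indicator {c..d} x :: real)" for x
    by (auto simp: indicator_def)
  ultimately show ?thesis by (simp add: set_integrable_def)
qed

lemma profile_set_integrable:
  assumes "profile T w D g" "0 < a" "c < 1"
  shows "set_integrable lborel {a..c} g"
proof (rule set_integrable_subset[of lborel "{a..1}" g "{a..c}"])
  show "set_integrable lborel {a..1} g" using assms by (simp add: profile_def)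
qed (use assms in auto)

lemma entry_trace_integrable:
  assumes "profile T' w D g" "0 < a" "c < 1"
  shows "set_integrable lborel {a..c} (entry_trace T T' D g)"
proof -
  let ?e = "\<lambda>s. g s - D * \<tau> T' * s"
  have e: "set_integrable lborel {a..c} ?e" if "0 < a" "c < 1" for a c
  proof (intro set_integral_diff(1) profile_set_integrable[OF assms(1) that])
    show "set_integrable lborel {a..c} (\<lambda>s. D * \<tau> T' * s)"
      by (intro borel_integrable_atLeastAtMost') (auto intro!: continuous_intros)
  qed
  have "set_integrable lborel {a..c} (\<lambda>s. ?e (1 - s))"
    by (rule set_integrable_reflect[of c a ?e]) (use assms in \<open>intro e; simp\<close>)
  then show ?thesis
    using e[OF assms(2,3)] unfolding entry_trace_def[abs_def] Let_def by (cases "P T' = P T") simp_all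
qed

text \<open>Across the common edge \<open>w\<close> is represented by \<open>g\<close> upstream and by the entry trace downstream, and the weak
  equation on the interface leaves no flux difference.\<close>

lemma match_interface:
  assumes T: "T \<in> \<T>" and T': "T' \<in> \<T>" "T' \<noteq> T" and sub: "exit_edge T \<subseteq> T'"
    and w: "w \<in> borel_measurable borel" and d: "d \<in> borel_measurable (lebesgue_on \<Omega>)"
    and dT: "const_on T d D" "const_on T' d D'" and weak: "weak_on \<Omega> w d"
    and g: "profile T w D g" and g': "profile T' w D' g'"
  shows "AE s in lborel. s \<in> {0<..<1} \<longrightarrow> g s = entry_trace T T' D' g' s"
proof -
  note J = frameD(1)[OF T] and flux = successor_flux[OF T T' sub]
  note int = interface[OF T T' sub] and sc = successor_coords[OF T T' sub]
  have J': "cross2 (u T) (b T') \<noteq> 0" "\<bar>cross2 (u T) (b T')\<bar> = \<bar>cross2 (u T) (b T)\<bar>" using flux J by auto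
  let ?e = "entry_trace T T' D' g'"
  have gm [measurable]: "g \<in> borel_measurable borel" "g' \<in> borel_measurable borel"
    using g g' by (auto simp: profile_def)
  have em [measurable]: "?e \<in> borel_measurable borel"
    unfolding entry_trace_def[abs_def] Let_def by (cases "P T' = P T") simp_all
  have wm: "w \<in> borel_measurable (lebesgue_on \<Omega>)"
    using w by (rule borel_lebesgue_on)
  show ?thesis
  proof (rule trace_match[OF J J' _ _ int(1) int(3)])
    show "set_integrable lborel {a..c} g" if "0 < a" "c < 1" for a c
      using profile_set_integrable[OF g that] .
    show "set_integrable lborel {a..c} ?e" if "0 < a" "c < 1" for a c
      using entry_trace_integrable[OF g' that] .
    fix \<psi> assume \<psi>: "test_function (interface T T') \<psi>"
    note [measurable] = smooth_borel_measurable[OF test_function_smooth[OF \<psi>]]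
    show "(LINT x|lborel. half_plane_flux (P T) (u T) (b T) D g \<psi> x -
        half_plane_flux (P T) (u T) (- b T') (- D') ?e \<psi> x) = 0"
    proof (rule weak_on_integral[OF weak test_function_mono[OF \<psi> int(2)] wm d])
      show "(\<lambda>x. half_plane_flux (P T) (u T) (b T) D g \<psi> x -
          half_plane_flux (P T) (u T) (- b T') (- D') ?e \<psi> x) \<in> borel_measurable borel"
        unfolding half_plane_flux_def by measurable
      have gx: "AE x in lborel. x \<in> cell_of T \<longrightarrow> w x = D * t_of T x + g (s_of T x)"
        using g by (simp add: profile_def)
      have g'x: "AE x in lborel. x \<in> cell_of T' \<longrightarrow> w x = D' * t_of T' x + g' (s_of T' x)"
        using g' by (simp add: profile_def)
      show "AE x in lborel. half_plane_flux (P T) (u T) (b T) D g \<psi> x -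
          half_plane_flux (P T) (u T) (- b T') (- D') ?e \<psi> x =
          indicator \<Omega> x * (w x * frechet_derivative \<psi> (at x) (\<beta> x) + d x * \<psi> x)"
        using AE_on_cell_of[OF T dT(1)] AE_on_cell_of[OF T'(1) dT(2)] gx g'x AE_tcoord_nonzero[OF J, of "P T"]
      proof eventually_elim
        case (elim x)
        let ?t = "t_of T x"
        have tt: "tcoord (P T) (u T) (- b T') x = - ?t" using flux by (simp add: tcoord_def)
        show ?case
        proof (cases "x \<in> interface T T'")
          case False
          then show ?thesis using test_function_outside[OF \<psi>, of x] by (simp add: half_plane_flux_def)
        next
          case True
          then have om: "indicator \<Omega> x = (1::real)" using int(2) by auto
          consider "?t < 0" | "?t > 0" using elim by linarith
          then show ?thesis
          proof cases
            case 1
            then have x: "x \<in> cell_of T" using int(4)[OF True] by blast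
            have bd: "\<beta> x = b T" "d x = D" and wx: "w x = D * ?t + g (s_of T x)"
              using elim x by blast+
            have h1: "half_plane_flux (P T) (u T) (b T) D g \<psi> x =
                w x * frechet_derivative \<psi> (at x) (\<beta> x) + d x * \<psi> x"
              unfolding half_plane_flux_def bd wx using 1 by (simp only: less_imp_le if_True)
            have h2: "half_plane_flux (P T) (u T) (- b T') (- D') ?e \<psi> x = 0"
              unfolding half_plane_flux_def tt using 1 by (simp only: neg_le_0_iff_le not_le[symmetric] if_False)
            show ?thesis unfolding om h1 h2 by simp
          next
            case 2
            then have x: "x \<in> cell_of T'" using int(5)[OF True] by simp
            have "?e (scoord (P T) (u T) (b T') x) =
                g' (s_of T' x) - D' * \<tau> T' * s_of T' x"
              using sc(2)[of x] sc(3)[of x] by (simp add: entry_trace_def Let_def)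
            have "t_of T' x = ?t - \<tau> T' * s_of T' x"
              using sc(1)[of x] by simp
            have wx: "w x = D' * ?t + ?e (scoord (P T) (u T) (b T') x)"
            proof -
              have "w x = D' * t_of T' x + g' (s_of T' x)"
                using elim x by blast
              with \<open>t_of T' x = _\<close> \<open>?e (scoord (P T) (u T) (b T') x) = _\<close>
              show ?thesis by (simp only:) (simp add: algebra_simps)
            qed
            have neg: "frechet_derivative \<psi> (at x) (- b T') = - frechet_derivative \<psi> (at x) (b T')"
              using frechet_derivative_scaleR[OF smooth_differentiable[OF test_function_smooth[OF \<psi>]], of x "- 1" "b T'"] by simp
            have bd: "\<beta> x = b T'" "d x = D'" using elim x by blast+
            have h1: "half_plane_flux (P T) (u T) (b T) D g \<psi> x = 0"
              unfolding half_plane_flux_def using 2 by (simp only: not_le[symmetric] if_False)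
            have "- ?t \<le> 0" using 2 by linarith
            then have h2: "half_plane_flux (P T) (u T) (- b T') (- D') ?e \<psi> x =
                (- D' * - ?t + ?e (scoord (P T) (u T) (b T') x)) * (- frechet_derivative \<psi> (at x) (b T')) + - D' * \<psi> x"
              unfolding half_plane_flux_def tt neg scoord_uminus by (simp only: if_True)
            show ?thesis unfolding om h1 h2 bd wx by (simp add: algebra_simps)
          qed
        qed
      qed
    qed
  qed auto
qed

text \<open>Downstream of the exit edge, \<open>w\<close> is continued by zero, and \<open>weak_on\<close> for a set reaching across the boundary is
  the weak equation for this continuation.\<close>

lemma match_outflow:
  assumes T: "T \<in> \<T>" and last: "\<forall>T'\<in>\<T>. exit_edge T \<subseteq> T' \<longrightarrow> T' = T"
    and w: "w \<in> borel_measurable borel" and d: "d \<in> borel_measurable (lebesgue_on \<Omega>)"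
    and dT: "const_on T d D" and weak: "weak_on (outflow_side T) w d"
    and g: "profile T w D g"
  shows "AE s in lborel. s \<in> {0<..<1} \<longrightarrow> g s = 0"
proof -
  note J = frameD(1)[OF T]
  note out = outflow_side[OF T last]
  have gm [measurable]: "g \<in> borel_measurable borel"
    using g by (auto simp: profile_def)
  have wm: "w \<in> borel_measurable (lebesgue_on \<Omega>)"
    using w by (rule borel_lebesgue_on)
  show ?thesis
  proof (rule trace_match[OF J J refl _ _ out(1) out(2)])
    show "set_integrable lborel {a..c} g" if "0 < a" "c < 1" for a c
      using profile_set_integrable[OF g that] .
    show "set_integrable lborel {a..c} (\<lambda>_. 0 :: real)" for a c :: real by (simp add: set_integrable_def)
    fix \<psi> assume \<psi>: "test_function (outflow_side T) \<psi>"
    note [measurable] = smooth_borel_measurable[OF test_function_smooth[OF \<psi>]]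
    show "(LINT x|lborel. half_plane_flux (P T) (u T) (b T) D g \<psi> x -
        half_plane_flux (P T) (u T) (- b T) 0 (\<lambda>_. 0) \<psi> x) = 0"
    proof (rule weak_on_integral[OF weak \<psi> wm d])
      show "(\<lambda>x. half_plane_flux (P T) (u T) (b T) D g \<psi> x -
          half_plane_flux (P T) (u T) (- b T) 0 (\<lambda>_. 0) \<psi> x) \<in> borel_measurable borel"
        unfolding half_plane_flux_def by measurable
      have gx: "AE x in lborel. x \<in> cell_of T \<longrightarrow> w x = D * t_of T x + g (s_of T x)"
        using g by (simp add: profile_def)
      show "AE x in lborel. half_plane_flux (P T) (u T) (b T) D g \<psi> x -
          half_plane_flux (P T) (u T) (- b T) 0 (\<lambda>_. 0) \<psi> x =
          indicator \<Omega> x * (w x * frechet_derivative \<psi> (at x) (\<beta> x) + d x * \<psi> x)"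
        using AE_on_cell_of[OF T dT] gx AE_tcoord_nonzero[OF J, of "P T"]
      proof eventually_elim
        case (elim x)
        let ?t = "t_of T x"
        show ?case
        proof (cases "x \<in> outflow_side T")
          case False
          then show ?thesis using test_function_outside[OF \<psi>, of x] by (simp add: half_plane_flux_def)
        next
          case True
          show ?thesis
          proof (cases "?t < 0")
            case t: True
            then have x: "x \<in> cell_of T" using out(3)[OF True] by blast
            have bd: "\<beta> x = b T" "d x = D" "x \<in> \<Omega>" and wx: "w x = D * ?t + g (s_of T x)"
              using elim x by blast+
            have h1: "half_plane_flux (P T) (u T) (b T) D g \<psi> x =
                w x * frechet_derivative \<psi> (at x) (\<beta> x) + d x * \<psi> x"
              unfolding half_plane_flux_def bd wx using t by (simp only: less_imp_le if_True)
            show ?thesis unfolding h1 half_plane_flux_def[of _ _ "- b T"] using bd(3) t by simp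
          next
            case False
            then have "x \<notin> \<Omega>" using out(4)[OF True] by simp
            moreover have "?t > 0" using elim False by linarith
            ultimately show ?thesis by (simp add: half_plane_flux_def)
          qed
        qed
      qed
    qed
  qed auto
qed

section \<open>Acyclicity and piecewise affine solutions\<close>

text \<open>For test functions that see only the outflow part of the boundary, the boundary integral in the definition
  of the trace vanishes.\<close>

lemma trace_weak:
  assumes w: "w \<in> graph_space_0out \<rho> \<beta> \<Omega>"
  obtains d where "d \<in> Lp \<rho> (lebesgue_on \<Omega>)" "has_weak_div \<Omega> (\<lambda>x. w x *\<^sub>R \<beta> x) d"
    "\<forall>N. (\<forall>x\<in>N. x \<in> frontier \<Omega> \<longrightarrow> normal_flux \<Omega> \<beta> x > 0) \<longrightarrow> weak_on N w d"
proof -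
  obtain \<gamma> where tr: "has_trace \<rho> \<beta> \<Omega> w \<gamma>"
    and ae: "AE x in flux_measure \<Omega> \<beta>. x \<in> outflow_boundary \<Omega> \<beta> \<longrightarrow> \<gamma> x = 0"
    using w by (auto simp: graph_space_0out_def)
  obtain d where d: "d \<in> Lp \<rho> (lebesgue_on \<Omega>)" "has_weak_div \<Omega> (\<lambda>x. w x *\<^sub>R \<beta> x) d"
    and ibp: "\<And>v. smooth v \<Longrightarrow> (LINT x|lebesgue_on \<Omega>. w x * frechet_derivative v (at x) (\<beta> x) + d x * v x) =
          (LINT x|arclength (frontier \<Omega>). \<gamma> x * v x * normal_flux \<Omega> \<beta> x)"
    using tr unfolding has_trace_def by blast
  have "(\<lambda>x. ennreal \<bar>normal_flux \<Omega> \<beta> x\<bar>) \<in> borel_measurable borel"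
    using normal_flux_measurable[OF open_domain] by simp
  then have "(\<lambda>x. ennreal \<bar>normal_flux \<Omega> \<beta> x\<bar>) \<in> borel_measurable (arclength (frontier \<Omega>))"
    by (simp cong: measurable_cong_sets)
  then have ae': "AE x in arclength (frontier \<Omega>). 0 < ennreal \<bar>normal_flux \<Omega> \<beta> x\<bar> \<longrightarrow>
      x \<in> outflow_boundary \<Omega> \<beta> \<longrightarrow> \<gamma> x = 0"
    using ae unfolding flux_measure_def by (simp only: AE_density)
  have "weak_on N w d" if N: "\<forall>x\<in>N. x \<in> frontier \<Omega> \<longrightarrow> normal_flux \<Omega> \<beta> x > 0" for N
    unfolding weak_on_def
  proof (intro allI impI)
    fix \<psi> assume \<psi>: "test_function N \<psi>"
    have "AE x in arclength (frontier \<Omega>). \<gamma> x * \<psi> x * normal_flux \<Omega> \<beta> x = 0"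
      using ae'
    proof eventually_elim
      case (elim x)
      show ?case
      proof (cases "normal_flux \<Omega> \<beta> x = 0 \<or> \<psi> x = 0")
        case False
        then have x: "x \<in> N" using test_function_outside(1)[OF \<psi>] by blast
        obtain b' \<nu> where "outward_normal \<Omega> x \<nu>" using False normal_flux_nonzeroE by blast
        then have fr: "x \<in> frontier \<Omega>" using outward_normal_frontier open_domain by blast
        then have "x \<in> outflow_boundary \<Omega> \<beta>" using N x fr by (simp add: outflow_boundary_def)
        then show ?thesis using elim False by simp
      qed auto
    qed
    then have "(LINT x|arclength (frontier \<Omega>). \<gamma> x * \<psi> x * normal_flux \<Omega> \<beta> x) = 0"
      by (rule integral_eq_zero_AE)
    then show "(LINT x|lebesgue_on \<Omega>. w x * frechet_derivative \<psi> (at x) (\<beta> x) + d x * \<psi> x) = 0"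
      using ibp[OF test_function_smooth[OF \<psi>]] by simp
  qed
  then show thesis using that d by blast
qed

lemma const_on_transfer:
  assumes T: "T \<in> \<T>" and eq: "AE x in lebesgue_on \<Omega>. d x = d' x" and c: "const_on T d c"
  shows "const_on T d' c"
proof -
  have "AE x in lborel. x \<in> \<Omega> \<longrightarrow> d x = d' x" using eq unfolding AE_lebesgue_on_iff[OF domain_sets] .
  moreover have "AE x in lborel. x \<in> T \<longrightarrow> d x = c"
    using c unfolding const_on_def AE_lebesgue_on_iff[OF mesh_sets(1)[OF T]] .
  ultimately have "AE x in lborel. x \<in> T \<longrightarrow> d' x = c"
    using AE_cell_of[OF T] by eventually_elim (use cell_of_domain[OF T] in auto)
  then show ?thesis unfolding const_on_def AE_lebesgue_on_iff[OF mesh_sets(1)[OF T]] .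
qed

text \<open>For bounded functions the trace is bounded, hence integrable up to the apex, so that its total flux is
  defined.\<close>

lemma profile_bounded:
  assumes T: "T \<in> \<T>" and g: "profile T w D g" and C: "AE x in lborel. \<bar>w x\<bar> \<le> C"
  shows "set_integrable lborel {0<..<1} g"
proof -
  note J = frameD(1)[OF T] and \<tau> = frameD(2)[OF T]
  have gm [measurable]: "g \<in> borel_measurable borel" using g by (simp add: profile_def)
  let ?C = "C + \<bar>D\<bar> * \<tau> T"
  have "AE x in lborel. x \<in> cell_of T \<longrightarrow> w x = D * t_of T x + g (s_of T x)"
    using g by (simp add: profile_def)
  then have "AE x in lborel. x \<in> cell_of T \<longrightarrow> \<bar>g (s_of T x)\<bar> \<le> ?C"
    using C
  proof eventually_elim
    case (elim x)
    show ?case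
    proof
      assume x: "x \<in> cell_of T"
      let ?s = "s_of T x" and ?t = "t_of T x"
      have st: "0 < ?s" "?s < 1" "- \<tau> T * ?s < ?t" "?t < 0" using x by (auto simp: cell_def)
      have "\<tau> T * ?s \<le> \<tau> T * 1" using st \<tau> by (intro mult_left_mono) auto
      then have "\<bar>?t\<bar> \<le> \<tau> T" using st by simp
      then have "\<bar>D * ?t\<bar> \<le> \<bar>D\<bar> * \<tau> T" unfolding abs_mult by (intro mult_left_mono) auto
      then show "\<bar>g ?s\<bar> \<le> ?C" using elim x by auto
    qed
  qed
  then have "AE s in lborel. s \<in> {0<..<1} \<longrightarrow> \<bar>g s\<bar> \<le> ?C"
    by (intro AE_scoord_cell[OF J \<tau>, of "\<lambda>s. \<bar>g s\<bar> \<le> ?C"]) simp_all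
  then have ae: "AE s in lborel. norm (indicator {0<..<1} s *\<^sub>R g s) \<le> norm (indicator {0<..<1} s * ?C)"
    by eventually_elim (auto simp: indicator_def)
  show ?thesis unfolding set_integrable_def
  proof (rule Bochner_Integration.integrable_bound[OF _ _ ae])
    show "integrable lborel (\<lambda>s::real. indicator {0<..<1} s * ?C)"
    proof (rule integrable_mult_left)
      show "integrable lborel (indicator {0<..<1} :: real \<Rightarrow> real)"
        by (simp add: integrable_indicator_iff)
    qed
  qed simp
qed

text \<open>The flux of \<open>h\<close> through the exit edge, where \<open>\<bar>cross2 u b\<bar>\<close> is the flux per unit of the parameter \<open>s\<close>.\<close>

definition exit_flux :: "((real^2) set \<Rightarrow> real \<Rightarrow> real) \<Rightarrow> (real^2) set \<Rightarrow> real" where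
  "exit_flux h T = \<bar>cross2 (u T) (b T)\<bar> * (LINT s:{0<..<1}|lborel. h T s)"

text \<open>The divergence theorem on \<open>T'\<close>: the flux entering \<open>T'\<close> differs from the flux leaving it by \<open>D\<close> times the area,
  and the flux entering \<open>T'\<close> is the flux leaving \<open>T\<close>.\<close>

lemma exit_flux_successor:
  assumes T: "T \<in> \<T>" and T': "T' \<in> \<T>" "T' \<noteq> T" and sub: "exit_edge T \<subseteq> T'"
    and match: "AE s in lborel. s \<in> {0<..<1} \<longrightarrow> h T s = entry_trace T T' D (h T') s"
    and h: "set_integrable lborel {0<..<1} (h T')" and D: "D < 0"
    and hm: "h T \<in> borel_measurable borel" "h T' \<in> borel_measurable borel"
  shows "exit_flux h T' < exit_flux h T"
proof -
  note [measurable] = hm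
  let ?e = "\<lambda>s. h T' s - D * \<tau> T' * s"
  have em [measurable]: "entry_trace T T' D (h T') \<in> borel_measurable borel"
    unfolding entry_trace_def[abs_def] Let_def by (cases "P T' = P T") simp_all
  have "(LINT s:{0<..<1}|lborel. h T s) = (LINT s:{0<..<1}|lborel. entry_trace T T' D (h T') s)"
    unfolding set_lebesgue_integral_def
  proof (rule integral_cong_AE)
    show "AE s in lborel. indicat_real {0<..<1} s *\<^sub>R h T s = indicat_real {0<..<1} s *\<^sub>R entry_trace T T' D (h T') s"
      using match by eventually_elim (auto simp: indicator_def)
  qed simp_all
  also have "\<dots> = (LINT s:{0<..<1}|lborel. ?e s)"
    using set_integral_reflect[of ?e] unfolding entry_trace_def Let_def by (cases "P T' = P T") simp_all
  also have "\<dots> = (LINT s:{0<..<1}|lborel. h T' s) - (LINT s:{0<..<1}|lborel. D * \<tau> T' * s)"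
    by (intro set_integral_diff(2) h set_integrable_mult_right set_integral_id(1))
  also have "(LINT s:{0<..<1}|lborel. D * \<tau> T' * s) = D * \<tau> T' / 2"
    using set_integral_id(2) by simp
  finally have eq: "(LINT s:{0<..<1}|lborel. h T s) = (LINT s:{0<..<1}|lborel. h T' s) - D * \<tau> T' / 2" .
  have "D * \<tau> T' < 0" using D frameD(2)[OF T'(1)] by (rule mult_neg_pos)
  then have "(LINT s:{0<..<1}|lborel. h T' s) < (LINT s:{0<..<1}|lborel. h T s)" unfolding eq by simp
  then show ?thesis
    unfolding exit_flux_def successor_coords(4)[OF T T' sub] using frameD(1)[OF T] by simp
qed

text \<open>Induction along the chain of successors. The function \<open>z\<close> with negative divergence has a strictly
  decreasing exit flux along this chain, so the chain ends, and it ends at the outflow boundary.\<close>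

lemma profile_affine:
  assumes z: "integrable lborel z" "z \<in> borel_measurable borel" "AE x in lborel. \<bar>z x\<bar> \<le> C"
    and wz: "weak_on \<Omega> z (\<lambda>_. D)" and D: "D < 0"
    and w: "integrable lborel w" "w \<in> borel_measurable borel" and d: "d \<in> borel_measurable (lebesgue_on \<Omega>)"
    and dT: "\<And>T. T \<in> \<T> \<Longrightarrow> const_on T d (c T)"
    and ww: "weak_on \<Omega> w d" and wo: "\<And>T. T \<in> \<T> \<Longrightarrow> \<forall>T'\<in>\<T>. exit_edge T \<subseteq> T' \<longrightarrow> T' = T \<Longrightarrow> weak_on (outflow_side T) w d"
    and g: "\<And>T. T \<in> \<T> \<Longrightarrow> profile T w (c T) (g T)"
    and T: "T \<in> \<T>"
  shows "\<exists>\<alpha> \<kappa>. AE s in lborel. s \<in> {0<..<1} \<longrightarrow> g T s = \<alpha> * s + \<kappa>"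
proof -
  have cD: "const_on T (\<lambda>_. D) D" for T by (simp add: const_on_def)
  have "\<forall>T\<in>\<T>. \<exists>h. profile T z D h"
    using profile_exists[OF _ z(1,2) _ cD wz] by simp
  then obtain h where h: "\<And>T. T \<in> \<T> \<Longrightarrow> profile T z D (h T)" by metis
  have decr: "exit_flux h T' < exit_flux h T"
    if "T \<in> \<T>" "T' \<in> \<T>" "T' \<noteq> T" "exit_edge T \<subseteq> T'" for T T'
  proof (rule exit_flux_successor[where D = D])
    show "T \<in> \<T>" "T' \<in> \<T>" "T' \<noteq> T" "exit_edge T \<subseteq> T'" "D < 0" by (rule that D)+
    show "set_integrable lborel {0<..<1} (h T')" by (rule profile_bounded[OF that(2) h[OF that(2)] z(3)])
    show "AE s in lborel. s \<in> {0<..<1} \<longrightarrow> h T s = entry_trace T T' D (h T') s"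
      by (rule match_interface[OF that z(2) _ cD cD wz h[OF that(1)] h[OF that(2)]]) simp
    show "h T \<in> borel_measurable borel" "h T' \<in> borel_measurable borel"
      using h[OF that(1)] h[OF that(2)] by (auto simp: profile_def)
  qed
  show ?thesis
    using T
  proof (induction "card {T'\<in>\<T>. exit_flux h T' < exit_flux h T}" arbitrary: T rule: less_induct)
    case less
    note T = less.prems
    show ?case
    proof (cases "\<exists>T'\<in>\<T>. T' \<noteq> T \<and> exit_edge T \<subseteq> T'")
      case True
      then obtain T' where T': "T' \<in> \<T>" "T' \<noteq> T" "exit_edge T \<subseteq> T'" by blast
      have lt: "exit_flux h T' < exit_flux h T" using decr[OF T T'] .
      have "{S\<in>\<T>. exit_flux h S < exit_flux h T'} \<subset> {S\<in>\<T>. exit_flux h S < exit_flux h T}"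
        using lt T'(1) by auto
      then have "card {S\<in>\<T>. exit_flux h S < exit_flux h T'} < card {S\<in>\<T>. exit_flux h S < exit_flux h T}"
        using finite_mesh by (intro psubset_card_mono) auto
      from less.hyps[OF this T'(1)] obtain \<alpha> \<kappa> where
        ak: "AE s in lborel. s \<in> {0<..<1} \<longrightarrow> g T' s = \<alpha> * s + \<kappa>" by blast
      have [measurable]: "g T' \<in> borel_measurable borel" using g[OF T'(1)] by (simp add: profile_def)
      have ak': "AE s in lborel. 1 + (-1) * s \<in> {0<..<1} \<longrightarrow> g T' (1 + (-1) * s) = \<alpha> * (1 + (-1) * s) + \<kappa>"
        by (rule AE_borel_affine[OF _ _ ak]) simp_all
      have m: "AE s in lborel. s \<in> {0<..<1} \<longrightarrow> g T s = entry_trace T T' (c T') (g T') s"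
        by (rule match_interface[OF T T' w(2) d dT[OF T] dT[OF T'(1)] ww g[OF T] g[OF T'(1)]])
      show ?thesis
      proof (cases "P T' = P T")
        case True
        have "AE s in lborel. s \<in> {0<..<1} \<longrightarrow> g T s = (\<alpha> - c T' * \<tau> T') * s + \<kappa>"
          using m ak by eventually_elim (use True in \<open>auto simp: entry_trace_def algebra_simps\<close>)
        then show ?thesis by blast
      next
        case False
        have "AE s in lborel. s \<in> {0<..<1} \<longrightarrow> g T s = (c T' * \<tau> T' - \<alpha>) * s + (\<alpha> + \<kappa> - c T' * \<tau> T')"
          using m ak' by eventually_elim (use False in \<open>auto simp: entry_trace_def Let_def algebra_simps\<close>)
        then show ?thesis by blast
      qed
    next
      case False
      then have last: "\<forall>T'\<in>\<T>. exit_edge T \<subseteq> T' \<longrightarrow> T' = T" by blast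
      have "AE s in lborel. s \<in> {0<..<1} \<longrightarrow> g T s = 0"
        by (rule match_outflow[OF T last w(2) d dT[OF T] wo[OF T last] g[OF T]])
      then have "AE s in lborel. s \<in> {0<..<1} \<longrightarrow> g T s = 0 * s + 0" by simp
      then show ?thesis by blast
    qed
  qed
qed

text \<open>Replaces a function on \<open>\<Omega>\<close> by a Borel function on the plane that vanishes almost everywhere outside \<open>\<Omega>\<close>, as
  required for Fubini's theorem and changes of coordinates.\<close>

lemma borel_version:
  assumes w: "integrable (lebesgue_on \<Omega>) \<phi>"
  obtains w where "integrable lborel w" "w \<in> borel_measurable borel" "AE x in lborel. w x = indicator \<Omega> x * \<phi> x"
    "\<forall>N d. d \<in> borel_measurable (lebesgue_on \<Omega>) \<longrightarrow> weak_on N \<phi> d \<longrightarrow> weak_on N w d"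
proof -
  have \<phi>m: "\<phi> \<in> borel_measurable (lebesgue_on \<Omega>)" using w by auto
  obtain w where w1: "w \<in> borel_measurable borel" and w2: "AE x in lborel. w x = indicator \<Omega> x * \<phi> x"
    using borel_representative[OF domain_sets \<phi>m] .
  have wm: "w \<in> borel_measurable (lebesgue_on \<Omega>)"
    using w1 by (rule borel_lebesgue_on)
  have "AE x in lborel. x \<in> \<Omega> \<longrightarrow> \<phi> x = w x" using w2 by eventually_elim simp
  then have eq: "AE x in lebesgue_on \<Omega>. \<phi> x = w x" unfolding AE_lebesgue_on_iff[OF domain_sets] .
  show thesis
  proof (rule that[OF _ w1 w2])
    show "integrable lborel w" using lebesgue_on_integral_eq(2)[OF domain_sets \<phi>m w1 w2] w by simp
    show "\<forall>N d. d \<in> borel_measurable (lebesgue_on \<Omega>) \<longrightarrow> weak_on N \<phi> d \<longrightarrow> weak_on N w d"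
      using weak_on_cong[OF \<phi>m wm _ eq] by blast
  qed
qed

text \<open>The divergence occurring in the trace formula is the given one, by uniqueness of weak divergences, hence
  constant on each triangle.\<close>

lemma S_space_piecewise_affine:
  assumes \<phi>: "\<phi> \<in> graph_space_0out \<rho> \<beta> \<Omega>" and \<rho>: "1 \<le> \<rho>"
    and \<eta>: "\<eta> \<in> P0_mesh \<Omega> \<T>" and div: "has_weak_div \<Omega> (\<lambda>x. \<phi> x *\<^sub>R \<beta> x) (\<lambda>x. - \<eta> x)"
    and fill: "filling \<Omega> \<beta>" and T: "T \<in> \<T>"
  shows "\<exists>a c. AE x in lebesgue_on T. \<phi> x = a \<bullet> x + c"
proof -
  interpret finite_measure "lebesgue_on \<Omega>" by (rule finite_measure_domain)
  have \<phi>i: "integrable (lebesgue_on \<Omega>) \<phi>"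
    using \<phi> \<rho> by (intro Lp_integrable) (auto simp: graph_space_0out_def graph_space_def)
  obtain d where d: "d \<in> Lp \<rho> (lebesgue_on \<Omega>)" "has_weak_div \<Omega> (\<lambda>x. \<phi> x *\<^sub>R \<beta> x) d"
    and dN: "\<forall>N. (\<forall>x\<in>N. x \<in> frontier \<Omega> \<longrightarrow> normal_flux \<Omega> \<beta> x > 0) \<longrightarrow> weak_on N \<phi> d"
    by (rule trace_weak[OF \<phi>])
  have di: "integrable (lebesgue_on \<Omega>) d" by (rule Lp_integrable[OF d(1) \<rho>])
  have dm: "d \<in> borel_measurable (lebesgue_on \<Omega>)" using di by auto
  have "integrable (lebesgue_on \<Omega>) (\<lambda>x. - \<eta> x)"
    using \<eta> by (intro Bochner_Integration.integrable_minus Lp_integrable[of _ \<infinity>]) (auto simp: P0_mesh_def)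
  from weak_div_unique[OF open_domain this di div d(2)]
  have d\<eta>: "AE x in lebesgue_on \<Omega>. - \<eta> x = d x" .
  have "\<exists>c. const_on S d c" if S: "S \<in> \<T>" for S
  proof -
    obtain c where "const_on S \<eta> c" using \<eta> S by (auto simp: P0_mesh_def)
    then have "const_on S (\<lambda>x. - \<eta> x) (- c)" by (simp add: const_on_def)
    then show ?thesis using const_on_transfer[OF S d\<eta>] by blast
  qed
  then obtain c where c: "\<And>S. S \<in> \<T> \<Longrightarrow> const_on S d (c S)" by metis
  obtain w where w: "integrable lborel w" "w \<in> borel_measurable borel" "AE x in lborel. w x = indicator \<Omega> x * \<phi> x"
    and wN: "\<forall>N d. d \<in> borel_measurable (lebesgue_on \<Omega>) \<longrightarrow> weak_on N \<phi> d \<longrightarrow> weak_on N w d"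
    by (rule borel_version[OF \<phi>i])
  have ww: "weak_on \<Omega> w d" using wN dm weak_on_of_weak_div[OF \<phi>i di d(2)] by blast
  have wo: "weak_on (outflow_side S) w d" if "S \<in> \<T>" "\<forall>T'\<in>\<T>. exit_edge S \<subseteq> T' \<longrightarrow> T' = S" for S
    using wN dm dN outflow_side(5)[OF that] by blast
  have "\<exists>g. profile S w (c S) g" if "S \<in> \<T>" for S
    by (rule profile_exists[OF that w(1,2) dm c[OF that] ww])
  then obtain g where g: "\<And>S. S \<in> \<T> \<Longrightarrow> profile S w (c S) (g S)" by metis
  \<comment> \<open>Any right-hand side allowed by the filling condition would serve; 2 is one of them.\<close>
  obtain \<zeta> where \<zeta>: "\<zeta> \<in> graph_space_0out \<infinity> \<beta> \<Omega>" "has_weak_div \<Omega> (\<lambda>x. \<zeta> x *\<^sub>R \<beta> x) (\<lambda>_. - 2)"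
    using fill unfolding filling_def by (meson one_less_numeral_iff semiring_norm(76))
  have \<zeta>L: "\<zeta> \<in> Lp \<infinity> (lebesgue_on \<Omega>)" using \<zeta>(1) by (simp add: graph_space_0out_def graph_space_def)
  then obtain C where C: "AE x in lebesgue_on \<Omega>. norm (\<zeta> x) \<le> C" by (auto simp: Lp_def)
  have \<zeta>i: "integrable (lebesgue_on \<Omega>) \<zeta>" by (rule Lp_integrable[OF \<zeta>L]) simp
  obtain z where z: "integrable lborel z" "z \<in> borel_measurable borel" "AE x in lborel. z x = indicator \<Omega> x * \<zeta> x"
    and zN: "\<forall>N d. d \<in> borel_measurable (lebesgue_on \<Omega>) \<longrightarrow> weak_on N \<zeta> d \<longrightarrow> weak_on N z d"
    by (rule borel_version[OF \<zeta>i])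
  have "AE x in lborel. x \<in> \<Omega> \<longrightarrow> norm (\<zeta> x) \<le> C" using C unfolding AE_lebesgue_on_iff[OF domain_sets] .
  then have zC: "AE x in lborel. \<bar>z x\<bar> \<le> \<bar>C\<bar>" using z(3) by eventually_elim (auto simp: indicator_def)
  have zw: "weak_on \<Omega> z (\<lambda>_. - 2)" 
    using zN weak_on_of_weak_div[OF \<zeta>i _ \<zeta>(2)] by simp
  have neg: "- 2 < (0 :: real)" by simp
  have "\<exists>\<alpha> \<kappa>. AE s in lborel. s \<in> {0<..<1} \<longrightarrow> g T s = \<alpha> * s + \<kappa>"
    using z(1,2) zC zw neg w(1,2) dm c ww wo g T by (rule profile_affine)
  then obtain \<alpha> \<kappa> where ak: "AE s in lborel. s \<in> {0<..<1} \<longrightarrow> g T s = \<alpha> * s + \<kappa>" by blast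
  have [measurable]: "g T \<in> borel_measurable borel" using g[OF T] by (simp add: profile_def)
  have "AE x in lborel. s_of T x \<in> {0<..<1} \<longrightarrow>
      g T (s_of T x) = \<alpha> * s_of T x + \<kappa>"
    by (rule AE_scoord[OF frameD(1)[OF T] ak]) simp
  moreover have "AE x in lborel. x \<in> cell_of T \<longrightarrow> w x = c T * t_of T x + g T (s_of T x)"
    using g[OF T] by (simp add: profile_def)
  ultimately have "AE x in lborel. x \<in> T \<longrightarrow>
      \<phi> x = c T * t_of T x + (\<alpha> * s_of T x + \<kappa>)"
    using w(3) AE_cell_of[OF T]
  proof eventually_elim
    case (elim x)
    show ?case
    proof
      assume "x \<in> T"
      then have x: "x \<in> cell_of T" using elim by blast
      then have "w x = \<phi> x" using elim(3) cell_of_domain[OF T] by auto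
      moreover have "s_of T x \<in> {0<..<1}" using x by (simp add: cell_def)
      ultimately show "\<phi> x = c T * t_of T x + (\<alpha> * s_of T x + \<kappa>)"
        using elim(1,2) x by simp
    qed
  qed
  moreover obtain a' c' where "\<And>x. c T * t_of T x + (\<alpha> * s_of T x + \<kappa>) = a' \<bullet> x + c'"
    using affine_of_coords by metis
  ultimately show ?thesis unfolding AE_lebesgue_on_iff[OF mesh_sets(1)[OF T]] by auto
qed

text \<open>An affine function has the form \<open>D t + g(s)\<close> with \<open>D = a \<bullet> b\<close> and \<open>g\<close> affine, so it solves the weak equation with
  the constant \<open>D\<close> inside the triangle. Subtracting this from the weak equation with \<open>d\<close> leaves \<open>d - D\<close>
  orthogonal to all test functions.\<close>

lemma weak_div_of_affine:
  assumes T: "T \<in> \<T>" and w: "integrable lborel w" "w \<in> borel_measurable borel"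
    and d: "integrable (lebesgue_on \<Omega>) d" and weak: "weak_on \<Omega> w d"
    and aff: "AE x in lborel. x \<in> cell_of T \<longrightarrow> w x = a \<bullet> x + c"
  shows "const_on T d (a \<bullet> b T)"
proof -
  note J = frameD(1)[OF T]
  let ?D = "a \<bullet> b T"
  let ?g = "\<lambda>s. indicator {0..1} s *\<^sub>R (a \<bullet> (P T + s *\<^sub>R u T) + c)"
  have dm: "d \<in> borel_measurable (lebesgue_on \<Omega>)" using d by auto
  have wm: "w \<in> borel_measurable (lebesgue_on \<Omega>)"
    using w(2) by (rule borel_lebesgue_on)
  have gi: "integrable lborel ?g"
    unfolding set_integrable_def[symmetric]
    by (intro borel_integrable_atLeastAtMost') (auto intro!: continuous_intros)
  have [measurable]: "cell_of T \<in> sets borel" by (simp add: open_cell)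
  obtain e where em [measurable]: "e \<in> borel_measurable borel" and e: "AE x in lborel. e x = indicator \<Omega> x * d x"
    using borel_representative[OF domain_sets dm] .
  have ei: "integrable lborel e" using lebesgue_on_integral_eq(2)[OF domain_sets dm em e] d by simp
  have "bounded (cell_of T)" using cell_of_domain[OF T] bounded_domain bounded_subset by blast
  then have "emeasure lborel (cell_of T) < \<infinity>" by (rule emeasure_bounded_finite)
  then have ci: "integrable lborel (indicat_real (cell_of T))" by (simp add: integrable_indicator_iff)
  define f where "f x = indicator (cell_of T) x * (e x - ?D)" for x
  have fm [measurable]: "f \<in> borel_measurable borel" unfolding f_def by measurable
  have fi: "integrable lborel f"
  proof -
    have "f = (\<lambda>x. indicator (cell_of T) x *\<^sub>R e x - indicator (cell_of T) x * ?D)"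
      by (auto simp: f_def algebra_simps)
    then show ?thesis
      using integrable_mult_indicator[of "cell_of T" lborel e] ei ci
      by (simp only:) (intro Bochner_Integration.integrable_diff integrable_mult_left; simp)
  qed
  have "AE x in lborel. x \<in> cell_of T \<longrightarrow> f x = 0"
  proof (rule fundamental_lemma[OF fi fm open_cell])
    fix \<psi> assume \<psi>: "test_function (cell_of T) \<psi>"
    note [measurable] = smooth_borel_measurable[OF test_function_smooth[OF \<psi>]]
    let ?h = "half_plane_flux (P T) (u T) (b T) ?D ?g \<psi>"
    obtain K where K: "\<And>x. \<bar>\<psi> x\<bar> \<le> K" using test_function_bounded[OF \<psi>] by metis
    have i1: "integrable lborel (\<lambda>x. f x * \<psi> x)"
      by (rule integrable_mult_bounded_real[OF fi _ K]) simp
    have i2: "integrable lborel ?h"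
      by (rule half_plane_flux_integral(1)[OF J test_function_mono[OF \<psi>] gi]) simp
    have "(LINT x|lborel. f x * \<psi> x + ?h x) = 0"
    proof (rule weak_on_integral[OF weak test_function_mono[OF \<psi> cell_of_domain[OF T]] wm dm])
      show "(\<lambda>x. f x * \<psi> x + ?h x) \<in> borel_measurable borel"
        using i2 by (intro borel_measurable_add borel_measurable_times fm) (auto dest: borel_measurable_integrable)
      show "AE x in lborel. f x * \<psi> x + ?h x =
          indicator \<Omega> x * (w x * frechet_derivative \<psi> (at x) (\<beta> x) + d x * \<psi> x)"
        using AE_on_cell_of[OF T frameD(4)[OF T]] aff e
      proof eventually_elim
        case (elim x)
        show ?case
        proof (cases "x \<in> cell_of T")
          case False
          then show ?thesis using test_function_outside[OF \<psi> False] by (simp add: half_plane_flux_cell[OF \<psi>])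
        next
          case True
          then have s: "s_of T x \<in> {0..1}" by (simp add: cell_def)
          have x: "x = frame_pt (P T) (u T) (b T) (s_of T x, t_of T x)"
            using frame_coords[OF J] by simp
          have "a \<bullet> x = a \<bullet> (P T + s_of T x *\<^sub>R u T) + t_of T x * ?D"
            by (subst x) (simp add: frame_pt_def inner_add_right)
          then have "w x = ?D * t_of T x + ?g (s_of T x)"
            using elim(2) True s by simp
          moreover have "\<beta> x = b T" "indicator \<Omega> x = (1::real)" "e x = d x"
            using elim(1,3) True by auto
          ultimately show ?thesis
            unfolding half_plane_flux_cell[OF \<psi>] f_def using True by (simp add: algebra_simps)
        qed
      qed
    qed
    then show "(LINT x|lborel. f x * \<psi> x) = 0"
      unfolding Bochner_Integration.integral_add[OF i1 i2] cell_flux_zero[OF J \<psi> gi] by simp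
  qed
  then have "AE x in lborel. x \<in> T \<longrightarrow> d x = ?D"
    using e AE_cell_of[OF T]
  proof eventually_elim
    case (elim x)
    then show ?case using cell_of_domain[OF T] by (auto simp: f_def)
  qed
  then show ?thesis unfolding const_on_def AE_lebesgue_on_iff[OF mesh_sets(1)[OF T]] .
qed

text \<open>A function that is constant on each of finitely many triangles is bounded, so the divergence found triangle by
  triangle belongs to the space of piecewise constant functions.\<close>

lemma piecewise_affine_S_space:
  assumes \<phi>: "\<phi> \<in> graph_space_0out \<rho> \<beta> \<Omega>" and \<rho>: "1 \<le> \<rho>"
    and aff: "\<forall>T\<in>\<T>. \<exists>a c. AE x in lebesgue_on T. \<phi> x = a \<bullet> x + c"
  shows "\<exists>\<eta>\<in>P0_mesh \<Omega> \<T>. has_weak_div \<Omega> (\<lambda>x. \<phi> x *\<^sub>R \<beta> x) (\<lambda>x. - \<eta> x)"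
proof -
  interpret finite_measure "lebesgue_on \<Omega>" by (rule finite_measure_domain)
  have \<phi>i: "integrable (lebesgue_on \<Omega>) \<phi>"
    using \<phi> \<rho> by (intro Lp_integrable) (auto simp: graph_space_0out_def graph_space_def)
  obtain d where d: "d \<in> Lp \<rho> (lebesgue_on \<Omega>)" "has_weak_div \<Omega> (\<lambda>x. \<phi> x *\<^sub>R \<beta> x) d"
    using \<phi> by (auto simp: graph_space_0out_def graph_space_def)
  have di: "integrable (lebesgue_on \<Omega>) d" by (rule Lp_integrable[OF d(1) \<rho>])
  have dm: "d \<in> borel_measurable (lebesgue_on \<Omega>)" using di by auto
  obtain w where w: "integrable lborel w" "w \<in> borel_measurable borel" "AE x in lborel. w x = indicator \<Omega> x * \<phi> x"
    and wN: "\<forall>N d. d \<in> borel_measurable (lebesgue_on \<Omega>) \<longrightarrow> weak_on N \<phi> d \<longrightarrow> weak_on N w d"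
    by (rule borel_version[OF \<phi>i])
  have ww: "weak_on \<Omega> w d" using wN dm weak_on_of_weak_div[OF \<phi>i di d(2)] by blast
  have "\<exists>k. const_on T d k" if T: "T \<in> \<T>" for T
  proof -
    obtain a c where "AE x in lebesgue_on T. \<phi> x = a \<bullet> x + c" using aff T by blast
    then have "AE x in lborel. x \<in> T \<longrightarrow> \<phi> x = a \<bullet> x + c" unfolding AE_lebesgue_on_iff[OF mesh_sets(1)[OF T]] .
    then have "AE x in lborel. x \<in> cell_of T \<longrightarrow> w x = a \<bullet> x + c"
      using w(3)
    proof eventually_elim
      case (elim x)
      then show ?case using cell_of_domain[OF T] cell_of_subset[OF T] by auto
    qed
    from weak_div_of_affine[OF T w(1,2) di ww this] show ?thesis by blast
  qed
  then obtain k where k: "\<And>T. T \<in> \<T> \<Longrightarrow> const_on T d (k T)" by metis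
  have "AE x in lborel. \<forall>T\<in>\<T>. x \<in> T \<longrightarrow> d x = k T"
  proof (rule AE_finite_allI[OF finite_mesh])
    fix T assume "T \<in> \<T>"
    then show "AE x in lborel. x \<in> T \<longrightarrow> d x = k T"
      using k[of T] mesh_sets(1)[of T] by (simp add: const_on_def AE_lebesgue_on_iff)
  qed
  then have "AE x in lborel. x \<in> \<Omega> \<longrightarrow> norm (- d x) \<le> (\<Sum>T\<in>\<T>. \<bar>k T\<bar>)"
  proof eventually_elim
    case (elim x)
    show ?case
    proof
      assume "x \<in> \<Omega>"
      then obtain T where T: "T \<in> \<T>" "x \<in> T" using mesh_cover closure_subset by blast
      then have "norm (- d x) = \<bar>k T\<bar>" using elim by simp
      also have "\<dots> \<le> (\<Sum>T\<in>\<T>. \<bar>k T\<bar>)" using finite_mesh T(1) by (intro member_le_sum) auto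
      finally show "norm (- d x) \<le> (\<Sum>T\<in>\<T>. \<bar>k T\<bar>)" .
    qed
  qed
  then have "AE x in lebesgue_on \<Omega>. norm (- d x) \<le> (\<Sum>T\<in>\<T>. \<bar>k T\<bar>)"
    unfolding AE_lebesgue_on_iff[OF domain_sets] .
  then have "(\<lambda>x. - d x) \<in> Lp \<infinity> (lebesgue_on \<Omega>)"
    using dm unfolding Lp_def by auto
  moreover have "\<exists>c. const_on T (\<lambda>x. - d x) c" if "T \<in> \<T>" for T
    using k[OF that] by (auto simp: const_on_def intro!: exI[of _ "- k T"])
  ultimately have "(\<lambda>x. - d x) \<in> P0_mesh \<Omega> \<T>" by (simp add: P0_mesh_def)
  then show ?thesis using d(2) by (intro bexI[of _ "\<lambda>x. - d x"]) simp_all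
qed

end

section \<open>The two discrete spaces\<close>

theorem proposition5p10:
  fixes p q :: real
    and \<Omega> :: "(real^2) set"
    and \<T> :: "(real^2) set set"
    and \<beta> :: "real^2 \<Rightarrow> real^2"
    and \<mu> :: "real^2 \<Rightarrow> real"
  assumes "1 < p" and "inverse p + inverse q = 1"
    and "polygonal_lipschitz_domain \<Omega>"
    and "simplicial_mesh \<Omega> \<T>"
    and "AE x in lebesgue_on \<Omega>. \<mu> x = 0"
    and "\<beta> \<in> Lp \<infinity> (lebesgue_on \<Omega>)"
    and "has_weak_div \<Omega> \<beta> (\<lambda>_. 0)"
    and "filling \<Omega> \<beta>"
    and "well_separated \<Omega> \<beta>"
    and "\<forall>T \<in> \<T>. \<exists>b. const_on T \<beta> b"
    and "normal_jump_free \<T> \<beta>"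
    and "flow_aligned \<T> \<beta>"
  shows "S_space q \<beta> \<Omega> \<T> = P1_conf q \<beta> \<Omega> \<T>"
proof -
  have "\<exists>z. flow_frame \<beta> T (fst z) (fst (snd z)) (fst (snd (snd z))) (snd (snd (snd z)))" if T: "T \<in> \<T>" for T
  proof -
    obtain b where cb: "const_on T \<beta> b" using assms(10) T by blast
    have sT: "2 simplex T" using assms(4) T by (simp add: simplicial_mesh_def)
    have tf: "\<exists>!F. tangential_face \<beta> T F" using assms(12) T by (simp add: flow_aligned_def)
    obtain P u \<tau> where "flow_frame \<beta> T P u b \<tau>" using flow_frame_exists[OF sT cb tf] by blast
    then show ?thesis by (intro exI[of _ "(P, u, b, \<tau>)"]) simp
  qed
  then obtain z where z: "\<And>T. T \<in> \<T> \<Longrightarrow>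
      flow_frame \<beta> T (fst (z T)) (fst (snd (z T))) (fst (snd (snd (z T)))) (snd (snd (snd (z T))))"
    by metis
  have dom: "open \<Omega>" "bounded \<Omega>" "lipschitz_boundary \<Omega>"
    using assms(3) by (auto simp: polygonal_lipschitz_domain_def)
  interpret flow_field \<Omega> \<T> \<beta> "\<lambda>T. fst (z T)" "\<lambda>T. fst (snd (z T))" "\<lambda>T. fst (snd (snd (z T)))" "\<lambda>T. snd (snd (snd (z T)))"
    using dom lipschitz_interior_closure[OF dom(1,3)] assms(4,6,11) z by unfold_locales
  have "inverse p < 1" "0 < inverse p" using assms(1) by (auto simp: inverse_less_1_iff)
  then have "0 < inverse q" "inverse q < 1" using assms(2) by linarith+
  then have "1 \<le> q" by (simp add: inverse_less_1_iff)
  then have q: "1 \<le> ereal q" by simp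
  show ?thesis
  proof (intro equalityI subsetI)
    fix \<phi> assume "\<phi> \<in> S_space q \<beta> \<Omega> \<T>"
    then show "\<phi> \<in> P1_conf q \<beta> \<Omega> \<T>"
      using S_space_piecewise_affine[OF _ q _ _ assms(8)] by (auto simp: S_space_def P1_conf_def)
  next
    fix \<phi> assume "\<phi> \<in> P1_conf q \<beta> \<Omega> \<T>"
    then show "\<phi> \<in> S_space q \<beta> \<Omega> \<T>"
      using piecewise_affine_S_space[OF _ q] by (auto simp: S_space_def P1_conf_def)
  qed
qed

end
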